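(* Let $\kappa>0$, let $\alpha$ satisfy Conditions C1 and C2, let $s>9/2$ and $f\in C^{[s]+1}(\mathbb{R})$ with $f(0)=0$. Let $u\in C^1([0,T],H^s(\mathbb{R}))$ be the solution of $u_t+\alpha'\ast f(u)+\kappa\,\alpha'''\ast u=0$, $u(x,0)=\varphi(x)$, with $\varphi\in H^s(\mathbb{R})$. Then for all sufficiently small $h>0$ and $\epsilon>0$ there is a positive integer $N$ such that the solution $\mathbf{u}^N_h$ of the finite system $$\frac{dv^N_i}{dt}=-\sum_{j=-N}^{N}h\,\alpha'(x_i-x_j)f(v^N_j)-\kappa\sum_{j=-N}^{N}h\,(D_h^2\boldsymbol{\alpha}'_h)_{i-j}\,v^N_j,\qquad -N\le i\le N,$$ with initial value $\mathbf{u}^N_h(0)=\mathcal{T}^N\boldsymbol{\varphi}_h$ exists for $t\in[0,T]$ and $$\big|u(ih,t)-(\mathbf{u}^N_h)_i(t)\big|\le C(h^2+\epsilon),\qquad t\in[0,T],\ -N\le i\le N,$$ with $C$ independent of $h$, $\epsilon$ and $N$.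
   Context: Condition C1: $\alpha\in W^{2,1}(\mathbb{R})$. Condition C2: the distributional third derivative $\alpha'''=\mu$ is a finite Borel measure on $\mathbb{R}$. Grid $x_i=ih$; $\boldsymbol{\alpha}'_h=(\alpha'(ih))_{i\in\mathbb{Z}}$; $(D_h^2\mathbf{u})_i=h^{-2}(u_{i+1}-2u_i+u_{i-1})$; $\boldsymbol{\varphi}_h=(\varphi(ih))_{i\in\mathbb{Z}}$; $\mathcal{T}^N\mathbf{v}=(v_{-N},\dots,v_N)$. $[s]$ is the integer part of $s$. *)

theory Defs
  imports "HOL-Analysis.Analysis"
begin

definition test_fun :: "(real \<Rightarrow> real) \<Rightarrow> bool" where
  "test_fun \<phi> \<longleftrightarrow> (\<forall>n x. ((deriv ^^ n) \<phi>) differentiable (at x))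
                  \<and> (\<exists>R. \<forall>x. R < \<bar>x\<bar> \<longrightarrow> \<phi> x = 0)"

text \<open>Condition C1: alpha in W^{2,1}(R), taken in its C^1 representative:
  alpha and alpha' = deriv alpha integrable, alpha' absolutely continuous with
  an integrable derivative alpha''.\<close>
definition cond_C1 :: "(real \<Rightarrow> real) \<Rightarrow> bool" where
  "cond_C1 \<alpha> \<longleftrightarrow> integrable lborel \<alpha>
     \<and> (\<forall>x. \<alpha> differentiable (at x))
     \<and> integrable lborel (deriv \<alpha>)
     \<and> (\<exists>g. integrable lborel g \<and>
           (\<forall>a b. a \<le> b \<longrightarrow> deriv \<alpha> b - deriv \<alpha> a = (LBINT y:{a..b}. g y)))"

text \<open>Condition C2: the distributional third derivative of alpha is the finite
  (signed) Borel measure mu = M1 - M2.\<close>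
definition cond_C2 :: "(real \<Rightarrow> real) \<Rightarrow> real measure \<Rightarrow> real measure \<Rightarrow> bool" where
  "cond_C2 \<alpha> M1 M2 \<longleftrightarrow> finite_measure M1 \<and> finite_measure M2
     \<and> sets M1 = sets borel \<and> sets M2 = sets borel
     \<and> (\<forall>\<phi>. test_fun \<phi> \<longrightarrow>
          (LBINT x. \<alpha> x * (deriv ^^ 3) \<phi> x) = - ((\<integral>x. \<phi> x \<partial>M1) - (\<integral>x. \<phi> x \<partial>M2)))"

text \<open>Fourier-side representation: g is a (weighted-L^2) Fourier transform of v,
  v being the continuous representative given by the inverse Fourier integral
  (well-defined for s > 1/2).\<close>
definition Hs_rep :: "real \<Rightarrow> (real \<Rightarrow> real) \<Rightarrow> (real \<Rightarrow> complex) \<Rightarrow> bool" where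
  "Hs_rep s v g \<longleftrightarrow> g \<in> borel_measurable lborel
     \<and> integrable lborel (\<lambda>\<xi>. (1 + \<xi>\<^sup>2) powr s * (cmod (g \<xi>))\<^sup>2)
     \<and> (\<forall>x. complex_of_real (v x) =
            (LINT \<xi>|lborel. g \<xi> * exp (\<i> * complex_of_real (\<xi> * x))) / complex_of_real (2 * pi))"

definition in_Hs :: "real \<Rightarrow> (real \<Rightarrow> real) \<Rightarrow> bool" where
  "in_Hs s v \<longleftrightarrow> (\<exists>g. Hs_rep s v g)"

definition Hs_norm :: "real \<Rightarrow> (real \<Rightarrow> real) \<Rightarrow> real" where
  "Hs_norm s v = sqrt ((LBINT \<xi>. (1 + \<xi>\<^sup>2) powr s * (cmod ((SOME g. Hs_rep s v g) \<xi>))\<^sup>2) / (2 * pi))"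

definition C1_Hs :: "real \<Rightarrow> real \<Rightarrow> (real \<Rightarrow> real \<Rightarrow> real) \<Rightarrow> (real \<Rightarrow> real \<Rightarrow> real) \<Rightarrow> bool" where
  "C1_Hs s T u ut \<longleftrightarrow> (\<forall>t\<in>{0..T}. in_Hs s (u t) \<and> in_Hs s (ut t)
     \<and> ((\<lambda>\<tau>. Hs_norm s (\<lambda>x. (u \<tau> x - u t x) / (\<tau> - t) - ut t x)) \<longlongrightarrow> 0) (at t within {0..T})
     \<and> ((\<lambda>\<tau>. Hs_norm s (\<lambda>x. ut \<tau> x - ut t x)) \<longlongrightarrow> 0) (at t within {0..T}))"

definition Ck :: "nat \<Rightarrow> (real \<Rightarrow> real) \<Rightarrow> bool" where
  "Ck k f \<longleftrightarrow> (\<forall>j<k. \<forall>x. ((deriv ^^ j) f) differentiable (at x))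
              \<and> continuous_on UNIV ((deriv ^^ k) f)"

definition D2h :: "real \<Rightarrow> (int \<Rightarrow> real) \<Rightarrow> int \<Rightarrow> real" where
  "D2h h a k = (a (k + 1) - 2 * a k + a (k - 1)) / h\<^sup>2"

definition solves_trunc ::
  "real \<Rightarrow> (real \<Rightarrow> real) \<Rightarrow> (real \<Rightarrow> real) \<Rightarrow> real \<Rightarrow> real \<Rightarrow> nat \<Rightarrow> (real \<Rightarrow> real)
    \<Rightarrow> (real \<Rightarrow> int \<Rightarrow> real) \<Rightarrow> bool" where
  "solves_trunc \<kappa> \<alpha> f h T N \<phi> v \<longleftrightarrow>
     (\<forall>i\<in>{-int N..int N}. v 0 i = \<phi> (real_of_int i * h)
        \<and> (\<forall>t\<in>{0..T}. ((\<lambda>\<tau>. v \<tau> i) has_real_derivative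
              (- (\<Sum>j\<in>{-int N..int N}. h * deriv \<alpha> (real_of_int i * h - real_of_int j * h) * f (v t j))
               - \<kappa> * (\<Sum>j\<in>{-int N..int N}.
                      h * D2h h (\<lambda>k. deriv \<alpha> (real_of_int k * h)) (i - j) * v t j)))
             (at t within {0..T})))"

end

theory Submission
  imports Defs "HOL-Probability.Characteristic_Functions" "HOL-Probability.Sinc_Integral"
    "HOL-Computational_Algebra.Polynomial"
begin

text \<open>Write \<open>\<beta>\<close> for \<open>\<alpha>'\<close> and \<open>\<mu>\<close> for \<open>\<alpha>'''\<close>. Testing the distributional identity with smoothed piecewise linear
  functions expresses every second difference of \<open>\<beta>\<close> as the \<open>\<mu>\<close>-integral of a trapezoid. Two consistency
  estimates follow. The trapezoidal rule for \<open>\<beta> * w\<close> has error \<open>O(h\<^sup>2)\<close>, because on each cell the error only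
  sees first and second differences of \<open>\<beta>\<close> and \<open>w\<close>, whose sums over cells are finite. The discrete dispersion
  \<open>h * (D\<^sub>h\<^sup>2 \<beta>)\<close> applied to \<open>u\<close> is exactly the \<open>\<mu>\<close>-convolution with the piecewise linear interpolant of \<open>u\<close>,
  again \<open>O(h\<^sup>2)\<close> away from \<open>\<mu> * u\<close>, and it is bounded in \<open>l\<^sup>\<infinity>\<close> uniformly in \<open>h\<close>. On the Fourier side the
  \<open>H\<^sup>s\<close> norm controls two sup-norm derivatives, and the Riemann--Lebesgue lemma with compactness of \<open>[0, T]\<close>
  makes \<open>u\<close> smaller than \<open>\<epsilon>\<close> outside a fixed interval, which fixes \<open>N\<close>. A comparison with an exponential
  barrier then bounds the error, and keeps the numerical solution in a range where \<open>f\<close> is Lipschitz, so that a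
  solution of the system with truncated \<open>f\<close> solves the original one.\<close>

section \<open>Sobolev functions on the Fourier side\<close>

text \<open>It is replaced by h^2 times a quantity that is additive over cells. Moreover \<mu> is
  only given through smooth test functions of compact support, while the estimates need it on
  piecewise linear ones; this is why an explicit bump and its antiderivatives are constructed. The
  other obstacle is that f is only locally Lipschitz. If M bounds u, all comparisons take place in
  [-R, R] with R = M + 1, and h and \<epsilon> are taken so small that the error bound C (h^2 +
  \<epsilon>) is at most 1. The barrier argument may assume this bound while proving it, so that f
  is never examined outside [-R, R]. The number N depends on h and \<epsilon>, but no constant
  depends on N.\<close>

definition C2bdd :: "real \<Rightarrow> (real \<Rightarrow> real) \<Rightarrow> bool" where
  "C2bdd M v \<longleftrightarrow> (\<exists>v1 v2. (\<forall>x. (v has_real_derivative v1 x) (at x)) \<and>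
     (\<forall>x. (v1 has_real_derivative v2 x) (at x)) \<and>
     (\<forall>x. \<bar>v x\<bar> \<le> M \<and> \<bar>v1 x\<bar> \<le> M \<and> \<bar>v2 x\<bar> \<le> M))"

lemma C2bdd_bound: "C2bdd M v \<Longrightarrow> \<bar>v x\<bar> \<le> M"
  by (auto simp: C2bdd_def)

lemma C2bdd_nonneg: "C2bdd M v \<Longrightarrow> 0 \<le> M"
  using C2bdd_bound[of M v 0] by linarith

lemma C2bdd_mono: "C2bdd M v \<Longrightarrow> M \<le> M' \<Longrightarrow> C2bdd M' v"
  unfolding C2bdd_def by (meson order_trans)

lemma C2bdd_add:
  assumes "C2bdd M v" "C2bdd N w" shows "C2bdd (M + N) (\<lambda>x. v x + w x)"
proof -
  obtain v1 v2 where v: "\<And>x. (v has_real_derivative v1 x) (at x)"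
     "\<And>x. (v1 has_real_derivative v2 x) (at x)"
     "\<And>x. \<bar>v x\<bar> \<le> M" "\<And>x. \<bar>v1 x\<bar> \<le> M" "\<And>x. \<bar>v2 x\<bar> \<le> M"
    using assms(1) unfolding C2bdd_def by blast
  obtain w1 w2 where w: "\<And>x. (w has_real_derivative w1 x) (at x)"
     "\<And>x. (w1 has_real_derivative w2 x) (at x)"
     "\<And>x. \<bar>w x\<bar> \<le> N" "\<And>x. \<bar>w1 x\<bar> \<le> N" "\<And>x. \<bar>w2 x\<bar> \<le> N"
    using assms(2) unfolding C2bdd_def by blast
  show ?thesis unfolding C2bdd_def
    apply (rule exI[of _ "\<lambda>x. v1 x + w1 x"], rule exI[of _ "\<lambda>x. v2 x + w2 x"])
    by (intro conjI allI DERIV_add v w order_trans[OF abs_triangle_ineq] add_mono)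
qed

lemma C2bdd_scale:
  assumes "C2bdd M v" shows "C2bdd (\<bar>c\<bar> * M) (\<lambda>x. c * v x)"
proof -
  obtain v1 v2 where v: "\<And>x. (v has_real_derivative v1 x) (at x)"
     "\<And>x. (v1 has_real_derivative v2 x) (at x)"
     "\<And>x. \<bar>v x\<bar> \<le> M" "\<And>x. \<bar>v1 x\<bar> \<le> M" "\<And>x. \<bar>v2 x\<bar> \<le> M"
    using assms(1) unfolding C2bdd_def by blast
  show ?thesis unfolding C2bdd_def
    apply (rule exI[of _ "\<lambda>x. c * v1 x"], rule exI[of _ "\<lambda>x. c * v2 x"])
    by (intro conjI allI DERIV_cmult v) (auto simp: abs_mult intro!: mult_left_mono v)
qed

text \<open>Both convolutions evaluate functions at a - x; the sign change of the first derivative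
  leaves the common bound alone.\<close>

lemma C2bdd_affine:
  assumes "C2bdd M v" shows "C2bdd M (\<lambda>x. v (a - x))"
proof -
  obtain v1 v2 where v: "\<And>x. (v has_real_derivative v1 x) (at x)"
     "\<And>x. (v1 has_real_derivative v2 x) (at x)"
     "\<And>x. \<bar>v x\<bar> \<le> M" "\<And>x. \<bar>v1 x\<bar> \<le> M" "\<And>x. \<bar>v2 x\<bar> \<le> M"
    using assms(1) unfolding C2bdd_def by blast
  have d: "((\<lambda>x. a - x) has_real_derivative -1) (at x)" for x
    by (auto intro!: derivative_eq_intros)
  have 1: "((\<lambda>x. v (a - x)) has_real_derivative - v1 (a - x)) (at x)" for x
    using DERIV_chain'[where f="\<lambda>x. a - x" and g=v, OF d v(1)] by simp
  have 2: "((\<lambda>x. - v1 (a - x)) has_real_derivative v2 (a - x)) (at x)" for x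
    using DERIV_minus[OF DERIV_chain'[where f="\<lambda>x. a - x" and g=v1, OF d v(2)]] by simp
  show ?thesis unfolding C2bdd_def
    apply (rule exI[of _ "\<lambda>x. - v1 (a - x)"], rule exI[of _ "\<lambda>x. v2 (a - x)"])
    using 1 2 v(3-5) by auto
qed

lemma C2bdd_continuous: "C2bdd M v \<Longrightarrow> continuous_on S v"
  unfolding C2bdd_def
  by (metis DERIV_isCont continuous_at_imp_continuous_on)

lemma exp_i_diff_bound:
  "cmod (exp (\<i> * complex_of_real \<theta>) - 1 - \<i> * complex_of_real \<theta>) \<le> \<theta>\<^sup>2"
proof -
  have "cmod (exp (\<i> * complex_of_real \<theta>) - 1 - \<i> * complex_of_real \<theta>) \<le> \<theta>\<^sup>2 / 2"
    using iexp_approx1[of \<theta> 1] by (simp add: diff_diff_eq power2_eq_square)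
  then show ?thesis using zero_le_power2[of \<theta>] by linarith
qed

lemma integrable_mult_exp:
  fixes g :: "real \<Rightarrow> complex"
  assumes "integrable lborel g"
  shows "integrable lborel (\<lambda>\<xi>. g \<xi> * exp (\<i> * complex_of_real (\<xi> * x)))"
  by (rule Bochner_Integration.integrable_bound[OF assms])
     (use assms in \<open>auto simp: norm_mult\<close>)

text \<open>The remainder of exp (i \<xi> y) around x is at most (\<xi> (y - x))^2, so the second
  moment of g bounds the error of the linear approximation by a multiple of (y - x)^2. The price of
  this explicit bound is one moment more than the derivative itself contains.\<close>

lemma fourier_has_derivative:
  fixes g :: "real \<Rightarrow> complex"
  assumes g: "integrable lborel g"
    and g2: "integrable lborel (\<lambda>\<xi>. \<xi>\<^sup>2 * cmod (g \<xi>))"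
    and g1: "integrable lborel (\<lambda>\<xi>. \<xi> * g \<xi>)"
  shows "((\<lambda>x. LINT \<xi>|lborel. g \<xi> * exp (\<i> * complex_of_real (\<xi> * x)))
           has_vector_derivative (LINT \<xi>|lborel. (\<i> * (\<xi> * g \<xi>)) * exp (\<i> * complex_of_real (\<xi> * x)))) (at x)"
proof -
  let ?F = "\<lambda>x. LINT \<xi>|lborel. g \<xi> * exp (\<i> * complex_of_real (\<xi> * x))"
  let ?D = "LINT \<xi>|lborel. (\<i> * (\<xi> * g \<xi>)) * exp (\<i> * complex_of_real (\<xi> * x))"
  define B where "B = (LINT \<xi>|lborel. \<xi>\<^sup>2 * cmod (g \<xi>))"
  have i1: "integrable lborel (\<lambda>\<xi>. g \<xi> * exp (\<i> * complex_of_real (\<xi> * x)))" for x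
    by (rule integrable_mult_exp[OF g])
  have i2: "integrable lborel (\<lambda>\<xi>. (\<i> * (\<xi> * g \<xi>)) * exp (\<i> * complex_of_real (\<xi> * x)))" for x
    by (rule integrable_mult_exp) (rule integrable_mult_right[OF g1])
  have bd: "cmod (?F y - ?F x - of_real (y - x) * ?D) \<le> (y - x)\<^sup>2 * B" for y
  proof -
    have "?F y - ?F x - of_real (y - x) * ?D =
       (LINT \<xi>|lborel. g \<xi> * exp (\<i> * complex_of_real (\<xi> * y)) - g \<xi> * exp (\<i> * complex_of_real (\<xi> * x))
          - of_real (y - x) * ((\<i> * (\<xi> * g \<xi>)) * exp (\<i> * complex_of_real (\<xi> * x))))"
      using i1 i2 by simp
    also have "cmod \<dots> \<le> (LINT \<xi>|lborel. (y - x)\<^sup>2 * (\<xi>\<^sup>2 * cmod (g \<xi>)))"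
    proof (rule Bochner_Integration.integral_norm_bound_integral)
      show "integrable lborel (\<lambda>\<xi>. g \<xi> * exp (\<i> * complex_of_real (\<xi> * y)) - g \<xi> * exp (\<i> * complex_of_real (\<xi> * x))
          - of_real (y - x) * ((\<i> * (\<xi> * g \<xi>)) * exp (\<i> * complex_of_real (\<xi> * x))))"
        using i1 i2 by (intro Bochner_Integration.integrable_diff integrable_mult_right) auto
      show "integrable lborel (\<lambda>\<xi>. (y - x)\<^sup>2 * (\<xi>\<^sup>2 * cmod (g \<xi>)))"
        by (rule integrable_mult_right[OF g2])
      fix \<xi> :: real
      have "g \<xi> * exp (\<i> * complex_of_real (\<xi> * y)) - g \<xi> * exp (\<i> * complex_of_real (\<xi> * x))
          - of_real (y - x) * ((\<i> * (\<xi> * g \<xi>)) * exp (\<i> * complex_of_real (\<xi> * x)))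
        = g \<xi> * exp (\<i> * complex_of_real (\<xi> * x)) * (exp (\<i> * complex_of_real (\<xi> * (y - x))) - 1 - \<i> * complex_of_real (\<xi> * (y - x)))"
        by (simp add: algebra_simps flip: exp_add)
      also have "cmod \<dots> \<le> cmod (g \<xi>) * (\<xi> * (y - x))\<^sup>2"
        unfolding norm_mult by (simp del: of_real_mult) (intro mult_left_mono exp_i_diff_bound norm_ge_zero)
      finally show "norm (g \<xi> * exp (\<i> * complex_of_real (\<xi> * y)) - g \<xi> * exp (\<i> * complex_of_real (\<xi> * x))
          - of_real (y - x) * ((\<i> * (\<xi> * g \<xi>)) * exp (\<i> * complex_of_real (\<xi> * x)))) \<le> (y - x)\<^sup>2 * (\<xi>\<^sup>2 * cmod (g \<xi>))"
        by (simp add: power_mult_distrib mult_ac)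
    qed
    finally show ?thesis by (simp add: B_def)
  qed
  show ?thesis
    unfolding has_vector_derivative_def has_derivative_within
  proof (intro conjI bounded_linear_scaleR_left)
    have "((\<lambda>y. \<bar>y - x\<bar> * B) \<longlongrightarrow> 0) (at x)"
      by (auto intro!: tendsto_eq_intros)
    then show "((\<lambda>y. (1 / norm (y - x)) *\<^sub>R (?F y - (?F x + (y - x) *\<^sub>R ?D))) \<longlongrightarrow> 0) (at x within UNIV)"
    proof (rule Lim_null_comparison[rotated])
      show "\<forall>\<^sub>F y in at x. norm ((1 / norm (y - x)) *\<^sub>R (?F y - (?F x + (y - x) *\<^sub>R ?D))) \<le> \<bar>y - x\<bar> * B"
        unfolding eventually_at
      proof (intro exI[of _ 1] conjI ballI impI)
        fix y assume "y \<noteq> x \<and> dist y x < 1"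
        then have pos: "\<bar>y - x\<bar> > 0" by auto
        have "norm ((1 / norm (y - x)) *\<^sub>R (?F y - (?F x + (y - x) *\<^sub>R ?D)))
          = norm (?F y - ?F x - of_real (y - x) * ?D) / \<bar>y - x\<bar>"
          by (simp only: norm_scaleR scaleR_conv_of_real diff_diff_eq) (simp add: norm_divide)
        also have "\<dots> \<le> (y - x)\<^sup>2 * B / \<bar>y - x\<bar>"
          using bd[of y] pos by (intro divide_right_mono) auto
        also have "\<dots> = \<bar>y - x\<bar> * B"
        proof -
          have "(y - x)\<^sup>2 = \<bar>y - x\<bar> * \<bar>y - x\<bar>"
            by (simp only: power2_eq_square abs_mult_self_eq)
          then show ?thesis using pos by (simp only: mult.assoc nonzero_mult_div_cancel_left)
        qed
        finally show "norm ((1 / norm (y - x)) *\<^sub>R (?F y - (?F x + (y - x) *\<^sub>R ?D))) \<le> \<bar>y - x\<bar> * B" .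
      qed simp
    qed
  qed
qed

lemma inverse_1_plus_square:
  "integrable lborel (\<lambda>x::real. inverse (1 + x\<^sup>2))" "(LBINT x. inverse (1 + x\<^sup>2)) = pi"
  using integrable_inverse_1_plus_square LBINT_inverse_1_plus_square
  by (simp_all add: set_integrable_def interval_lebesgue_integral_def set_lebesgue_integral_def)

text \<open>The free parameter \<open>K\<close> makes the resulting sup-norm bounds linear, rather than quadratic, in the
  \<open>H\<^sup>s\<close> norm without invoking Cauchy--Schwarz for integrals.\<close>

lemma weight_bound:
  fixes g :: "real \<Rightarrow> complex" and s K :: real
  assumes "4 \<le> s" "0 < K" "k \<le> 3"
  shows "\<bar>\<xi>\<bar> ^ k * cmod (g \<xi>)
    \<le> ((1 + \<xi>\<^sup>2) powr s * (cmod (g \<xi>))\<^sup>2 / K + K * inverse (1 + \<xi>\<^sup>2)) / 2"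
proof -
  define q where "q = 1 + \<xi>\<^sup>2"
  have q1: "1 \<le> q" by (simp add: q_def)
  define A where "A = q powr (s/2) * cmod (g \<xi>)"
  define D where "D = q powr (-1/2)"
  have "\<bar>\<xi>\<bar> \<le> q powr (1/2)"
    unfolding q_def by (subst powr_half_sqrt) (auto intro!: real_le_rsqrt)
  then have "\<bar>\<xi>\<bar> ^ k \<le> (q powr (1/2)) ^ k"
    by (intro power_mono) auto
  also have "\<dots> = q powr (k/2)"
    using q1 by (simp add: powr_power)
  \<comment> \<open>Since k \<le> 3 \<le> s - 1, a factor \<open>q powr (-1/2)\<close> can be split
    off; its square 1 / (1 + \<xi>^2) is integrable.\<close>
  also have "\<dots> \<le> q powr ((s - 1)/2)"
    using q1 assms by (intro powr_mono) auto
  also have "\<dots> = q powr (s/2) * D"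
    unfolding D_def by (simp add: diff_divide_distrib flip: powr_add)
  finally have "\<bar>\<xi>\<bar> ^ k * cmod (g \<xi>) \<le> A * D"
    unfolding A_def by (metis mult.commute mult.left_commute mult_right_mono norm_ge_zero)
  also have "A * D \<le> (A\<^sup>2 / K + K * D\<^sup>2) / 2"
  proof -
    have "0 \<le> (A - K * D)\<^sup>2 / K" using assms by simp
    also have "\<dots> = A\<^sup>2 / K + K * D\<^sup>2 - 2 * (A * D)"
      using assms by (simp add: power2_eq_square field_simps)
    finally show ?thesis by simp
  qed
  also have "A\<^sup>2 = q powr s * (cmod (g \<xi>))\<^sup>2"
    using q1 by (simp add: A_def power_mult_distrib powr_power)
  also have "D\<^sup>2 = inverse q"
    using q1 by (simp add: D_def power2_eq_square powr_minus_divide inverse_eq_divide flip: powr_add)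
  finally show ?thesis unfolding q_def .
qed

text \<open>With K at the size of the weighted L^2 norm, the two terms of
  \<open>weight_bound\<close> together integrate to at most K (1 + pi) / 2. The coarser 2 pi K is
  chosen to cancel the factor 1 / (2 pi) of the inverse transform.\<close>

lemma Hs_rep_moment:
  assumes "Hs_rep s v g" "4 \<le> s" "k \<le> 3"
  shows "integrable lborel (\<lambda>\<xi>. \<bar>\<xi>\<bar> ^ k * cmod (g \<xi>))"
    and "0 < K \<Longrightarrow> (LBINT \<xi>. (1 + \<xi>\<^sup>2) powr s * (cmod (g \<xi>))\<^sup>2) \<le> K\<^sup>2 \<Longrightarrow>
      (LBINT \<xi>. \<bar>\<xi>\<bar> ^ k * cmod (g \<xi>)) \<le> 2 * pi * K"
proof -
  have m: "g \<in> borel_measurable lborel"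
    and i: "integrable lborel (\<lambda>\<xi>. (1 + \<xi>\<^sup>2) powr s * (cmod (g \<xi>))\<^sup>2)"
    using assms(1) by (auto simp: Hs_rep_def)
  have ib: "integrable lborel (\<lambda>\<xi>. ((1 + \<xi>\<^sup>2) powr s * (cmod (g \<xi>))\<^sup>2 / K + K * inverse (1 + \<xi>\<^sup>2)) / 2)" for K
    using i inverse_1_plus_square(1) by (intro integrable_divide integrable_mult_right Bochner_Integration.integrable_add)
  show int: "integrable lborel (\<lambda>\<xi>. \<bar>\<xi>\<bar> ^ k * cmod (g \<xi>))"
  proof (rule Bochner_Integration.integrable_bound[OF ib[of 1]])
    show "(\<lambda>\<xi>. \<bar>\<xi>\<bar> ^ k * cmod (g \<xi>)) \<in> borel_measurable lborel" using m by measurable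
    show "AE \<xi> in lborel. norm (\<bar>\<xi>\<bar> ^ k * cmod (g \<xi>)) \<le> norm (((1 + \<xi>\<^sup>2) powr s * (cmod (g \<xi>))\<^sup>2 / 1 + 1 * inverse (1 + \<xi>\<^sup>2)) / 2)"
      using weight_bound[OF assms(2) zero_less_one assms(3), of _ g]
      by (intro AE_I2) (smt (verit, best) norm_mult norm_power real_norm_def abs_ge_self abs_norm_cancel abs_abs)
  qed
  assume K: "0 < K" and le: "(LBINT \<xi>. (1 + \<xi>\<^sup>2) powr s * (cmod (g \<xi>))\<^sup>2) \<le> K\<^sup>2"
  have "(LBINT \<xi>. \<bar>\<xi>\<bar> ^ k * cmod (g \<xi>)) \<le>
    (LBINT \<xi>. ((1 + \<xi>\<^sup>2) powr s * (cmod (g \<xi>))\<^sup>2 / K + K * inverse (1 + \<xi>\<^sup>2)) / 2)"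
    by (intro integral_mono int ib weight_bound assms K)
  also have "\<dots> = ((LBINT \<xi>. (1 + \<xi>\<^sup>2) powr s * (cmod (g \<xi>))\<^sup>2) / K + K * pi) / 2"
    using i inverse_1_plus_square by (simp add: Bochner_Integration.integral_add)
  also have "\<dots> \<le> (K\<^sup>2 / K + K * pi) / 2"
    using le K by (intro divide_right_mono add_right_mono) auto
  also have "\<dots> = K * (1 + pi) / 2"
    using K by (simp add: power2_eq_square field_simps)
  also have "\<dots> \<le> K * (4 * pi) / 2"
    using K pi_ge_two by (intro divide_right_mono mult_left_mono) auto
  finally show "(LBINT \<xi>. \<bar>\<xi>\<bar> ^ k * cmod (g \<xi>)) \<le> 2 * pi * K" by (simp add: mult_ac)
qed

lemma Hs_rep_integrable:
  assumes "Hs_rep s v g" "4 \<le> s" "k \<le> 3"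
  shows "integrable lborel (\<lambda>\<xi>. complex_of_real \<xi> ^ k * g \<xi>)"
proof (rule Bochner_Integration.integrable_bound[OF Hs_rep_moment(1)[OF assms]])
  have "g \<in> borel_measurable lborel"
    using assms(1) by (auto simp: Hs_rep_def)
  then show "(\<lambda>\<xi>. complex_of_real \<xi> ^ k * g \<xi>) \<in> borel_measurable lborel" by measurable
qed (simp add: norm_mult norm_power)

text \<open>The k-th derivative of v is the inverse transform of (i \<xi>)^k g and is bounded by the
  k-th moment of g. Moments up to 3 occur although only two derivatives are taken, because
  \<open>fourier_has_derivative\<close> at k = 1 asks for the second moment of \<xi> g.\<close>

lemma Hs_rep_C2bdd:
  assumes rep: "Hs_rep s v g" and s: "4 \<le> s" and K: "0 < K"
    and le: "(LBINT \<xi>. (1 + \<xi>\<^sup>2) powr s * (cmod (g \<xi>))\<^sup>2) \<le> K\<^sup>2"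
  shows "C2bdd K v"
proof -
  define F where "F = (\<lambda>k x. LINT \<xi>|lborel. \<i> ^ k * (complex_of_real \<xi> ^ k * g \<xi>) * exp (\<i> * complex_of_real (\<xi> * x)))"
  have int: "integrable lborel (\<lambda>\<xi>. \<i> ^ k * (complex_of_real \<xi> ^ k * g \<xi>))" if "k \<le> 3" for k
    by (intro integrable_mult_right Hs_rep_integrable[OF rep s that])
  have d: "(F k has_vector_derivative F (Suc k) x) (at x)" if "k \<le> 1" for k x
  proof -
    have 1: "integrable lborel (\<lambda>\<xi>. \<xi>\<^sup>2 * cmod (\<i> ^ k * (complex_of_real \<xi> ^ k * g \<xi>)))"
    proof -
      have "(\<lambda>\<xi>. \<xi>\<^sup>2 * cmod (\<i> ^ k * (complex_of_real \<xi> ^ k * g \<xi>))) = (\<lambda>\<xi>. \<bar>\<xi>\<bar> ^ (k + 2) * cmod (g \<xi>))"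
        by (simp add: norm_mult norm_power power_add mult_ac del: add_2_eq_Suc')
      then show ?thesis
        using Hs_rep_moment(1)[OF rep s, of "k + 2"] that by simp
    qed
    have 2: "integrable lborel (\<lambda>\<xi>. complex_of_real \<xi> * (\<i> ^ k * (complex_of_real \<xi> ^ k * g \<xi>)))"
      using integrable_mult_right[OF Hs_rep_integrable[OF rep s, of "Suc k"], of "\<i> ^ k"] that
      by (simp add: mult_ac)
    have 0: "integrable lborel (\<lambda>\<xi>. \<i> ^ k * (complex_of_real \<xi> ^ k * g \<xi>))"
      by (rule int) (use that in auto)
    show ?thesis
      using fourier_has_derivative[OF 0 1 2, of x] by (simp add: F_def mult_ac)
  qed
  define V where "V = (\<lambda>k x. Re (F k x) / (2 * pi))"
  have dV: "(V k has_real_derivative V (Suc k) x) (at x)" if "k \<le> 1" for k x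
    unfolding V_def
    by (intro DERIV_cdivide)
       (use bounded_linear.has_vector_derivative[OF bounded_linear_Re d[OF that]] in
         \<open>simp add: has_real_derivative_iff_has_vector_derivative\<close>)
  have bV: "\<bar>V k x\<bar> \<le> K" if "k \<le> 2" for k x
  proof -
    have "cmod (F k x) \<le> (LBINT \<xi>. \<bar>\<xi>\<bar> ^ k * cmod (g \<xi>))"
      unfolding F_def
    proof (rule Bochner_Integration.integral_norm_bound_integral)
      show "integrable lborel (\<lambda>\<xi>. \<i> ^ k * (complex_of_real \<xi> ^ k * g \<xi>) * exp (\<i> * complex_of_real (\<xi> * x)))"
        by (rule integrable_mult_exp) (rule int, use that in auto)
      show "integrable lborel (\<lambda>\<xi>. \<bar>\<xi>\<bar> ^ k * cmod (g \<xi>))"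
        by (rule Hs_rep_moment(1)[OF rep s]) (use that in auto)
    qed (simp add: norm_mult norm_power)
    also have "\<dots> \<le> 2 * pi * K"
      by (rule Hs_rep_moment(2)[OF rep s _ K le]) (use that in auto)
    finally have "\<bar>Re (F k x)\<bar> \<le> 2 * pi * K"
      using abs_Re_le_cmod order_trans by blast
    then show ?thesis by (simp add: V_def field_simps)
  qed
  have v: "v = V 0"
  proof
    fix x
    have "complex_of_real (v x) = F 0 x / complex_of_real (2 * pi)"
      using rep by (simp add: Hs_rep_def F_def)
    then have "v x = Re (F 0 x / complex_of_real (2 * pi))"
      by (metis Re_complex_of_real)
    then show "v x = V 0 x"
      by (simp only: Re_divide_of_real V_def)
  qed
  show ?thesis
    unfolding C2bdd_def v
    by (rule exI[of _ "V 1"], rule exI[of _ "V 2"])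
       (use dV[of 0] dV[of 1] bV[of 0] bV[of 1] bV[of 2] in \<open>auto simp: numeral_2_eq_2\<close>)
qed

text \<open>\<open>Hs_norm\<close> says nothing about a function without a Fourier representative,
  because \<open>SOME\<close> is then arbitrary. Difference quotients in time therefore have to be
  shown to lie in H^s before their norm can be used. Integrability comes from |a + b|^2 \<le> 2
  |a|^2 + 2 |b|^2.\<close>

lemma Hs_rep_lincomb:
  assumes v: "Hs_rep s v g" and w: "Hs_rep s w k" and s: "4 \<le> s"
  shows "Hs_rep s (\<lambda>x. a * v x + b * w x) (\<lambda>\<xi>. of_real a * g \<xi> + of_real b * k \<xi>)"
  unfolding Hs_rep_def
proof (intro conjI allI)
  have mg: "g \<in> borel_measurable lborel" and mk: "k \<in> borel_measurable lborel"
    and ig: "integrable lborel (\<lambda>\<xi>. (1 + \<xi>\<^sup>2) powr s * (cmod (g \<xi>))\<^sup>2)"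
    and ik: "integrable lborel (\<lambda>\<xi>. (1 + \<xi>\<^sup>2) powr s * (cmod (k \<xi>))\<^sup>2)"
    using v w by (auto simp: Hs_rep_def)
  show m: "(\<lambda>\<xi>. of_real a * g \<xi> + of_real b * k \<xi>) \<in> borel_measurable lborel"
    using mg mk by measurable
  have "integrable lborel (\<lambda>\<xi>. 2 * a\<^sup>2 * ((1 + \<xi>\<^sup>2) powr s * (cmod (g \<xi>))\<^sup>2) + 2 * b\<^sup>2 * ((1 + \<xi>\<^sup>2) powr s * (cmod (k \<xi>))\<^sup>2))"
    using ig ik by (intro Bochner_Integration.integrable_add integrable_mult_right)
  then show "integrable lborel (\<lambda>\<xi>. (1 + \<xi>\<^sup>2) powr s * (cmod (of_real a * g \<xi> + of_real b * k \<xi>))\<^sup>2)"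
  proof (rule Bochner_Integration.integrable_bound)
    show "(\<lambda>\<xi>. (1 + \<xi>\<^sup>2) powr s * (cmod (of_real a * g \<xi> + of_real b * k \<xi>))\<^sup>2) \<in> borel_measurable lborel"
      using mg mk by measurable
    have "(cmod (of_real a * g \<xi> + of_real b * k \<xi>))\<^sup>2 \<le> 2 * a\<^sup>2 * (cmod (g \<xi>))\<^sup>2 + 2 * b\<^sup>2 * (cmod (k \<xi>))\<^sup>2" for \<xi>
    proof -
      have "(cmod (of_real a * g \<xi> + of_real b * k \<xi>))\<^sup>2 \<le> (\<bar>a\<bar> * cmod (g \<xi>) + \<bar>b\<bar> * cmod (k \<xi>))\<^sup>2"
        by (intro power_mono norm_triangle_le) (auto simp: norm_mult)
      also have "\<dots> \<le> 2 * (\<bar>a\<bar> * cmod (g \<xi>))\<^sup>2 + 2 * (\<bar>b\<bar> * cmod (k \<xi>))\<^sup>2"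
        using zero_le_power2[of "\<bar>a\<bar> * cmod (g \<xi>) - \<bar>b\<bar> * cmod (k \<xi>)"]
        by (simp add: power2_eq_square algebra_simps)
      finally show ?thesis by (simp add: power_mult_distrib mult_ac)
    qed
    then have "(1 + \<xi>\<^sup>2) powr s * (cmod (of_real a * g \<xi> + of_real b * k \<xi>))\<^sup>2
      \<le> (1 + \<xi>\<^sup>2) powr s * (2 * a\<^sup>2 * (cmod (g \<xi>))\<^sup>2 + 2 * b\<^sup>2 * (cmod (k \<xi>))\<^sup>2)" for \<xi>
      by (intro mult_left_mono) auto
    then show "AE \<xi> in lborel. norm ((1 + \<xi>\<^sup>2) powr s * (cmod (of_real a * g \<xi> + of_real b * k \<xi>))\<^sup>2)
       \<le> norm (2 * a\<^sup>2 * ((1 + \<xi>\<^sup>2) powr s * (cmod (g \<xi>))\<^sup>2) + 2 * b\<^sup>2 * ((1 + \<xi>\<^sup>2) powr s * (cmod (k \<xi>))\<^sup>2))"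
      by (intro AE_I2) (simp add: algebra_simps)
  qed
  fix x
  have i: "integrable lborel (\<lambda>\<xi>. g \<xi> * exp (\<i> * complex_of_real (\<xi> * x)))"
          "integrable lborel (\<lambda>\<xi>. k \<xi> * exp (\<i> * complex_of_real (\<xi> * x)))"
    using integrable_mult_exp[of g] integrable_mult_exp[of k]
      Hs_rep_integrable[OF v s, of 0] Hs_rep_integrable[OF w s, of 0] by simp_all
  have "(LINT \<xi>|lborel. (of_real a * g \<xi> + of_real b * k \<xi>) * exp (\<i> * complex_of_real (\<xi> * x)))
    = (LINT \<xi>|lborel. of_real a * (g \<xi> * exp (\<i> * complex_of_real (\<xi> * x))) + of_real b * (k \<xi> * exp (\<i> * complex_of_real (\<xi> * x))))"
    by (intro Bochner_Integration.integral_cong) (auto simp: algebra_simps)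
  also have "\<dots> = of_real a * (LINT \<xi>|lborel. g \<xi> * exp (\<i> * complex_of_real (\<xi> * x)))
      + of_real b * (LINT \<xi>|lborel. k \<xi> * exp (\<i> * complex_of_real (\<xi> * x)))"
    using i by (subst Bochner_Integration.integral_add) auto
  finally show "complex_of_real (a * v x + b * w x) =
     (LINT \<xi>|lborel. (of_real a * g \<xi> + of_real b * k \<xi>) * exp (\<i> * complex_of_real (\<xi> * x))) / complex_of_real (2 * pi)"
    using v w by (simp add: Hs_rep_def add_divide_distrib)
qed

lemma in_Hs_lincomb:
  "in_Hs s v \<Longrightarrow> in_Hs s w \<Longrightarrow> 4 \<le> s \<Longrightarrow> in_Hs s (\<lambda>x. a * v x + b * w x)"
  unfolding in_Hs_def by (blast dest: Hs_rep_lincomb)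

lemma Hs_norm_nonneg: "0 \<le> Hs_norm s v"
  unfolding Hs_norm_def by (auto intro!: divide_nonneg_nonneg Bochner_Integration.integral_nonneg)

text \<open>The bound holds for every Fourier representative, so the choice made by \<open>SOME\<close> in the norm is harmless
  and uniqueness of Fourier transforms is never needed.\<close>

lemma Hs_norm_C2bdd:
  assumes "in_Hs s v" "4 \<le> s" "Hs_norm s v < N"
  shows "C2bdd (3 * N) v"
proof -
  define g where "g = (SOME g. Hs_rep s v g)"
  have rep: "Hs_rep s v g" using assms(1) unfolding g_def in_Hs_def by (rule someI_ex)
  define I where "I = (LBINT \<xi>. (1 + \<xi>\<^sup>2) powr s * (cmod (g \<xi>))\<^sup>2)"
  have I0: "0 \<le> I" unfolding I_def by (auto intro!: Bochner_Integration.integral_nonneg)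
  have N: "0 < N" using Hs_norm_nonneg[of s v] assms(3) by linarith
  have "sqrt (I / (2 * pi)) < N" using assms(3) by (simp add: Hs_norm_def I_def g_def)
  then have "I / (2 * pi) < N\<^sup>2" using N real_sqrt_less_iff[of "I / (2*pi)" "N\<^sup>2"] by simp
  then have "I \<le> 2 * pi * N\<^sup>2" by (simp add: field_simps)
  \<comment> \<open>The bound 2 pi < 9 = 3^2 is the origin of the factor 3.\<close>
  also have "\<dots> \<le> 9 * N\<^sup>2" using pi_less_4 by (intro mult_right_mono) auto
  finally have "I \<le> (3 * N)\<^sup>2" by (simp add: power_mult_distrib)
  then show ?thesis using Hs_rep_C2bdd[OF rep assms(2), of "3 * N"] N by (simp add: I_def)
qed

section \<open>Decay at infinity: the Riemann--Lebesgue lemma\<close>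

definition fourier_vanishes :: "(real \<Rightarrow> complex) \<Rightarrow> bool" where
  "fourier_vanishes g \<longleftrightarrow>
    ((\<lambda>x. LINT \<xi>|lborel. g \<xi> * exp (\<i> * complex_of_real (\<xi> * x))) \<longlongrightarrow> 0) at_infinity"

lemma fourier_vanishes_add:
  assumes "integrable lborel f" "integrable lborel g" "fourier_vanishes f" "fourier_vanishes g"
  shows "fourier_vanishes (\<lambda>x. f x + g x)"
  using tendsto_add[OF assms(3,4)[unfolded fourier_vanishes_def]]
    integrable_mult_exp[OF assms(1)] integrable_mult_exp[OF assms(2)]
  by (simp add: fourier_vanishes_def distrib_right)

lemma fourier_vanishes_mult:
  assumes "fourier_vanishes f"
  shows "fourier_vanishes (\<lambda>x. c * f x)"
  using tendsto_mult_right_zero[OF assms[unfolded fourier_vanishes_def], of c]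
  by (simp add: fourier_vanishes_def mult.assoc)

text \<open>At every x the transforms of \<open>s i\<close> and f differ by at most the L^1 distance
  of \<open>s i\<close> and f, which tends to 0 by dominated convergence. Countable unions, cut-offs
  and simple approximations all arrive below in this dominated pointwise form.\<close>

lemma fourier_vanishes_limit:
  fixes f :: "real \<Rightarrow> complex" and s :: "nat \<Rightarrow> real \<Rightarrow> complex"
  assumes s: "\<And>i. integrable lborel (s i)" and v: "\<And>i. fourier_vanishes (s i)"
    and lim: "\<And>x. (\<lambda>i. s i x) \<longlonglongrightarrow> f x"
    and dom: "\<And>i x. norm (s i x) \<le> w x" and w: "integrable lborel (w :: real \<Rightarrow> real)"
  shows "fourier_vanishes f"
  unfolding fourier_vanishes_def
proof (rule tendstoI)
  fix e :: real assume e: "0 < e"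
  have m: "f \<in> borel_measurable lborel"
    by (rule borel_measurable_LIMSEQ_metric[of s]) (use s lim in auto)
  have fw: "norm (f x) \<le> w x" for x
    by (rule LIMSEQ_le_const2[OF tendsto_norm[OF lim]]) (use dom in auto)
  have f: "integrable lborel f"
    by (rule Bochner_Integration.integrable_bound[OF w m]) (use fw in \<open>auto intro: order_trans[OF _ abs_ge_self]\<close>)
  have "(\<lambda>i. LBINT x. norm (s i x - f x)) \<longlonglongrightarrow> integral\<^sup>L lborel (\<lambda>x::real. 0 :: real)"
  proof (rule Bochner_Integration.integral_dominated_convergence[where w = "\<lambda>x. w x + w x"])
    show "integrable lborel (\<lambda>x. w x + w x)" using w by simp
    show "(\<lambda>x. norm (s i x - f x)) \<in> borel_measurable lborel" for i
      using s m by (auto dest: borel_measurable_integrable)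
    show "AE x in lborel. (\<lambda>i. norm (s i x - f x)) \<longlonglongrightarrow> 0"
      using lim tendsto_norm_zero Lim_null by fast
    show "AE x in lborel. norm (norm (s i x - f x)) \<le> w x + w x" for i
      by (intro AE_I2) (smt (verit) norm_triangle_ineq4[of "s i _" "f _"] dom[of i] fw norm_ge_zero real_norm_def)
  qed auto
  then have "\<forall>\<^sub>F i in sequentially. (LBINT x. norm (s i x - f x)) < e / 2"
    using e by (intro order_tendstoD) auto
  then obtain i where i: "(LBINT x. norm (s i x - f x)) < e / 2"
    using eventually_happens' sequentially_bot by blast
  have "\<forall>\<^sub>F x in at_infinity. dist (LINT \<xi>|lborel. s i \<xi> * exp (\<i> * complex_of_real (\<xi> * x))) 0 < e / 2"
    using v[of i] e unfolding fourier_vanishes_def by (intro tendstoD) auto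
  then show "\<forall>\<^sub>F x in at_infinity. dist (LINT \<xi>|lborel. f \<xi> * exp (\<i> * complex_of_real (\<xi> * x))) 0 < e"
  proof eventually_elim
    case (elim x)
    have "norm ((LINT \<xi>|lborel. s i \<xi> * exp (\<i> * complex_of_real (\<xi> * x))) - (LINT \<xi>|lborel. f \<xi> * exp (\<i> * complex_of_real (\<xi> * x))))
       = norm (LINT \<xi>|lborel. (s i \<xi> - f \<xi>) * exp (\<i> * complex_of_real (\<xi> * x)))"
      using integrable_mult_exp[OF s] integrable_mult_exp[OF f]
      by (simp add: left_diff_distrib)
    also have "\<dots> \<le> (LBINT x. norm (s i x - f x))"
      using integrable_mult_exp[of "\<lambda>x. s i x - f x" x] s f
      by (intro Bochner_Integration.integral_norm_bound_integral) (auto simp: norm_mult)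
    finally show ?case using i elim
      by (simp add: dist_norm)
         (smt (verit) norm_minus_commute norm_triangle_sub)
  qed
qed

text \<open>The antiderivative exp (i \<xi> x) / (i x) gives the decay 2 / |x|.\<close>

lemma fourier_vanishes_interval: "fourier_vanishes (indicator {a..b})"
proof (cases "a \<le> b")
  case False
  then show ?thesis by (simp add: fourier_vanishes_def)
next
  case True
  have val: "(LINT \<xi>|lborel. indicator {a..b} \<xi> * exp (\<i> * complex_of_real (\<xi> * x)))
     = exp (\<i> * complex_of_real (b * x)) / (\<i> * x) - exp (\<i> * complex_of_real (a * x)) / (\<i> * x)"
    if "x \<noteq> 0" for x
  proof -
    have "has_bochner_integral lborel (\<lambda>\<xi>. indicator {a..b} \<xi> *\<^sub>R exp (\<i> * complex_of_real (\<xi> * x)))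
      (exp (\<i> * complex_of_real (b * x)) / (\<i> * x) - exp (\<i> * complex_of_real (a * x)) / (\<i> * x))"
    proof (rule has_bochner_integral_FTC_Icc[OF True])
      show "continuous_on {a..b} (\<lambda>\<xi>. exp (\<i> * complex_of_real (\<xi> * x)))"
        by (intro continuous_intros)
      fix \<xi> assume "a \<le> \<xi>" "\<xi> \<le> b"
      have "((\<lambda>z. exp (\<i> * (z * complex_of_real x)) / (\<i> * x)) has_field_derivative exp (\<i> * (complex_of_real \<xi> * complex_of_real x))) (at (of_real \<xi>))"
      proof -
        have "((\<lambda>z. exp (\<i> * (z * complex_of_real x))) has_field_derivative exp (\<i> * (complex_of_real \<xi> * complex_of_real x)) * (\<i> * x)) (at (of_real \<xi>))"
          by (auto intro!: derivative_eq_intros)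
        from DERIV_cdivide[OF this, of "\<i> * x"] that show ?thesis by simp
      qed
      from has_vector_derivative_real_field[OF this]
      show "((\<lambda>\<xi>. exp (\<i> * complex_of_real (\<xi> * x)) / (\<i> * x)) has_vector_derivative exp (\<i> * complex_of_real (\<xi> * x))) (at \<xi> within {a..b})"
        by (simp add: o_def)
    qed
    moreover have "indicator {a..b} \<xi> *\<^sub>R exp (\<i> * complex_of_real (\<xi> * x)) = indicator {a..b} \<xi> * exp (\<i> * complex_of_real (\<xi> * x))" for \<xi>
      by (simp add: indicator_def)
    ultimately show ?thesis by (simp add: has_bochner_integral_iff)
  qed
  show ?thesis unfolding fourier_vanishes_def
  proof (rule Lim_null_comparison)
    show "((\<lambda>x::real. 2 / \<bar>x\<bar>) \<longlongrightarrow> 0) at_infinity"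
      using tendsto_mult_right_zero[OF tendsto_norm_zero[OF tendsto_inverse_0[where 'a=real]], of 2]
      by (simp add: divide_inverse)
    have "norm (LINT \<xi>|lborel. indicator {a..b} \<xi> * exp (\<i> * complex_of_real (\<xi> * x))) \<le> 2 / \<bar>x\<bar>" if "x \<noteq> 0" for x
      unfolding val[OF that]
      by (rule order_trans[OF norm_triangle_ineq4]) (simp add: norm_divide norm_mult del: of_real_mult)
    then show "\<forall>\<^sub>F x in at_infinity. norm (LINT \<xi>|lborel. indicator {a..b} \<xi> * exp (\<i> * complex_of_real (\<xi> * x))) \<le> 2 / \<bar>x\<bar>"
      unfolding eventually_at_infinity by (intro exI[of _ 1]) auto
  qed
qed

text \<open>Closed intervals form an intersection-stable generator, so Dynkin's induction applies:
  complements are subtracted from [-R, R], and disjoint unions are limits of their partial unions.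
  The cut-off keeps every indicator integrable.\<close>

lemma fourier_vanishes_borel:
  fixes A :: "real set"
  assumes "A \<in> sets borel"
  shows "fourier_vanishes (indicator (A \<inter> {-R..R}))"
proof -
  let ?G = "range (\<lambda>(a::real, b). {a..b})"
  have fin: "integrable lborel (indicator (A \<inter> {-R..R}) :: real \<Rightarrow> complex)" if "A \<in> sets borel" for A
  proof (rule Bochner_Integration.integrable_bound)
    show "integrable lborel (indicator {-R..R} :: real \<Rightarrow> real)"
      by (intro integrable_real_indicator) (use emeasure_compact_finite[of "{-R..R}"] in auto)
  qed (use that in \<open>auto simp: indicator_def\<close>)
  have sig: "sets borel = sigma_sets UNIV ?G"
    by (subst borel_eq_atLeastAtMost) auto
  have A: "A \<in> sigma_sets UNIV ?G" using assms sig by simp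
  have "Int_stable ?G"
    by (auto simp: Int_stable_def)
  moreover have "?G \<subseteq> Pow UNIV" by simp
  ultimately show ?thesis using A
  proof (induction rule: sigma_sets_induct_disjoint)
    case (basic A)
    then obtain a b where "A = {a..b}" by auto
    then have "A \<inter> {-R..R} = {max a (-R)..min b R}" by auto
    then show ?case using fourier_vanishes_interval by metis
  next
    case empty
    then show ?case by (simp add: fourier_vanishes_def)
  next
    case (compl A)
    have "(indicator ((UNIV - A) \<inter> {-R..R}) :: real \<Rightarrow> complex) = (\<lambda>x. indicator {-R..R} x + (-1) * indicator (A \<inter> {-R..R}) x)"
      by (auto simp: indicator_def)
    moreover have "fourier_vanishes \<dots>"
    proof (rule fourier_vanishes_add)
      show "integrable lborel (indicator {-R..R} :: real \<Rightarrow> complex)" using fin[of UNIV] by simp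
      show "integrable lborel (\<lambda>x. (-1) * (indicator (A \<inter> {-R..R}) x :: complex))"
        by (rule integrable_mult_right) (rule fin, use compl sig in simp)
      show "fourier_vanishes (\<lambda>x. (-1) * indicator (A \<inter> {-R..R}) x)"
        by (rule fourier_vanishes_mult) (rule compl)
    qed (rule fourier_vanishes_interval)
    ultimately show ?case by simp
  next
    case (union A)
    have Ab: "A i \<in> sets borel" for i using union sig by auto
    show ?case
    proof (rule fourier_vanishes_limit)
      show "integrable lborel (indicator ((\<Union>i<n. A i) \<inter> {-R..R}) :: real \<Rightarrow> complex)" for n
        using Ab by (intro fin) auto
      show "fourier_vanishes (indicator ((\<Union>i<n. A i) \<inter> {-R..R}))" for n
      proof (induction n)
        case 0 then show ?case by (simp add: fourier_vanishes_def)
      next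
        case (Suc n)
        have "A n \<inter> A i = {}" if "i < n" for i
          using union(1) that unfolding disjoint_family_on_def by (metis UNIV_I nat_neq_iff)
        then have "(indicator ((\<Union>i<Suc n. A i) \<inter> {-R..R}) :: real \<Rightarrow> complex)
          = (\<lambda>x. indicator ((\<Union>i<n. A i) \<inter> {-R..R}) x + indicator (A n \<inter> {-R..R}) x)"
          by (auto simp: indicator_def lessThan_Suc fun_eq_iff)
        moreover have "fourier_vanishes \<dots>"
          using Ab Suc union by (intro fourier_vanishes_add fin) auto
        ultimately show ?case by simp
      qed
      show "(\<lambda>n. indicator ((\<Union>i<n. A i) \<inter> {-R..R}) x :: complex) \<longlonglongrightarrow> indicator ((\<Union>i. A i) \<inter> {-R..R}) x" for x
      proof (rule tendsto_eventually)
        show "\<forall>\<^sub>F n in sequentially. indicator ((\<Union>i<n. A i) \<inter> {-R..R}) x = (indicator ((\<Union>i. A i) \<inter> {-R..R}) x :: complex)"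
        proof (cases "x \<in> (\<Union>i. A i)")
          case True
          then obtain i where "x \<in> A i" by auto
          then show ?thesis
            by (intro eventually_sequentiallyI[of "Suc i"]) (auto simp: indicator_def)
        qed (auto simp: indicator_def)
      qed
      show "norm (indicator ((\<Union>i<n. A i) \<inter> {-R..R}) x :: complex) \<le> indicator {-R..R} x" for n x
        by (auto simp: indicator_def)
      show "integrable lborel (indicator {-R..R} :: real \<Rightarrow> real)"
        by (intro integrable_real_indicator) (use emeasure_compact_finite[of "{-R..R}"] in auto)
    qed
  qed
qed

text \<open>Induction over integrable functions. A set of finite measure may be unbounded, so the
  base case exhausts it by its parts in [-n, n], dominated by its own indicator.\<close>

lemma Riemann_Lebesgue:
  fixes g :: "real \<Rightarrow> complex"
  assumes "integrable lborel g"
  shows "fourier_vanishes g"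
  using assms
proof (induction rule: integrable_induct)
  case (base A c)
  have fin: "integrable lborel (indicator A :: real \<Rightarrow> real)"
    using base by (intro integrable_real_indicator) auto
  have "fourier_vanishes (\<lambda>x. c * indicator A x)"
  proof (rule fourier_vanishes_mult, rule fourier_vanishes_limit)
    show "fourier_vanishes (indicator (A \<inter> {- real n..real n}))" for n
      using base by (intro fourier_vanishes_borel) auto
    have "integrable lborel (indicator (A \<inter> {- real n..real n}) :: real \<Rightarrow> real)" for n
      by (rule Bochner_Integration.integrable_bound[OF fin]) (use base in \<open>auto simp: indicator_def\<close>)
    then show "integrable lborel (indicator (A \<inter> {- real n..real n}) :: real \<Rightarrow> complex)" for n
      by (rule Bochner_Integration.integrable_bound) (use base in \<open>auto simp: indicator_def\<close>)
    show "(\<lambda>n. indicator (A \<inter> {- real n..real n}) x :: complex) \<longlonglongrightarrow> indicator A x" for x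
    proof (rule tendsto_eventually)
      obtain k :: nat where "\<bar>x\<bar> \<le> real k" using real_arch_simple by blast
      then show "\<forall>\<^sub>F n in sequentially. indicator (A \<inter> {- real n..real n}) x = (indicator A x :: complex)"
        by (intro eventually_sequentiallyI[of k]) (auto simp: indicator_def)
    qed
    show "norm (indicator (A \<inter> {- real n..real n}) x :: complex) \<le> indicator A x" for n x
      by (auto simp: indicator_def)
    show "integrable lborel (indicator A :: real \<Rightarrow> real)" by (rule fin)
  qed
  moreover have "(\<lambda>x. c * indicator A x) = (\<lambda>x. indicator A x *\<^sub>R c)"
    by (auto simp: indicator_def)
  ultimately show ?case by simp
next
  case (add f g)
  then show ?case by (intro fourier_vanishes_add)
next
  case (lim f s)
  show ?case
    by (rule fourier_vanishes_limit[of s f "\<lambda>x. 2 * norm (f x)"]) (use lim in auto)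
qed

lemma in_Hs_vanishes:
  assumes "in_Hs s v" "4 \<le> s"
  shows "(v \<longlongrightarrow> 0) at_infinity"
proof -
  obtain g where g: "Hs_rep s v g" using assms by (auto simp: in_Hs_def)
  have "integrable lborel g" using Hs_rep_integrable[OF g assms(2), of 0] by simp
  from Riemann_Lebesgue[OF this]
  have "((\<lambda>x. (LINT \<xi>|lborel. g \<xi> * exp (\<i> * complex_of_real (\<xi> * x))) / complex_of_real (2 * pi)) \<longlongrightarrow> 0 / complex_of_real (2 * pi)) at_infinity"
    unfolding fourier_vanishes_def by (intro tendsto_divide tendsto_const) auto
  then have "((\<lambda>x. complex_of_real (v x)) \<longlongrightarrow> 0) at_infinity"
    using g by (simp add: Hs_rep_def)
  then show ?thesis
    using tendsto_Re by fastforce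
qed

section \<open>Regularity and decay uniformly in time\<close>

lemma C1_Hs_C2bdd_difference:
  assumes C: "C1_Hs s T u ut" and s: "4 \<le> s" and t: "t \<in> {0..T}" and \<eta>: "0 < \<eta>"
  shows "\<exists>d>0. \<forall>\<tau>\<in>{0..T}. \<bar>\<tau> - t\<bar> < d \<longrightarrow> C2bdd \<eta> (\<lambda>x. u \<tau> x - u t x)"
proof -
  have Hs: "\<And>\<tau>. \<tau> \<in> {0..T} \<Longrightarrow> in_Hs s (u \<tau>)" "in_Hs s (ut t)"
    using C t by (auto simp: C1_Hs_def)
  define N where "N = 3 * (Hs_norm s (ut t) + 1)"
  have N: "C2bdd N (ut t)"
    unfolding N_def by (rule Hs_norm_C2bdd[OF Hs(2) s]) simp
  have N0: "0 \<le> N" by (rule C2bdd_nonneg[OF N])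
  have "((\<lambda>\<tau>. Hs_norm s (\<lambda>x. (u \<tau> x - u t x) / (\<tau> - t) - ut t x)) \<longlongrightarrow> 0) (at t within {0..T})"
    using C t by (auto simp: C1_Hs_def)
  then have "\<forall>\<^sub>F \<tau> in at t within {0..T}. Hs_norm s (\<lambda>x. (u \<tau> x - u t x) / (\<tau> - t) - ut t x) < 1"
    by (rule order_tendstoD) simp
  then obtain d where d: "d > 0" "\<And>\<tau>. \<tau> \<in> {0..T} \<Longrightarrow> \<tau> \<noteq> t \<Longrightarrow> \<bar>\<tau> - t\<bar> < d \<Longrightarrow>
     Hs_norm s (\<lambda>x. (u \<tau> x - u t x) / (\<tau> - t) - ut t x) < 1"
    unfolding eventually_at dist_real_def by auto
  \<comment> \<open>\<open>u \<tau> - u t\<close> is (\<tau> - t) times the sum of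
    \<open>ut t\<close>, bounded by N, and the error q of the difference quotient, bounded by 3. The
    choice of d' makes |\<tau> - t| (N + 3) at most \<eta>.\<close>
  define d' where "d' = min d (\<eta> / (N + 3))"
  show ?thesis
  proof (intro exI[of _ d'] conjI ballI impI)
    show "0 < d'" using d \<eta> N0 by (simp add: d'_def)
    fix \<tau> assume \<tau>: "\<tau> \<in> {0..T}" "\<bar>\<tau> - t\<bar> < d'"
    show "C2bdd \<eta> (\<lambda>x. u \<tau> x - u t x)"
    proof (cases "\<tau> = t")
      case True
      then show ?thesis using \<eta> unfolding C2bdd_def by (auto intro!: exI[of _ "\<lambda>x. 0"])
    next
      case False
      define q where "q = (\<lambda>x. (u \<tau> x - u t x) / (\<tau> - t) - ut t x)"
      have "in_Hs s (\<lambda>x. 1 / (\<tau> - t) * (1 * u \<tau> x + (-1) * u t x) + (-1) * ut t x)"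
        by (intro in_Hs_lincomb Hs s \<tau> t)
      then have "in_Hs s q" by (simp add: q_def)
      moreover have "Hs_norm s q < 1" using d(2)[of \<tau>] \<tau> False by (simp add: q_def d'_def)
      ultimately have "C2bdd 3 q" using Hs_norm_C2bdd[OF _ s, of q 1] by simp
      from C2bdd_scale[OF C2bdd_add[OF N this], of "\<tau> - t"]
      have "C2bdd (\<bar>\<tau> - t\<bar> * (N + 3)) (\<lambda>x. u \<tau> x - u t x)"
        using False by (simp add: q_def)
      moreover have "\<bar>\<tau> - t\<bar> * (N + 3) \<le> \<eta>"
      proof -
        have "\<bar>\<tau> - t\<bar> \<le> \<eta> / (N + 3)" using \<tau> by (simp add: d'_def)
        then show ?thesis using N0 by (simp add: field_simps)
      qed
      ultimately show ?thesis by (rule C2bdd_mono)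
    qed
  qed
qed

lemma C1_Hs_has_derivative:
  assumes C: "C1_Hs s T u ut" and s: "4 \<le> s" and t: "t \<in> {0..T}"
  shows "((\<lambda>\<tau>. u \<tau> x) has_real_derivative ut t x) (at t within {0..T})"
proof -
  have Hs: "\<And>\<tau>. \<tau> \<in> {0..T} \<Longrightarrow> in_Hs s (u \<tau>)" "in_Hs s (ut t)"
    using C t by (auto simp: C1_Hs_def)
  let ?N = "\<lambda>\<tau>. Hs_norm s (\<lambda>x. (u \<tau> x - u t x) / (\<tau> - t) - ut t x)"
  have lim: "(?N \<longlongrightarrow> 0) (at t within {0..T})"
    using C t by (auto simp: C1_Hs_def)
  have bd: "\<bar>(u \<tau> x - u t x) / (\<tau> - t) - ut t x\<bar> \<le> 3 * ?N \<tau>" if "\<tau> \<in> {0..T}" for \<tau>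
  \<comment> \<open>The strict hypothesis of \<open>Hs_norm_C2bdd\<close> costs e / 3. The case
    \<tau> = t is covered, because division by 0 gives 0 on both sides.\<close>
  proof (rule field_le_epsilon)
    fix e :: real assume "0 < e"
    have "in_Hs s (\<lambda>x. 1 / (\<tau> - t) * (1 * u \<tau> x + (-1) * u t x) + (-1) * ut t x)"
      by (intro in_Hs_lincomb Hs s that t)
    then have "in_Hs s (\<lambda>x. (u \<tau> x - u t x) / (\<tau> - t) - ut t x)" by simp
    from C2bdd_bound[OF Hs_norm_C2bdd[OF this s, of "?N \<tau> + e / 3"], of x] \<open>0 < e\<close>
    show "\<bar>(u \<tau> x - u t x) / (\<tau> - t) - ut t x\<bar> \<le> 3 * ?N \<tau> + e" by simp
  qed
  have "((\<lambda>\<tau>. (u \<tau> x - u t x) / (\<tau> - t) - ut t x) \<longlongrightarrow> 0) (at t within {0..T})"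
  proof (rule Lim_null_comparison)
    show "((\<lambda>\<tau>. 3 * ?N \<tau>) \<longlongrightarrow> 0) (at t within {0..T})"
      using tendsto_mult_right_zero[OF lim] by simp
    show "\<forall>\<^sub>F \<tau> in at t within {0..T}. norm ((u \<tau> x - u t x) / (\<tau> - t) - ut t x) \<le> 3 * ?N \<tau>"
      unfolding eventually_at using bd by (intro exI[of _ 1]) auto
  qed
  then show ?thesis
    by (simp add: has_field_derivative_iff Lim_null[of _ "ut t x"])
qed

text \<open>Counterexamples \<open>t n\<close> have a subsequence with limit l in S. The index n
  that works near l would, by monotonicity, also work for \<open>P (r k)\<close> once r k \<ge> n, a
  contradiction. It serves both the C^2 bound and the decay radius.\<close>

lemma compact_uniform_nat:
  fixes P :: "nat \<Rightarrow> real \<Rightarrow> bool"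
  assumes mono: "\<And>m n t. m \<le> n \<Longrightarrow> P m t \<Longrightarrow> P n t"
    and local: "\<And>t. t \<in> S \<Longrightarrow> \<exists>n. \<exists>d>0. \<forall>\<tau>\<in>S. \<bar>\<tau> - t\<bar> < d \<longrightarrow> P n \<tau>"
    and S: "compact S"
  shows "\<exists>n. \<forall>t\<in>S. P n t"
proof (rule ccontr)
  assume "\<not> ?thesis"
  then obtain t where t: "\<And>n. t n \<in> S" "\<And>n. \<not> P n (t n)" by metis
  obtain l r where l: "l \<in> S" "strict_mono r" "(t \<circ> r) \<longlonglongrightarrow> l"
    using S t(1) unfolding compact_def by meson
  obtain n d where d: "d > 0" "\<And>\<tau>. \<tau> \<in> S \<Longrightarrow> \<bar>\<tau> - l\<bar> < d \<Longrightarrow> P n \<tau>"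
    using local[OF l(1)] by metis
  have "\<forall>\<^sub>F k in sequentially. dist ((t \<circ> r) k) l < d"
    using l(3) d(1) by (rule tendstoD)
  moreover have "\<forall>\<^sub>F k in sequentially. n \<le> r k"
    using l(2) by (intro eventually_sequentiallyI[of n]) (meson order_trans seq_suble)
  ultimately have "\<forall>\<^sub>F k in sequentially. False"
  proof eventually_elim
    case (elim k)
    then have "P n (t (r k))" using d(2)[OF t(1)] by (simp add: dist_real_def)
    with mono[OF elim(2)] t(2) show ?case by blast
  qed
  then show False by simp
qed

lemma C1_Hs_uniform_C2bdd:
  assumes C: "C1_Hs s T u ut" and s: "4 \<le> s"
  shows "\<exists>M. \<forall>t\<in>{0..T}. C2bdd M (u t)"
proof -
  have "\<exists>n. \<forall>t\<in>{0..T}. C2bdd (real n) (u t)"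
  proof (rule compact_uniform_nat)
    fix t assume t: "t \<in> {0..T}"
    obtain d where d: "d > 0" "\<And>\<tau>. \<tau> \<in> {0..T} \<Longrightarrow> \<bar>\<tau> - t\<bar> < d \<Longrightarrow> C2bdd 1 (\<lambda>x. u \<tau> x - u t x)"
      using C1_Hs_C2bdd_difference[OF C s t zero_less_one] by blast
    define N where "N = 3 * (Hs_norm s (u t) + 1)"
    have N: "C2bdd N (u t)"
      unfolding N_def by (rule Hs_norm_C2bdd) (use C t s in \<open>auto simp: C1_Hs_def\<close>)
    obtain n where n: "1 + N \<le> real n" using real_arch_simple by blast
    have "C2bdd (real n) (u \<tau>)" if "\<tau> \<in> {0..T}" "\<bar>\<tau> - t\<bar> < d" for \<tau>
      using C2bdd_mono[OF C2bdd_add[OF d(2)[OF that] N] n] by simp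
    then show "\<exists>n. \<exists>d>0. \<forall>\<tau>\<in>{0..T}. \<bar>\<tau> - t\<bar> < d \<longrightarrow> C2bdd (real n) (u \<tau>)"
      using d(1) by blast
  qed (auto intro: C2bdd_mono)
  then show ?thesis by blast
qed

text \<open>Outside some interval \<open>u t\<close> itself is below \<eta> / 2, and at times near t
  the difference to \<open>u t\<close> is at most \<eta> / 2 everywhere, so one radius works in a
  neighbourhood of t.\<close>

lemma C1_Hs_uniform_decay:
  assumes C: "C1_Hs s T u ut" and s: "4 \<le> s" and \<eta>: "0 < \<eta>"
  shows "\<exists>R. \<forall>t\<in>{0..T}. \<forall>x. R \<le> \<bar>x\<bar> \<longrightarrow> \<bar>u t x\<bar> \<le> \<eta>"
proof -
  have "\<exists>n. \<forall>t\<in>{0..T}. \<forall>x. real n \<le> \<bar>x\<bar> \<longrightarrow> \<bar>u t x\<bar> \<le> \<eta>"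
  proof (rule compact_uniform_nat)
    fix t assume t: "t \<in> {0..T}"
    obtain d where d: "d > 0" "\<And>\<tau>. \<tau> \<in> {0..T} \<Longrightarrow> \<bar>\<tau> - t\<bar> < d \<Longrightarrow> C2bdd (\<eta> / 2) (\<lambda>x. u \<tau> x - u t x)"
      using C1_Hs_C2bdd_difference[OF C s t, of "\<eta> / 2"] \<eta> by auto
    have "(u t \<longlongrightarrow> 0) at_infinity"
      using in_Hs_vanishes[OF _ s] C t by (auto simp: C1_Hs_def)
    then have "\<forall>\<^sub>F x in at_infinity. dist (u t x) 0 < \<eta> / 2" by (rule tendstoD) (use \<eta> in simp)
    then obtain b where b: "\<And>x. b \<le> \<bar>x\<bar> \<Longrightarrow> \<bar>u t x\<bar> < \<eta> / 2"
      unfolding eventually_at_infinity by auto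
    obtain n where n: "b \<le> real n" using real_arch_simple by blast
    have "\<bar>u \<tau> x\<bar> \<le> \<eta>" if "\<tau> \<in> {0..T}" "\<bar>\<tau> - t\<bar> < d" "real n \<le> \<bar>x\<bar>" for \<tau> x
      using C2bdd_bound[OF d(2)[OF that(1,2)], of x] b[of x] n that(3) by linarith
    then show "\<exists>n. \<exists>d>0. \<forall>\<tau>\<in>{0..T}. \<bar>\<tau> - t\<bar> < d \<longrightarrow> (\<forall>x. real n \<le> \<bar>x\<bar> \<longrightarrow> \<bar>u \<tau> x\<bar> \<le> \<eta>)"
      using d(1) by blast
  next
    show "\<forall>x. real n \<le> \<bar>x\<bar> \<longrightarrow> \<bar>u t x\<bar> \<le> \<eta>"
      if "m \<le> n" "\<forall>x. real m \<le> \<bar>x\<bar> \<longrightarrow> \<bar>u t x\<bar> \<le> \<eta>" for m n t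
      using that by (meson of_nat_mono order_trans)
  qed auto
  then show ?thesis by blast
qed

section \<open>Smooth test functions and second differences of the kernel\<close>

text \<open>With q = x (1 - x), the functions P q^(-m) exp (-1/q) form a class closed under
  differentiation. Smoothness of the standard bump, P = 1 and m = 0, thus reduces to one
  differentiation step on pairs (P, m).\<close>

definition bump :: "real poly \<Rightarrow> nat \<Rightarrow> real \<Rightarrow> real" where
  "bump P m x = (if 0 < x \<and> x < 1
     then poly P x / (x * (1 - x)) ^ m * exp (- 1 / (x * (1 - x))) else 0)"

text \<open>The product rule over the common denominator q^(m+2): \<open>[:0, 1, -1:]\<close> is q
  and \<open>[:1, -2:]\<close> is its derivative. The three terms come from P, from q^(-m) and from
  the exponential.\<close>

definition bump_step :: "real poly \<times> nat \<Rightarrow> real poly \<times> nat" where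
  "bump_step = (\<lambda>(P, m). (pderiv P * [:0, 1, -1:]\<^sup>2 - smult (real m) (P * [:1, -2:] * [:0, 1, -1:])
       + P * [:1, -2:], m + 2))"

text \<open>Raising 1 / (n q) \<le> exp (1 / (n q)) to the power n gives exp (-1/q) \<le> (n q)^n.
  With n = m + 2 a factor q^2 survives division by q^m, and this quadratic decay forces the
  derivative 0 at the two end points.\<close>

lemma bump_quadratic_bound:
  "\<exists>K. \<forall>x. \<bar>bump P m x\<bar> \<le> K * x\<^sup>2 \<and> \<bar>bump P m x\<bar> \<le> K * (1 - x)\<^sup>2"
proof -
  define n where "n = m + 2"
  have "compact (poly P ` {0..1})"
    by (intro compact_continuous_image continuous_intros) auto
  then obtain B where B: "\<And>x. 0 \<le> x \<Longrightarrow> x \<le> 1 \<Longrightarrow> \<bar>poly P x\<bar> \<le> B"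
    by (force simp: bounded_iff dest!: compact_imp_bounded)
  have B0: "0 \<le> B" using B[of 0] by simp
  have main: "\<bar>bump P m x\<bar> \<le> B * real n ^ n * (x * (1 - x))\<^sup>2" if "0 < x" "x < 1" for x
  proof -
    define q where "q = x * (1 - x)"
    have q: "0 < q" using that by (simp add: q_def)
    have n0: "0 < real n" by (simp add: n_def)
    have "(1 / (q * n)) ^ n \<le> exp (1 / (q * n)) ^ n"
      using q n0 exp_ge_add_one_self[of "1 / (q * n)"]
      by (intro power_mono) (linarith, simp)
    also have "\<dots> = exp (1 / q)"
      using n0 by (simp flip: exp_of_nat_mult)
    finally have "1 \<le> exp (1 / q) * (q * n) ^ n"
      using q n0 by (simp add: power_divide field_simps)
    then have "exp (- (1 / q)) \<le> (q * n) ^ n"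
      by (simp add: exp_minus field_simps)
    then have "exp (- 1 / q) / q ^ m \<le> (q * n) ^ n / q ^ m"
      using q by (intro divide_right_mono) auto
    also have "\<dots> = real n ^ n * q\<^sup>2"
      using q by (simp add: n_def power_mult_distrib power_add power2_eq_square)
    finally have e: "exp (- 1 / q) / q ^ m \<le> real n ^ n * q\<^sup>2" .
    have "\<bar>bump P m x\<bar> = \<bar>poly P x\<bar> * (exp (- 1 / q) / q ^ m)"
      using that q by (simp add: bump_def abs_mult q_def)
    also have "\<dots> \<le> B * (real n ^ n * q\<^sup>2)"
      using B[of x] that e q B0 by (intro mult_mono) auto
    finally show ?thesis by (simp add: q_def mult_ac)
  qed
  show ?thesis
  proof (intro exI[of _ "B * real n ^ n"] allI)
    fix x :: real
    have K: "0 \<le> B * real n ^ n" using B0 by simp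
    show "\<bar>bump P m x\<bar> \<le> B * real n ^ n * x\<^sup>2 \<and> \<bar>bump P m x\<bar> \<le> B * real n ^ n * (1 - x)\<^sup>2"
    proof (cases "0 < x \<and> x < 1")
      case True
      have "(x * (1 - x))\<^sup>2 \<le> x\<^sup>2" "(x * (1 - x))\<^sup>2 \<le> (1 - x)\<^sup>2"
        using True by (auto intro!: power_mono mult_left_le mult_left_le_one_le)
      then show ?thesis using main[of x] True K
        by (meson mult_left_mono order_trans)
    qed (use K in \<open>auto simp: bump_def\<close>)
  qed
qed

lemma DERIV_zero_quadratic:
  fixes f :: "real \<Rightarrow> real"
  assumes "\<And>y. \<bar>f y\<bar> \<le> K * (y - x)\<^sup>2"
  shows "(f has_real_derivative 0) (at x)"
proof -
  have f0: "f x = 0" using assms[of x] by simp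
  have "((\<lambda>y. (f y - f x) / (y - x)) \<longlongrightarrow> 0) (at x)"
  proof (rule Lim_null_comparison)
    show "((\<lambda>y. K * \<bar>y - x\<bar>) \<longlongrightarrow> 0) (at x)" by (auto intro!: tendsto_eq_intros)
    have "\<bar>(f y - f x) / (y - x)\<bar> \<le> K * \<bar>y - x\<bar>" if "y \<noteq> x" for y
    proof -
      have "\<bar>f y\<bar> \<le> K * \<bar>y - x\<bar> * \<bar>y - x\<bar>"
        using assms[of y] by (simp add: power2_eq_square mult.assoc)
      then show ?thesis using that f0 by (simp add: divide_le_eq)
    qed
    then show "\<forall>\<^sub>F y in at x. norm ((f y - f x) / (y - x)) \<le> K * \<bar>y - x\<bar>"
      by (auto simp: eventually_at intro!: exI[of _ 1])
  qed
  then show ?thesis by (simp add: has_field_derivative_iff)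
qed

lemma DERIV_bump:
  "(bump P m has_real_derivative case_prod bump (bump_step (P, m)) x) (at x)"
proof -
  consider "x < 0 \<or> 1 < x" | "x = 0 \<or> x = 1" | "0 < x" "x < 1" by linarith
  then show ?thesis
  proof cases
    case 1
    then have z: "case_prod bump (bump_step (P, m)) x = 0"
      by (auto simp: bump_def split: prod.splits)
    show ?thesis unfolding z
      by (rule has_field_derivative_transform_within_open[OF DERIV_const[of 0 "at x"], of "{..<0} \<union> {1<..}"])
        (use 1 in \<open>auto simp: bump_def\<close>)
  next
    case 2
    then have z: "case_prod bump (bump_step (P, m)) x = 0"
      by (auto simp: bump_def split: prod.splits)
    obtain K where K: "\<And>x. \<bar>bump P m x\<bar> \<le> K * x\<^sup>2" "\<And>x. \<bar>bump P m x\<bar> \<le> K * (1 - x)\<^sup>2"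
      using bump_quadratic_bound by blast
    have "\<bar>bump P m y\<bar> \<le> K * (y - x)\<^sup>2" for y
      using 2 K[of y] by (auto simp: power2_commute[of 1 y])
    then show ?thesis unfolding z by (rule DERIV_zero_quadratic)
  next
    case 3
    define q where "q = x * (1 - x)"
    have q: "q > 0" using 3 by (simp add: q_def)
    have dq: "((\<lambda>x. x * (1 - x)) has_real_derivative (1 - 2 * x)) (at x)"
      by (auto intro!: derivative_eq_intros)
    have 1: "((\<lambda>x. 1 / (x * (1 - x)) ^ m) has_real_derivative - (real m * (1 - 2 * x) / q ^ (m + 1))) (at x)"
    proof -
      have "((\<lambda>x. inverse ((x * (1 - x)) ^ m)) has_real_derivative
         - (inverse (q ^ m) * (real m * ((1 - 2 * x) * q ^ (m - 1))) * inverse (q ^ m))) (at x)"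
        using DERIV_inverse'[OF DERIV_power[OF dq, of m]] q 3 by (simp add: q_def)
      moreover have "inverse (q ^ m) * (real m * ((1 - 2 * x) * q ^ (m - 1))) * inverse (q ^ m)
         = real m * (1 - 2 * x) / q ^ (m + 1)"
        using q by (cases m) (auto simp: field_simps)
      ultimately show ?thesis by (simp add: inverse_eq_divide)
    qed
    have 2: "((\<lambda>x. exp (- 1 / (x * (1 - x)))) has_real_derivative exp (- 1 / q) * ((1 - 2 * x) / q\<^sup>2)) (at x)"
    proof -
      have "((\<lambda>x. - 1 / (x * (1 - x))) has_real_derivative (0 * q - (- 1) * (1 - 2 * x)) / (q * q)) (at x)"
        using q unfolding q_def by (intro DERIV_divide DERIV_const dq) auto
      from DERIV_fun_exp[OF this] show ?thesis
        by (simp add: q_def power2_eq_square)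
    qed
    have "((\<lambda>x. poly P x * (1 / (x * (1 - x)) ^ m) * exp (- 1 / (x * (1 - x)))) has_real_derivative
       (poly (pderiv P) x * (1 / q ^ m) + - (real m * (1 - 2 * x) / q ^ (m + 1)) * poly P x) * exp (- 1 / q)
       + exp (- 1 / q) * ((1 - 2 * x) / q\<^sup>2) * (poly P x * (1 / q ^ m))) (at x)"
      using DERIV_mult[OF DERIV_mult[OF poly_DERIV 1] 2] by (simp add: q_def)
    moreover have "(poly (pderiv P) x * (1 / q ^ m) + - (real m * (1 - 2 * x) / q ^ (m + 1)) * poly P x) * exp (- 1 / q)
       + exp (- 1 / q) * ((1 - 2 * x) / q\<^sup>2) * (poly P x * (1 / q ^ m)) = case_prod bump (bump_step (P, m)) x"
    proof -
      have qq: "q = x + - (x * x)" by (simp add: q_def algebra_simps)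
      have "case_prod bump (bump_step (P, m)) x
        = (poly (pderiv P) x * q\<^sup>2 - real m * (poly P x * (1 - 2 * x) * q) + poly P x * (1 - 2 * x)) / q ^ (m + 2) * exp (- 1 / q)"
        using 3 by (simp add: bump_def bump_step_def q_def algebra_simps)
      also have "(poly (pderiv P) x * q\<^sup>2 - real m * (poly P x * (1 - 2 * x) * q) + poly P x * (1 - 2 * x)) / q ^ (m + 2)
        = poly (pderiv P) x * (1 / q ^ m) + - (real m * (1 - 2 * x) / q ^ (m + 1)) * poly P x + ((1 - 2 * x) / q\<^sup>2) * (poly P x * (1 / q ^ m))"
        using q by (simp add: power_add power2_eq_square field_simps)
      finally show ?thesis by (simp only: distrib_right distrib_left mult_ac)
    qed
    ultimately have d: "((\<lambda>x. poly P x * (1 / (x * (1 - x)) ^ m) * exp (- 1 / (x * (1 - x)))) has_real_derivative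
        case_prod bump (bump_step (P, m)) x) (at x)" by simp
    show ?thesis
      by (rule has_field_derivative_transform_within_open[OF d, of "{0<..<1}"]) (use 3 in \<open>auto simp: bump_def\<close>)
  qed
qed

lemma antiderivative_from_zero:
  fixes f :: "real \<Rightarrow> real"
  assumes cont: "continuous_on UNIV f" and z: "\<And>x. x \<le> 0 \<Longrightarrow> f x = 0"
  obtains F where "\<And>x. (F has_real_derivative f x) (at x)" "\<And>x. x \<le> 0 \<Longrightarrow> F x = 0"
proof
  \<comment> \<open>The integral starts at -1 rather than 0, so that the derivative at 0 is taken in
    the interior of an interval.\<close>
  let ?F = "\<lambda>x. integral {-1..x} f"
  show F0: "?F x = 0" if "x \<le> 0" for x
    using that z by (intro integral_unique has_integral_is_0) auto
  show "(?F has_real_derivative f x) (at x)" for x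
  proof (cases "x < 0")
    case True
    then show ?thesis
      using has_field_derivative_transform_within_open[OF DERIV_const[of 0 "at x"], of "{..<0}" ?F]
        F0 z[of x] by auto
  next
    case False
    have "(?F has_real_derivative f x) (at x within {-1..x + 1})"
      by (rule integral_has_real_derivative) (use False cont in \<open>auto intro: continuous_on_subset\<close>)
    moreover have "at x within {-1..x + 1} = at x"
      using False by (intro at_within_Icc_at) auto
    ultimately show ?thesis by simp
  qed
qed

text \<open>The family is a smoothed ramp with all its derivatives: \<open>r 2\<close> is the bump
  divided by its integral, \<open>r 1\<close> a smooth step from 0 to 1, \<open>r 0\<close> the ramp
  itself. Indexing by n makes the iterated \<open>deriv\<close> of test functions
  computable.\<close>

lemma smooth_ramp:
  obtains r :: "nat \<Rightarrow> real \<Rightarrow> real"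
  where "\<And>n x. (r n has_real_derivative r (Suc n) x) (at x)"
    and "\<And>x. x \<le> 0 \<Longrightarrow> r 0 x = 0" "\<And>x. x \<le> 0 \<Longrightarrow> r 1 x = 0" "\<And>x. 1 \<le> x \<Longrightarrow> r 1 x = 1"
    and "\<And>x. 0 \<le> r 2 x" "\<And>x. x \<notin> {0..1} \<Longrightarrow> r 2 x = 0"
proof -
  define b where "b n = case_prod bump ((bump_step ^^ n) (1, 0))" for n
  have db: "(b n has_real_derivative b (Suc n) x) (at x)" for n x
    using DERIV_bump[of "fst ((bump_step ^^ n) (1, 0))" "snd ((bump_step ^^ n) (1, 0))" x]
    by (simp add: b_def split_beta')
  have b0: "b 0 x = (if 0 < x \<and> x < 1 then exp (- 1 / (x * (1 - x))) else 0)" for x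
    by (simp add: b_def bump_def)
  have bc: "continuous_on UNIV (b 0)"
    by (intro continuous_at_imp_continuous_on ballI DERIV_isCont) (rule db)
  obtain \<sigma> where \<sigma>: "\<And>x. (\<sigma> has_real_derivative b 0 x) (at x)" "\<And>x. x \<le> 0 \<Longrightarrow> \<sigma> x = 0"
    by (rule antiderivative_from_zero[OF bc]) (auto simp: b0)
  have sc: "continuous_on UNIV \<sigma>"
    by (intro continuous_at_imp_continuous_on ballI DERIV_isCont) (rule \<sigma>(1))
  obtain R where R: "\<And>x. (R has_real_derivative \<sigma> x) (at x)" "\<And>x. x \<le> 0 \<Longrightarrow> R x = 0"
    by (rule antiderivative_from_zero[OF sc]) (auto simp: \<sigma>)
  have "\<sigma> 0 < \<sigma> 1"
    by (rule DERIV_pos_imp_increasing_open)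
       (auto intro!: exI[of _ "b 0 _"] \<sigma> continuous_on_subset[OF sc] simp: b0)
  then have c: "0 < \<sigma> 1" using \<sigma>(2)[of 0] by simp
  have one: "\<sigma> x = \<sigma> 1" if "1 \<le> x" for x
  proof (cases "x = 1")
    case False
    then show ?thesis using that
      by (intro DERIV_isconst_end[of 1 x \<sigma>]) (auto intro!: continuous_on_subset[OF sc], metis \<sigma>(1) b0 not_less_iff_gr_or_eq order_less_asym)
  qed simp
  define r where "r n = (\<lambda>x. (case n of 0 \<Rightarrow> R x | Suc 0 \<Rightarrow> \<sigma> x | Suc (Suc k) \<Rightarrow> b k x) / \<sigma> 1)" for n
  show ?thesis
  proof
    show "(r n has_real_derivative r (Suc n) x) (at x)" for n x
    proof -
      consider "n = 0" | "n = 1" | k where "n = Suc (Suc k)"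
        by (metis One_nat_def not0_implies_Suc)
      then show ?thesis
        by cases (auto simp: r_def intro!: DERIV_cdivide R \<sigma> db)
    qed
    show "r 0 x = 0" if "x \<le> 0" for x using that R by (simp add: r_def)
    show "r 1 x = 0" if "x \<le> 0" for x using that \<sigma> by (simp add: r_def)
    show "r 1 x = 1" if "1 \<le> x" for x using one[OF that] c by (simp add: r_def)
    show "0 \<le> r 2 x" for x using c by (simp add: r_def numeral_2_eq_2 b0)
    show "r 2 x = 0" if "x \<notin> {0..1}" for x using that by (auto simp: r_def numeral_2_eq_2 b0)
  qed
qed

lemma funpow_deriv_family:
  fixes F :: "nat \<Rightarrow> real \<Rightarrow> real"
  assumes "\<And>n x. (F n has_real_derivative F (Suc n) x) (at x)"
  shows "(deriv ^^ n) (F 0) = F n"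
proof (induction n)
  case (Suc n)
  then show ?case using assms by (auto intro!: DERIV_imp_deriv)
qed simp

section \<open>Second differences of \<alpha>' as integrals against \<mu>\<close>

lemma cond_C1_continuous_deriv:
  assumes "cond_C1 \<alpha>"
  shows "continuous_on UNIV (deriv \<alpha>)"
proof -
  obtain g where g: "integrable lborel g"
    and gd: "\<And>a b. a \<le> b \<Longrightarrow> deriv \<alpha> b - deriv \<alpha> a = (LBINT y:{a..b}. g y)"
    using assms unfolding cond_C1_def by blast
  have "isCont (deriv \<alpha>) x" for x
  proof -
    have si: "set_integrable lborel {x - 1..y} g" for y
      unfolding set_integrable_def by (intro integrable_mult_indicator g) auto
    have "continuous_on {x - 1..x + 1} (\<lambda>y. deriv \<alpha> (x - 1) + integral {x - 1..y} g)"
      by (intro continuous_intros indefinite_integral_continuous_1 set_borel_integral_eq_integral(1) si)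
    moreover have "deriv \<alpha> (x - 1) + integral {x - 1..y} g = deriv \<alpha> y" if "y \<in> {x - 1..x + 1}" for y
      using gd[of "x - 1" y] set_borel_integral_eq_integral(2)[OF si[of y]] that by simp
    ultimately have "continuous_on {x - 1..x + 1} (deriv \<alpha>)"
      by (rule continuous_on_eq)
    then show ?thesis by (rule continuous_on_interior) simp
  qed
  then show ?thesis by (simp add: continuous_at_imp_continuous_on)
qed

lemma continuous_compact_support_integrable:
  fixes f :: "real \<Rightarrow> real"
  assumes "continuous_on UNIV f" "\<And>x. R < \<bar>x\<bar> \<Longrightarrow> f x = 0"
  shows "integrable lborel f"
proof -
  have "integrable lborel (\<lambda>x. indicator {-R..R} x *\<^sub>R f x)"
    by (intro borel_integrable_compact continuous_on_subset[OF assms(1)]) auto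
  also have "(\<lambda>x. indicator {-R..R} x *\<^sub>R f x) = f"
  proof
    fix x show "indicator {-R..R} x *\<^sub>R f x = f x"
      using assms(2)[of x] by (cases "R < \<bar>x\<bar>") (auto simp: indicator_def)
  qed
  finally show ?thesis .
qed

lemma integral_derivative_compact_support:
  fixes F :: "real \<Rightarrow> real"
  assumes d: "\<And>x. (F has_real_derivative f x) (at x)" and c: "continuous_on UNIV f"
    and z: "\<And>x. R < \<bar>x\<bar> \<Longrightarrow> F x = 0" "\<And>x. R < \<bar>x\<bar> \<Longrightarrow> f x = 0"
  shows "(LBINT x. f x) = 0"
proof -
  define N where "N = \<bar>R\<bar> + 1"
  have "has_bochner_integral lborel (\<lambda>x. indicator {-N..N} x *\<^sub>R f x) (F N - F (-N))"
    by (rule has_bochner_integral_FTC_Icc)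
       (use d c in \<open>auto simp: N_def has_real_derivative_iff_has_vector_derivative
          intro: has_vector_derivative_at_within continuous_on_subset\<close>)
  moreover have "(\<lambda>x. indicator {-N..N} x *\<^sub>R f x) = f"
  proof
    fix x show "indicator {-N..N} x *\<^sub>R f x = f x"
      using z(2)[of x] by (cases "R < \<bar>x\<bar>") (auto simp: indicator_def N_def)
  qed
  ultimately have "has_bochner_integral lborel f (F N - F (-N))" by simp
  then show ?thesis using z(1)[of N] z(1)[of "-N"] by (simp add: has_bochner_integral_iff N_def)
qed

text \<open>The continuous piecewise linear function whose second derivative is
  \<open>\<delta>\<^sub>p - \<delta>\<^bsub>p+k\<^esub> - \<delta>\<^sub>y + \<delta>\<^bsub>y+k\<^esub>\<close>.\<close>

definition trap :: "real \<Rightarrow> real \<Rightarrow> real \<Rightarrow> real \<Rightarrow> real" where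
  "trap p y k x = max (x - p) 0 - max (x - (p + k)) 0 - max (x - y) 0 + max (x - (y + k)) 0"

lemma trap_bounds:
  assumes "p \<le> y" "0 \<le> k"
  shows "0 \<le> trap p y k x" "trap p y k x \<le> k"
    "x \<notin> {p<..<y + k} \<Longrightarrow> trap p y k x = 0"
  using assms by (auto simp: trap_def max_def)

text \<open>For a smoothed trapezoid \<phi>, the identity defining \<mu> and one integration by
  parts show that \<beta> integrated against the second derivative of \<phi> equals \<mu>(\<phi>).
  That second derivative consists of four approximate point masses, so by continuity the left side
  tends to the four values of \<beta>. The right side converges because \<phi> is uniformly within 4
  \<delta> of the trapezoid and both measures are finite.\<close>

lemma second_derivative_measure:
  assumes C1: "cond_C1 \<alpha>" and C2: "cond_C2 \<alpha> M1 M2"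
    and py: "p \<le> y" and k: "0 \<le> k"
  shows "deriv \<alpha> p - deriv \<alpha> (p + k) - deriv \<alpha> y + deriv \<alpha> (y + k)
    = (LINT x|M1. trap p y k x) - (LINT x|M2. trap p y k x)"
proof -
  let ?\<beta> = "deriv \<alpha>"
  interpret M1: finite_measure M1 using C2 by (simp add: cond_C2_def)
  interpret M2: finite_measure M2 using C2 by (simp add: cond_C2_def)
  have sets[measurable_cong]: "sets M1 = sets borel" "sets M2 = sets borel" using C2 by (auto simp: cond_C2_def)
  have cb: "continuous_on UNIV ?\<beta>" by (rule cond_C1_continuous_deriv[OF C1])
  have da: "(\<alpha> has_real_derivative ?\<beta> x) (at x)" for x
    using C1 by (simp add: cond_C1_def DERIV_deriv_iff_real_differentiable)
  have ca: "continuous_on UNIV \<alpha>"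
    by (intro continuous_at_imp_continuous_on ballI DERIV_isCont) (rule da)
  obtain r where r: "\<And>n x. (r n has_real_derivative r (Suc n) x) (at x)"
    and r0: "\<And>x. x \<le> 0 \<Longrightarrow> r 0 x = 0" and r1: "\<And>x. x \<le> 0 \<Longrightarrow> r 1 x = 0" "\<And>x. 1 \<le> x \<Longrightarrow> r 1 x = 1"
    and r2: "\<And>x. 0 \<le> r 2 x" "\<And>x. x \<notin> {0..1} \<Longrightarrow> r 2 x = 0"
    using smooth_ramp by metis
  have rc: "continuous_on UNIV (r n)" for n
    by (intro continuous_at_imp_continuous_on ballI DERIV_isCont) (rule r)
  have r1mono: "r 1 x \<le> r 1 x'" if "x \<le> x'" for x x'
    by (rule DERIV_nonneg_imp_nondecreasing[OF that])
       (use r[of 1] r2(1) in \<open>auto simp: numeral_2_eq_2\<close>)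
  have r1b: "0 \<le> r 1 x" "r 1 x \<le> 1" for x
    using r1mono[of "min x 0" x] r1mono[of x "max x 1"] r1(1)[of "min x 0"] r1(2)[of "max x 1"] by auto
  have diffmono: "x - r 0 x \<le> x' - r 0 x'" if "x \<le> x'" for x x'
    by (rule DERIV_nonneg_imp_nondecreasing[OF that])
       (use r[of 0] r1b in \<open>auto intro!: derivative_eq_intros exI\<close>)
  \<comment> \<open>Right of 1 the slope is 1, so the ramp is a line displaced by the constant 1 -
    \<open>r 0 1\<close>; this displacement has to cancel in \<phi>.\<close>
  have r0lin: "r 0 x = x - (1 - r 0 1)" if "1 \<le> x" for x
  proof -
    have "x - r 0 x \<le> 1 - r 0 1"
    proof (rule DERIV_nonpos_imp_nonincreasing[OF that])
      fix z :: real assume "1 \<le> z"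
      then show "\<exists>d. ((\<lambda>x. x - r 0 x) has_real_derivative d) (at z) \<and> d \<le> 0"
        using DERIV_diff[OF DERIV_ident r[of 0 z]] r1(2)[of z] by auto
    qed
    then show ?thesis using diffmono[OF that] by simp
  qed
  have r0near: "\<bar>r 0 x - max x 0\<bar> \<le> 1" for x
  proof -
    have m: "r 0 x \<le> r 0 x'" if "x \<le> x'" for x x'
      by (rule DERIV_nonneg_imp_nondecreasing[OF that]) (use r[of 0] r1b in auto)
    have "0 \<le> r 0 1" using m[of 0 1] r0[of 0] by simp
    then show ?thesis
      using diffmono[of 0 x] diffmono[of x 1] m[of 0 x] r0[of 0] r0[of x] r0lin[of x]
      by (cases "x \<le> 0"; cases "1 \<le> x") auto
  qed
  \<comment> \<open>The n-th derivative of \<delta> r ((x - a) / \<delta>), the ramp at a smoothed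
    at scale \<delta>; for n = 2 it is an approximate point mass on [a, a + \<delta>].\<close>
  define G where "G \<delta> a n x = \<delta> * (1 / \<delta>) ^ n * r n ((x - a) / \<delta>)" for \<delta> a n x
  have dG: "(G \<delta> a n has_real_derivative G \<delta> a (Suc n) x) (at x)" for \<delta> a n x
  proof -
    have "((\<lambda>x. (x - a) / \<delta>) has_real_derivative 1 / \<delta>) (at x)"
      by (intro DERIV_cdivide) (auto intro!: derivative_eq_intros)
    from DERIV_cmult[OF DERIV_chain'[where g = "r n", OF this r], of "\<delta> * (1 / \<delta>) ^ n"]
    have "((\<lambda>x. \<delta> * (1 / \<delta>) ^ n * r n ((x - a) / \<delta>)) has_real_derivative
      \<delta> * (1 / \<delta>) ^ n * (r (Suc n) ((x - a) / \<delta>) * (1 / \<delta>))) (at x)" .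
    moreover have "\<delta> * (1 / \<delta>) ^ n * (r (Suc n) ((x - a) / \<delta>) * (1 / \<delta>)) = G \<delta> a (Suc n) x"
      by (simp only: G_def power_Suc mult_ac)
    moreover have "G \<delta> a n = (\<lambda>x. \<delta> * (1 / \<delta>) ^ n * r n ((x - a) / \<delta>))"
      by (simp add: G_def fun_eq_iff)
    ultimately show ?thesis by simp
  qed
  have Gc: "continuous_on UNIV (G \<delta> a n)" for \<delta> a n
    by (intro continuous_at_imp_continuous_on ballI DERIV_isCont) (rule dG)
  have G2: "0 \<le> G \<delta> a 2 x" "x \<notin> {a..a + \<delta>} \<Longrightarrow> G \<delta> a 2 x = 0" if "0 < \<delta>" for \<delta> a x
    using that r2(1) r2(2)[of "(x - a) / \<delta>"] by (auto simp: G_def field_simps)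
  have Gint: "integrable lborel (\<lambda>x. b x * G \<delta> a 2 x)" if "0 < \<delta>" "continuous_on UNIV b" for \<delta> a and b :: "real \<Rightarrow> real"
  proof (rule continuous_compact_support_integrable)
    show "b x * G \<delta> a 2 x = 0" if "\<bar>a\<bar> + \<delta> < \<bar>x\<bar>" for x
    proof -
      have "\<not> (a \<le> x \<and> x \<le> a + \<delta>)" using that \<open>0 < \<delta>\<close> by arith
      then show ?thesis using G2(2)[OF \<open>0 < \<delta>\<close>, of x a] by simp
    qed
  qed (intro continuous_intros Gc that)
  have G1: "(LBINT x. G \<delta> a 2 x) = 1" if "0 < \<delta>" for \<delta> a
  proof -
    have "has_bochner_integral lborel (\<lambda>x. indicator {a..a + \<delta>} x *\<^sub>R G \<delta> a 2 x) (G \<delta> a 1 (a + \<delta>) - G \<delta> a 1 a)"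
      using dG[of \<delta> a 1] that
      by (intro has_bochner_integral_FTC_Icc continuous_on_subset[OF Gc])
         (auto simp: has_real_derivative_iff_has_vector_derivative numeral_2_eq_2 intro: has_vector_derivative_at_within)
    moreover have "(\<lambda>x. indicator {a..a + \<delta>} x *\<^sub>R G \<delta> a 2 x) = G \<delta> a 2"
    proof
      fix x show "indicator {a..a + \<delta>} x *\<^sub>R G \<delta> a 2 x = G \<delta> a 2 x"
        using G2(2)[OF that, of x a] by (auto simp: indicator_def)
    qed
    moreover have "G \<delta> a 1 (a + \<delta>) - G \<delta> a 1 a = 1"
      using that r1 by (simp add: G_def)
    ultimately show ?thesis by (simp add: has_bochner_integral_iff)
  qed
  define \<phi> where "\<phi> \<delta> n x = G \<delta> p n x - G \<delta> (p + k) n x - G \<delta> y n x + G \<delta> (y + k) n x" for \<delta> n x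
  have d\<phi>: "(\<phi> \<delta> n has_real_derivative \<phi> \<delta> (Suc n) x) (at x)" for \<delta> n x
    unfolding \<phi>_def by (intro DERIV_add DERIV_diff dG)
  have \<phi>c: "continuous_on UNIV (\<phi> \<delta> n)" for \<delta> n
    by (intro continuous_at_imp_continuous_on ballI DERIV_isCont) (rule d\<phi>)
  define S where "S = \<bar>p\<bar> + \<bar>y\<bar> + k + 1"
  \<comment> \<open>Far to the left all four ramps vanish. Far to the right they are lines, and with
    the signs +, -, -, + their slopes, their displacements and the base points p, p + k, y, y + k
    all cancel.\<close>
  have \<phi>0: "\<phi> \<delta> 0 x = 0" if "0 < \<delta>" "\<delta> < 1" "S < \<bar>x\<bar>" for \<delta> x
  proof (cases "x < 0")
    case True
    then have "x \<le> a" if "\<bar>a\<bar> \<le> \<bar>p\<bar> + \<bar>y\<bar> + k" for a using that \<open>S < \<bar>x\<bar>\<close> by (auto simp: S_def)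
    then have "G \<delta> a 0 x = 0" if "\<bar>a\<bar> \<le> \<bar>p\<bar> + \<bar>y\<bar> + k" for a
      using that r0[of "(x - a) / \<delta>"] \<open>0 < \<delta>\<close> by (simp add: G_def divide_le_0_iff)
    then show ?thesis using k by (simp add: \<phi>_def)
  next
    case False
    then have "x \<ge> a + \<delta>" if "\<bar>a\<bar> \<le> \<bar>p\<bar> + \<bar>y\<bar> + k" for a using that \<open>S < \<bar>x\<bar>\<close> \<open>\<delta> < 1\<close> by (auto simp: S_def)
    then have "G \<delta> a 0 x = x - a - \<delta> * (1 - r 0 1)" if "\<bar>a\<bar> \<le> \<bar>p\<bar> + \<bar>y\<bar> + k" for a
    proof -
      have "\<delta> \<le> x - a" using \<open>\<And>a. \<bar>a\<bar> \<le> \<bar>p\<bar> + \<bar>y\<bar> + k \<Longrightarrow> a + \<delta> \<le> x\<close>[OF that] by simp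
      then have "r 0 ((x - a) / \<delta>) = (x - a) / \<delta> - (1 - r 0 1)"
        using r0lin[of "(x - a) / \<delta>"] \<open>0 < \<delta>\<close> by simp
      moreover have "\<delta> * ((x - a) / \<delta>) = x - a" using \<open>0 < \<delta>\<close> by simp
      ultimately show ?thesis by (simp only: G_def power_0 mult_1_right right_diff_distrib)
    qed
    then show ?thesis using k by (simp add: \<phi>_def)
  qed
  have \<phi>z: "\<phi> \<delta> n x = 0" if "0 < \<delta>" "\<delta> < 1" "S < \<bar>x\<bar>" for \<delta> n x
    using that(3)
  proof (induction n arbitrary: x)
    case 0 then show ?case using \<phi>0 that by simp
  next
    case (Suc n)
    have "open {x. S < \<bar>x\<bar>}" by (intro open_Collect_less continuous_intros)
    then have "(\<phi> \<delta> n has_real_derivative 0) (at x)"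
      by (intro has_field_derivative_transform_within_open[OF DERIV_const[of 0 "at x"], of "{x. S < \<bar>x\<bar>}"])
         (use Suc in auto)
    then show ?case using d\<phi> DERIV_unique by blast
  qed
  have main: "(LBINT x. ?\<beta> x * \<phi> \<delta> 2 x) = (LINT x|M1. \<phi> \<delta> 0 x) - (LINT x|M2. \<phi> \<delta> 0 x)"
    if \<delta>: "0 < \<delta>" "\<delta> < 1" for \<delta>
  proof -
    have der: "(deriv ^^ n) (\<phi> \<delta> 0) = \<phi> \<delta> n" for n
      by (rule funpow_deriv_family) (rule d\<phi>)
    have tf: "test_fun (\<phi> \<delta> 0)"
      unfolding test_fun_def der
      using \<phi>0[OF \<delta>] d\<phi> by (metis real_differentiable_def)
    have 1: "(LBINT x. \<alpha> x * \<phi> \<delta> 3 x) = - ((LINT x|M1. \<phi> \<delta> 0 x) - (LINT x|M2. \<phi> \<delta> 0 x))"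
    proof -
      have "(LBINT x. \<alpha> x * (deriv ^^ 3) (\<phi> \<delta> 0) x) = - ((LINT x|M1. \<phi> \<delta> 0 x) - (LINT x|M2. \<phi> \<delta> 0 x))"
        using C2 tf unfolding cond_C2_def by blast
      then show ?thesis by (simp only: der)
    qed
    have i: "integrable lborel (\<lambda>x. ?\<beta> x * \<phi> \<delta> 2 x)" "integrable lborel (\<lambda>x. \<alpha> x * \<phi> \<delta> 3 x)"
      by (rule continuous_compact_support_integrable[of _ S],
          use \<phi>z[OF \<delta>] in \<open>auto intro!: continuous_intros cb ca \<phi>c\<close>)+
    have "(LBINT x. ?\<beta> x * \<phi> \<delta> 2 x + \<alpha> x * \<phi> \<delta> 3 x) = 0"
    proof (rule integral_derivative_compact_support[of "\<lambda>x. \<alpha> x * \<phi> \<delta> 2 x" _ S])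
      show "((\<lambda>x. \<alpha> x * \<phi> \<delta> 2 x) has_real_derivative ?\<beta> x * \<phi> \<delta> 2 x + \<alpha> x * \<phi> \<delta> 3 x) (at x)" for x
        using DERIV_mult'[OF da d\<phi>[of \<delta> 2]] by (simp add: numeral_3_eq_3 numeral_2_eq_2 add.commute)
    qed (use \<phi>z[OF \<delta>] in \<open>auto intro!: continuous_intros cb ca \<phi>c\<close>)
    with 1 show ?thesis using i by simp
  qed
  let ?L = "?\<beta> p - ?\<beta> (p + k) - ?\<beta> y + ?\<beta> (y + k)"
  let ?R = "(LINT x|M1. trap p y k x) - (LINT x|M2. trap p y k x)"
  have meas: "\<phi> \<delta> n \<in> borel_measurable borel" for \<delta> n
    using \<phi>c by (rule borel_measurable_continuous_onI)
  have tmeas: "trap p y k \<in> borel_measurable borel" unfolding trap_def by measurable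
  have close: "\<bar>\<phi> \<delta> 0 x - trap p y k x\<bar> \<le> 4 * \<delta>" if "0 < \<delta>" for \<delta> x
  proof -
    have "\<bar>G \<delta> a 0 x - max (x - a) 0\<bar> \<le> \<delta>" for a
    proof -
      have "G \<delta> a 0 x - max (x - a) 0 = \<delta> * (r 0 ((x - a) / \<delta>) - max ((x - a) / \<delta>) 0)"
        using that by (simp add: G_def max_def field_simps)
      then show ?thesis using r0near[of "(x - a) / \<delta>"] that by (simp add: abs_mult)
    qed
    note G0 = this
    have tri: "\<bar>a - b - c + d\<bar> \<le> 4 * e"
      if "\<bar>a\<bar> \<le> e" "\<bar>b\<bar> \<le> e" "\<bar>c\<bar> \<le> e" "\<bar>d\<bar> \<le> e" for a b c d e :: real
      using that by linarith
    have "\<phi> \<delta> 0 x - trap p y k x = (G \<delta> p 0 x - max (x - p) 0) - (G \<delta> (p + k) 0 x - max (x - (p + k)) 0)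
        - (G \<delta> y 0 x - max (x - y) 0) + (G \<delta> (y + k) 0 x - max (x - (y + k)) 0)"
      by (simp add: \<phi>_def trap_def)
    then show ?thesis by (simp only:) (intro tri G0)
  qed
  have right: "\<bar>(LINT x|M. \<phi> \<delta> 0 x) - (LINT x|M. trap p y k x)\<bar> \<le> 4 * \<delta> * measure M UNIV"
    if "0 < \<delta>" "finite_measure M" "sets M = sets borel" for \<delta> M
  proof -
    interpret finite_measure M by fact
    have sp: "space M = UNIV" using sets_eq_imp_space_eq[OF that(3)] by simp
    have mm: "f \<in> borel_measurable M" if "f \<in> borel_measurable borel" for f :: "real \<Rightarrow> real"
      using that measurable_cong_sets[OF \<open>sets M = sets borel\<close> refl] by blast
    have it: "integrable M (trap p y k)"
      by (rule integrable_const_bound[of _ k]) (use trap_bounds[OF py k] mm[OF tmeas] in auto)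
    have id: "integrable M (\<lambda>x. \<phi> \<delta> 0 x - trap p y k x)"
      by (rule integrable_const_bound[of _ "4 * \<delta>"]) (use close[OF that(1)] mm[OF borel_measurable_diff[OF meas tmeas]] in auto)
    have ip: "integrable M (\<phi> \<delta> 0)"
      using Bochner_Integration.integrable_add[OF it id] by simp
    have "norm (LINT x|M. \<phi> \<delta> 0 x - trap p y k x) \<le> (LINT x|M. 4 * \<delta>)"
      by (rule Bochner_Integration.integral_norm_bound_integral[OF id]) (use close[OF that(1)] in auto)
    then show ?thesis using it ip by (simp add: sp mult_ac)
  qed
  have left: "\<bar>(LBINT x. ?\<beta> x * G \<delta> a 2 x) - ?\<beta> a\<bar> \<le> e"
    if "0 < \<delta>" "\<And>x. \<bar>x - a\<bar> \<le> \<delta> \<Longrightarrow> \<bar>?\<beta> x - ?\<beta> a\<bar> \<le> e" for \<delta> a e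
  proof -
    have "(LBINT x. ?\<beta> x * G \<delta> a 2 x) - ?\<beta> a = (LBINT x. ?\<beta> x * G \<delta> a 2 x) - (LBINT x. ?\<beta> a * G \<delta> a 2 x)"
      using G1[OF that(1)] by simp
    also have "\<dots> = (LBINT x. ?\<beta> x * G \<delta> a 2 x - ?\<beta> a * G \<delta> a 2 x)"
      using Gint[OF that(1) cb] Gint[OF that(1) continuous_on_const] by (intro Bochner_Integration.integral_diff[symmetric])
    finally have eq: "(LBINT x. ?\<beta> x * G \<delta> a 2 x) - ?\<beta> a = (LBINT x. ?\<beta> x * G \<delta> a 2 x - ?\<beta> a * G \<delta> a 2 x)" .
    have "norm (LBINT x. ?\<beta> x * G \<delta> a 2 x - ?\<beta> a * G \<delta> a 2 x) \<le> (LBINT x. e * G \<delta> a 2 x)"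
    proof (rule Bochner_Integration.integral_norm_bound_integral)
      show "integrable lborel (\<lambda>x. ?\<beta> x * G \<delta> a 2 x - ?\<beta> a * G \<delta> a 2 x)"
        using Gint[OF that(1) cb] Gint[OF that(1) continuous_on_const] by (intro Bochner_Integration.integrable_diff)
      show "integrable lborel (\<lambda>x. e * G \<delta> a 2 x)" by (rule Gint[OF that(1) continuous_on_const])
      fix x
      show "norm (?\<beta> x * G \<delta> a 2 x - ?\<beta> a * G \<delta> a 2 x) \<le> e * G \<delta> a 2 x"
      proof (cases "x \<in> {a..a + \<delta>}")
        case True
        then have "\<bar>?\<beta> x - ?\<beta> a\<bar> \<le> e" by (intro that(2)) auto
        then show ?thesis using G2(1)[OF that(1), of a x]
          by (simp add: abs_mult mult_right_mono flip: left_diff_distrib)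
      qed (use G2(2)[OF that(1)] in auto)
    qed
    then show ?thesis using G1[OF that(1)] eq by simp
  qed
  have cont: "\<exists>d>0. \<forall>x. \<bar>x - a\<bar> \<le> d \<longrightarrow> \<bar>?\<beta> x - ?\<beta> a\<bar> \<le> e" if "0 < e" for a e
  proof -
    have "isCont ?\<beta> a" using cb by (simp add: continuous_on_eq_continuous_at)
    then have "\<exists>d>0. \<forall>x. \<bar>x - a\<bar> < d \<longrightarrow> \<bar>?\<beta> x - ?\<beta> a\<bar> < e"
      using that unfolding continuous_at_eps_delta dist_real_def by simp
    then obtain d where "d > 0" "\<forall>x. \<bar>x - a\<bar> < d \<longrightarrow> \<bar>?\<beta> x - ?\<beta> a\<bar> < e" by (elim exE conjE)
    then show ?thesis by (intro exI[of _ "d / 2"]) (auto intro: less_imp_le)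
  qed
  define m where "m = measure M1 UNIV + measure M2 UNIV"
  have "\<bar>?L - ?R\<bar> \<le> 0 + e" if e: "0 < e" for e
  proof -
    \<comment> \<open>Four errors come from the values of \<beta> and four multiples of \<delta> m
      from the measures, each at most e / 8.\<close>
    define e' where "e' = e / 8"
    have e': "0 < e'" using e by (simp add: e'_def)
    have "\<exists>d. \<forall>a. 0 < d a \<and> (\<forall>x. \<bar>x - a\<bar> \<le> d a \<longrightarrow> \<bar>?\<beta> x - ?\<beta> a\<bar> \<le> e')"
      by (intro choice allI cont[OF e'])
    then obtain d where d0: "\<forall>a. 0 < d a \<and> (\<forall>x. \<bar>x - a\<bar> \<le> d a \<longrightarrow> \<bar>?\<beta> x - ?\<beta> a\<bar> \<le> e')"
      by (elim exE)
    have d: "0 < d a" "\<bar>x - a\<bar> \<le> d a \<Longrightarrow> \<bar>?\<beta> x - ?\<beta> a\<bar> \<le> e'" for a x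
      using d0 by simp_all
    have m0: "0 \<le> m" by (simp add: m_def)
    define \<delta> where "\<delta> = min (min (min (d p) (d (p + k))) (min (d y) (d (y + k)))) (min (1/2) (e' / (m + 1)))"
    have \<delta>: "0 < \<delta>" "\<delta> < 1" using d(1) e' m0 by (auto simp: \<delta>_def)
    have "\<delta> \<le> e' / (m + 1)" by (simp add: \<delta>_def)
    then have \<delta>m: "\<delta> * m \<le> e'" using m0 \<delta> by (simp add: field_simps)
    have l: "\<bar>(LBINT x. ?\<beta> x * G \<delta> a 2 x) - ?\<beta> a\<bar> \<le> e'" if "\<delta> \<le> d a" for a
      using that by (intro left[OF \<delta>(1)] d(2)) auto
    have "(LBINT x. ?\<beta> x * \<phi> \<delta> 2 x) = (LBINT x. ?\<beta> x * G \<delta> p 2 x - ?\<beta> x * G \<delta> (p + k) 2 x - ?\<beta> x * G \<delta> y 2 x + ?\<beta> x * G \<delta> (y + k) 2 x)"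
      by (simp add: \<phi>_def algebra_simps)
    also have "\<dots> = (LBINT x. ?\<beta> x * G \<delta> p 2 x) - (LBINT x. ?\<beta> x * G \<delta> (p + k) 2 x)
        - (LBINT x. ?\<beta> x * G \<delta> y 2 x) + (LBINT x. ?\<beta> x * G \<delta> (y + k) 2 x)"
      using Gint[OF \<delta>(1) cb] by simp
    finally have eq: "(LBINT x. ?\<beta> x * \<phi> \<delta> 2 x) = (LBINT x. ?\<beta> x * G \<delta> p 2 x) - (LBINT x. ?\<beta> x * G \<delta> (p + k) 2 x)
        - (LBINT x. ?\<beta> x * G \<delta> y 2 x) + (LBINT x. ?\<beta> x * G \<delta> (y + k) 2 x)" .
    have "\<bar>?L - (LBINT x. ?\<beta> x * \<phi> \<delta> 2 x)\<bar> \<le> 4 * e'"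
    proof -
      have tri: "\<bar>bp - bpk - b1 + b2 - (lp - lpk - l1 + l2)\<bar> \<le> 4 * c"
        if "\<bar>lp - bp\<bar> \<le> c" "\<bar>lpk - bpk\<bar> \<le> c" "\<bar>l1 - b1\<bar> \<le> c" "\<bar>l2 - b2\<bar> \<le> c"
        for bp bpk b1 b2 lp lpk l1 l2 c :: real
        using that by linarith
      show ?thesis
        unfolding eq by (intro tri l) (auto simp only: \<delta>_def min.bounded_iff intro: min.coboundedI1 min.coboundedI2)
    qed
    moreover have "\<bar>(LBINT x. ?\<beta> x * \<phi> \<delta> 2 x) - ?R\<bar> \<le> 4 * \<delta> * m"
    proof -
      have tri: "\<bar>(a1 - a2) - (b1 - b2)\<bar> \<le> c * (m1 + m2)"
        if "\<bar>a1 - b1\<bar> \<le> c * m1" "\<bar>a2 - b2\<bar> \<le> c * m2" for a1 a2 b1 b2 c m1 m2 :: real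
        using that unfolding distrib_left by linarith
      show ?thesis
        unfolding main[OF \<delta>] m_def
        by (intro tri right[OF \<delta>(1) M1.finite_measure_axioms sets(1)] right[OF \<delta>(1) M2.finite_measure_axioms sets(2)])
    qed
    ultimately have "\<bar>?L - ?R\<bar> \<le> 4 * e' + 4 * (\<delta> * m)"
      using abs_triangle_ineq[of "?L - (LBINT x. ?\<beta> x * \<phi> \<delta> 2 x)" "(LBINT x. ?\<beta> x * \<phi> \<delta> 2 x) - ?R"]
      by (simp only: mult.assoc diff_add_cancel add_diff_eq)
    then have "\<bar>?L - ?R\<bar> \<le> 8 * e'" using \<delta>m by linarith
    then show ?thesis by (simp add: e'_def)
  qed
  then have "\<bar>?L - ?R\<bar> \<le> 0" by (rule field_le_epsilon)
  then show ?thesis by simp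
qed

section \<open>Consistency of the discretisation\<close>

text \<open>The data on \<alpha> that the numerical analysis works with: its derivative \<beta>, the
  density g of \<beta>, and the trapezoid formula. The offset y - p and the step k are independent,
  because the quadrature error needs different values for them, while the dispersion takes both
  equal to h.\<close>

locale kernel =
  fixes \<beta> g :: "real \<Rightarrow> real" and M1 M2 :: "real measure"
  assumes \<beta>_int: "integrable lborel \<beta>" and g_int: "integrable lborel g"
    and \<beta>_cont: "continuous_on UNIV \<beta>"
    and \<beta>_diff: "a \<le> b \<Longrightarrow> \<beta> b - \<beta> a = (LBINT y:{a..b}. g y)"
    and M1_finite: "finite_measure M1" and M2_finite: "finite_measure M2"
    and M1_sets: "sets M1 = sets borel" and M2_sets: "sets M2 = sets borel"
    and second_difference: "p \<le> y \<Longrightarrow> 0 \<le> k \<Longrightarrow> \<beta> p - \<beta> (p + k) - \<beta> y + \<beta> (y + k)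
      = (LINT x|M1. trap p y k x) - (LINT x|M2. trap p y k x)"

lemma kernel_deriv:
  assumes "cond_C1 \<alpha>" "cond_C2 \<alpha> M1 M2"
  shows "\<exists>g. kernel (deriv \<alpha>) g M1 M2"
proof -
  obtain g where g: "integrable lborel g"
    and gd: "\<And>a b. a \<le> b \<Longrightarrow> deriv \<alpha> b - deriv \<alpha> a = (LBINT y:{a..b}. g y)"
    using assms(1) unfolding cond_C1_def by blast
  have "kernel (deriv \<alpha>) g M1 M2"
    by (rule kernel.intro)
       (use assms in \<open>simp_all add: cond_C1_def cond_C2_def g gd[symmetric]
         cond_C1_continuous_deriv[OF assms(1)] second_derivative_measure[OF assms]\<close>)
  then show ?thesis by blast
qed

lemma integrable_bounded_borel:
  fixes f :: "real \<Rightarrow> real"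
  assumes "finite_measure M" "sets M = sets borel" "f \<in> borel_measurable borel" "\<And>x. \<bar>f x\<bar> \<le> B"
  shows "integrable M f"
  using assms(3,4) measurable_cong_sets[OF assms(2) refl]
  by (intro finite_measure.integrable_const_bound[OF assms(1), of _ B]) auto

lemma trap_integral_bound:
  assumes M: "finite_measure M" "sets M = sets borel" and "p \<le> y" "0 \<le> k"
  shows "0 \<le> (LINT x|M. trap p y k x)" "(LINT x|M. trap p y k x) \<le> k * measure M {p<..y + k}"
    "integrable M (trap p y k)"
proof -
  interpret finite_measure M by fact
  show i: "integrable M (trap p y k)"
    by (rule integrable_bounded_borel[OF M, of _ k]) (use trap_bounds[OF assms(3,4)] in \<open>auto simp: trap_def[abs_def]\<close>)
  show "0 \<le> (LINT x|M. trap p y k x)"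
    using trap_bounds[OF assms(3,4)] by (intro Bochner_Integration.integral_nonneg) auto
  have "(LINT x|M. trap p y k x) \<le> (LINT x|M. k * indicator {p<..y + k} x)"
  proof (rule integral_mono[OF i])
    show "integrable M (\<lambda>x. k * indicator {p<..y + k} x)"
      using M(2) by (intro integrable_mult_right integrable_real_indicator) (auto simp: less_top[symmetric])
    show "trap p y k x \<le> k * indicator {p<..y + k} x" for x
      using trap_bounds[OF assms(3,4), of x] by (auto simp: indicator_def)
  qed
  then show "(LINT x|M. trap p y k x) \<le> k * measure M {p<..y + k}"
    using M(2) by simp
qed

section \<open>Variation of \<beta> over grid cells\<close>

context kernel
begin

text \<open>One quantity for two purposes: the part with g controls the oscillation of \<beta> in a
  cell, the measures control its second differences. Additivity over disjoint cells keeps the sum of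
  all cell errors bounded independently of h.\<close>

definition cell_variation :: "real \<Rightarrow> real \<Rightarrow> real" where
  "cell_variation a b = (LBINT x. indicator {a<..b} x * \<bar>g x\<bar>) + measure M1 {a<..b} + measure M2 {a<..b}"

definition total_variation :: real where
  "total_variation = (LBINT x. \<bar>g x\<bar>) + measure M1 UNIV + measure M2 UNIV"

definition L1_norm :: real where "L1_norm = (LBINT x. \<bar>\<beta> x\<bar>)"

lemma abs_g_int: "integrable lborel (\<lambda>x. indicator {a<..b} x * \<bar>g x\<bar>)"
  using integrable_mult_indicator[of "{a<..b}" lborel "\<lambda>x. \<bar>g x\<bar>"] g_int by simp

lemma cell_variation_nonneg: "0 \<le> cell_variation a b" and total_variation_nonneg: "0 \<le> total_variation" and L1_norm_nonneg: "0 \<le> L1_norm"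
  by (auto simp: cell_variation_def total_variation_def L1_norm_def intro!: add_nonneg_nonneg Bochner_Integration.integral_nonneg)

lemma sum_cell_variation:
  assumes h: "0 \<le> h"
  shows "(\<Sum>j<n. cell_variation (c + real j * h) (c + real (Suc j) * h)) \<le> total_variation"
proof -
  let ?I = "\<lambda>j. {c + real j * h<..c + real (Suc j) * h}"
  have disj: "disjoint_family_on ?I {..<n}"
  proof (unfold disjoint_family_on_def, intro ballI impI)
    have *: "?I i \<inter> ?I j = {}" if "i < j" for i j :: nat
    proof -
      have "real (Suc i) * h \<le> real j * h" using that h by (intro mult_right_mono) auto
      then show ?thesis by auto
    qed
    fix i j :: nat assume "i \<noteq> j"
    then show "?I i \<inter> ?I j = {}" using *[of i j] *[of j i] by (metis Int_commute nat_neq_iff)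
  qed
  have M: "(\<Sum>j<n. measure M (?I j)) \<le> measure M UNIV" if "finite_measure M" "sets M = sets borel" for M :: "real measure"
  proof -
    interpret finite_measure M by fact
    have sp: "space M = UNIV" using sets_eq_imp_space_eq[OF that(2)] by simp
    have "(\<Sum>j<n. measure M (?I j)) = measure M (\<Union>j<n. ?I j)"
    proof (rule finite_measure_finite_Union[symmetric])
      show "?I ` {..<n} \<subseteq> sets M" unfolding that(2) by (simp add: image_subset_iff)
    qed (simp_all only: finite_lessThan disj)
    then show ?thesis using bounded_measure[of "\<Union>j<n. ?I j"] by (simp add: sp)
  qed
  have "(\<Sum>j<n. LBINT x. indicator (?I j) x * \<bar>g x\<bar>) = (LBINT x. (\<Sum>j<n. indicator (?I j) x) * \<bar>g x\<bar>)"
    by (subst Bochner_Integration.integral_sum[symmetric]) (auto simp: sum_distrib_right intro: abs_g_int)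
  also have "\<dots> = (LBINT x. indicator (\<Union>j<n. ?I j) x * \<bar>g x\<bar>)"
    by (subst indicator_UN_disjoint[OF _ disj]) auto
  also have "\<dots> \<le> (LBINT x. \<bar>g x\<bar>)"
    using integrable_mult_indicator[of "\<Union>j<n. ?I j" lborel "\<lambda>x. \<bar>g x\<bar>"] g_int
    by (intro integral_mono) (auto simp: indicator_def)
  finally show ?thesis
    using M[OF M1_finite M1_sets] M[OF M2_finite M2_sets] by (simp add: cell_variation_def total_variation_def sum.distrib)
qed

lemma \<beta>_variation:
  assumes "a \<le> x" "x \<le> y" "y \<le> b"
  shows "\<bar>\<beta> y - \<beta> x\<bar> \<le> cell_variation a b"
proof -
  have "\<beta> y - \<beta> x = (LBINT z. indicator {x..y} z * g z)"
    using \<beta>_diff[OF assms(2)] by (simp add: set_lebesgue_integral_def)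
  also have "\<bar>\<dots>\<bar> \<le> (LBINT z. indicator {x..y} z * \<bar>g z\<bar>)"
    using integral_norm_bound[of lborel "\<lambda>z. indicator {x..y} z * g z"] by (simp add: abs_mult)
  also have "\<dots> \<le> (LBINT z. indicator {a<..b} z * \<bar>g z\<bar>)"
  proof (rule integral_mono_AE)
    show "integrable lborel (\<lambda>z. indicator {x..y} z * \<bar>g z\<bar>)"
      using integrable_mult_indicator[of "{x..y}" lborel "\<lambda>x. \<bar>g x\<bar>"] g_int by simp
    \<comment> \<open>The closed interval exceeds the half-open one at most in the point x, namely
      when x = a.\<close>
    show "AE z in lborel. indicator {x..y} z * \<bar>g z\<bar> \<le> indicator {a<..b} z * \<bar>g z\<bar>"
      using AE_lborel_singleton[of x] by eventually_elim (use assms in \<open>auto simp: indicator_def\<close>)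
  qed (rule abs_g_int)
  finally show ?thesis by (simp add: cell_variation_def add_increasing2)
qed

lemma \<beta>_second_variation:
  assumes "p \<le> y" "0 \<le> k"
  shows "\<bar>\<beta> p - \<beta> (p + k) - \<beta> y + \<beta> (y + k)\<bar> \<le> k * cell_variation p (y + k)"
proof -
  have "\<bar>\<beta> p - \<beta> (p + k) - \<beta> y + \<beta> (y + k)\<bar> \<le> k * measure M1 {p<..y + k} + k * measure M2 {p<..y + k}"
    using trap_integral_bound[OF M1_finite M1_sets assms] trap_integral_bound[OF M2_finite M2_sets assms]
    unfolding second_difference[OF assms] by linarith
  also have "\<dots> \<le> k * cell_variation p (y + k)"
    using assms(2) by (simp add: cell_variation_def algebra_simps Bochner_Integration.integral_nonneg)
  finally show ?thesis .
qed

definition sup_bound :: real where "sup_bound = \<bar>\<beta> 0\<bar> + total_variation"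

lemma \<beta>_bounded: "\<bar>\<beta> x\<bar> \<le> sup_bound"
proof -
  have cell_variation: "cell_variation a b \<le> total_variation" if "a \<le> b" for a b
    using sum_cell_variation[of "b - a" a 1] that by simp
  have "\<bar>\<beta> x - \<beta> 0\<bar> \<le> total_variation"
    using \<beta>_variation[of 0 0 x x] \<beta>_variation[of x x 0 0] cell_variation[of 0 x] cell_variation[of x 0] by (cases "0 \<le> x") auto
  then show ?thesis by (simp add: sup_bound_def)
qed

text \<open>The second difference of the product \<beta> w splits into products of first increments
  and second differences of the single factors. Every term is of order h times the cell variation or
  h^2 times |\<beta> l|; the length of the cell supplies one more factor h.\<close>

lemma quadrature_cell:
  assumes w: "C2bdd M w" and h: "0 < h" "h \<le> 1" and r: "r = l + h"
  shows "\<bar>integral {l..r} (\<lambda>x. \<beta> x * w x) - h / 2 * (\<beta> l * w l + \<beta> r * w r)\<bar>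
     \<le> M * h\<^sup>2 * (3 * cell_variation l r + integral {l..r} (\<lambda>x. \<bar>\<beta> x\<bar>))"
proof -
  obtain w1 w2 where d1: "\<And>x. (w has_real_derivative w1 x) (at x)"
    and d2: "\<And>x. (w1 has_real_derivative w2 x) (at x)" and b: "\<And>x. \<bar>w x\<bar> \<le> M" "\<And>x. \<bar>w1 x\<bar> \<le> M" "\<And>x. \<bar>w2 x\<bar> \<le> M"
    using w unfolding C2bdd_def by blast
  have M0: "0 \<le> M" using C2bdd_nonneg[OF w] .
  have lip: "\<bar>w y - w x\<bar> \<le> M * \<bar>y - x\<bar>" "\<bar>w1 y - w1 x\<bar> \<le> M * \<bar>y - x\<bar>" for x y
    using field_differentiable_bound[of UNIV w w1 M y x] field_differentiable_bound[of UNIV w1 w2 M y x] d1 d2 b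
    by auto
  define W where "W x = \<beta> x * w x" for x
  have wc: "continuous_on UNIV w" by (rule C2bdd_continuous[OF w])
  have Wc: "continuous_on S W" for S
    unfolding W_def by (intro continuous_intros continuous_on_subset[OF \<beta>_cont] continuous_on_subset[OF wc]) auto
  define F where "F x = integral {l - 1..x} W" for x
  have dF: "(F has_real_derivative W x) (at x)" if "l \<le> x" "x \<le> r" for x
  proof -
    have "(F has_real_derivative W x) (at x within {l - 1..r + 1})"
      unfolding F_def by (rule integral_has_real_derivative[OF Wc]) (use that in auto)
    moreover have "at x within {l - 1..r + 1} = at x"
      using that by (intro at_within_Icc_at) auto
    ultimately show ?thesis by simp
  qed
  have FI: "F r - F l = integral {l..r} W"
  proof -
    have "(W has_integral (F r - F l)) {l..r}"
    proof (rule fundamental_theorem_of_calculus)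
      fix x assume "x \<in> {l..r}"
      then show "(F has_vector_derivative W x) (at x within {l..r})"
        using dF[of x] has_vector_derivative_at_within
        by (auto simp: has_real_derivative_iff_has_vector_derivative)
    qed (use r h in simp)
    then show ?thesis by (simp add: integral_unique)
  qed
  \<comment> \<open>\<open>\<Phi>\<close> integrates inwards from both ends of the cell: \<open>\<Phi> h\<close> is twice the quadrature error, while its
    derivative \<open>D\<close> contains only symmetric differences.\<close>
  define D where "D t = W (l + t) + W (r - t) - W l - W r" for t
  define \<Phi> where "\<Phi> t = F (l + t) - F l + F r - F (r - t) - t * (W l + W r)" for t
  have d\<Phi>: "(\<Phi> has_real_derivative D t) (at t)" if "0 \<le> t" "t \<le> h" for t
  proof -
    have "((\<lambda>t. l + t) has_real_derivative 1) (at t)" "((\<lambda>t. r - t) has_real_derivative -1) (at t)"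
      by (auto intro!: derivative_eq_intros)
    note d = DERIV_chain'[OF this(1) dF[of "l + t"]] DERIV_chain'[OF this(2) dF[of "r - t"]]
    have 1: "((\<lambda>t. F (l + t)) has_real_derivative W (l + t)) (at t)"
      and 2: "((\<lambda>t. F (r - t)) has_real_derivative - W (r - t)) (at t)"
      using d that r by simp_all
    show ?thesis
      unfolding \<Phi>_def D_def using 1 2 by (auto intro!: derivative_eq_intros)
  qed
  have D: "\<bar>D t\<bar> \<le> M * h * (4 * cell_variation l r + h * \<bar>\<beta> l\<bar>)" if t: "0 \<le> t" "t \<le> h" for t
  proof -
    have prod: "\<bar>(\<beta> x - \<beta> l) * (w x - w l)\<bar> \<le> cell_variation l r * (M * h)" if "l \<le> x" "x \<le> r" for x
    proof -
      have "\<bar>w x - w l\<bar> \<le> M * h"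
        by (rule order_trans[OF lip(1)]) (use that r M0 in \<open>auto intro: mult_left_mono\<close>)
      then show ?thesis unfolding abs_mult
        using \<beta>_variation[of l l x r] that cell_variation_nonneg by (intro mult_mono) auto
    qed
    have Dw: "\<bar>w (l + t) + w (r - t) - w l - w r\<bar> \<le> M * h * h"
    proof (cases "t = 0")
      case False
      then have "0 < t" using t by simp
      obtain z1 where z1: "l < z1" "z1 < l + t" "w (l + t) - w l = t * w1 z1"
        using MVT2[of l "l + t" w w1] d1 \<open>0 < t\<close> by auto
      obtain z2 where z2: "r - t < z2" "z2 < r" "w r - w (r - t) = t * w1 z2"
        using MVT2[of "r - t" r w w1] d1 \<open>0 < t\<close> by auto
      have "w (l + t) + w (r - t) - w l - w r = t * (w1 z1 - w1 z2)"
        using z1(3) z2(3) by (simp add: algebra_simps)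
      moreover have "\<bar>z1 - z2\<bar> \<le> h" using z1 z2 t r by auto
      ultimately have "\<bar>w (l + t) + w (r - t) - w l - w r\<bar> \<le> t * (M * h)"
        using order_trans[OF lip(2)[of z1 z2] mult_left_mono[OF _ M0]] \<open>0 < t\<close>
        by (simp add: abs_mult)
      also have "\<dots> \<le> h * (M * h)" using t M0 h by (intro mult_right_mono) auto
      finally show ?thesis by (simp add: mult_ac)
    qed (use M0 h in auto)
    have D\<beta>: "\<bar>\<beta> (l + t) + \<beta> (r - t) - \<beta> l - \<beta> r\<bar> \<le> h * cell_variation l r"
    proof -
      \<comment> \<open>The trapezoid formula with step t and offset h - t, which differ in
        general.\<close>
      have "\<bar>\<beta> l - \<beta> (l + t) - \<beta> (r - t) + \<beta> (r - t + t)\<bar> \<le> t * cell_variation l (r - t + t)"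
        by (rule \<beta>_second_variation) (use t r in auto)
      also have "\<dots> \<le> h * cell_variation l r" using t cell_variation_nonneg by (intro mult_mono) auto
      finally show ?thesis by (simp add: abs_le_iff)
    qed
    \<comment> \<open>Every product is expanded around l; the terms linear in the increments regroup
      into second differences of w and of \<beta>.\<close>
    have "D t = (\<beta> (l + t) - \<beta> l) * (w (l + t) - w l) + (\<beta> (r - t) - \<beta> l) * (w (r - t) - w l)
       - (\<beta> r - \<beta> l) * (w r - w l) + \<beta> l * (w (l + t) + w (r - t) - w l - w r)
       + w l * (\<beta> (l + t) + \<beta> (r - t) - \<beta> l - \<beta> r)"
      by (simp add: D_def W_def algebra_simps)
    also have "\<bar>\<dots>\<bar> \<le> cell_variation l r * (M * h) + cell_variation l r * (M * h) + cell_variation l r * (M * h) + \<bar>\<beta> l\<bar> * (M * h * h) + M * (h * cell_variation l r)"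
    proof -
      have p1: "\<bar>\<beta> l * (w (l + t) + w (r - t) - w l - w r)\<bar> \<le> \<bar>\<beta> l\<bar> * (M * h * h)"
        unfolding abs_mult using Dw by (intro mult_left_mono) auto
      have p2: "\<bar>w l * (\<beta> (l + t) + \<beta> (r - t) - \<beta> l - \<beta> r)\<bar> \<le> M * (h * cell_variation l r)"
        unfolding abs_mult using D\<beta> b(1)[of l] M0 by (intro mult_mono) auto
      have tri: "\<bar>a + b - c + d + e\<bar> \<le> A + B + C + D + E"
        if "\<bar>a\<bar> \<le> A" "\<bar>b\<bar> \<le> B" "\<bar>c\<bar> \<le> C" "\<bar>d\<bar> \<le> D" "\<bar>e\<bar> \<le> E" for a b c d e A B C D E :: real
        using that by linarith
      show ?thesis
        by (rule tri[OF prod prod prod p1 p2]) (use t r h in simp_all)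
    qed
    also have "\<dots> = M * h * (4 * cell_variation l r + h * \<bar>\<beta> l\<bar>)" by (simp add: algebra_simps)
    finally show ?thesis .
  qed
  obtain z where z: "0 < z" "z < h" "\<Phi> h - \<Phi> 0 = (h - 0) * D z"
  proof -
    have "\<exists>z>0. z < h \<and> \<Phi> h - \<Phi> 0 = (h - 0) * D z" by (rule MVT2[OF h(1) d\<Phi>])
    then show ?thesis using that by (elim exE conjE)
  qed
  define X where "X = integral {l..r} W - h / 2 * (W l + W r)"
  have "\<Phi> h - \<Phi> 0 = 2 * X"
    using FI r by (simp add: \<Phi>_def X_def algebra_simps)
  then have "2 * X = h * D z" using z(3) by simp
  then have "2 * \<bar>X\<bar> = h * \<bar>D z\<bar>" using h(1) by (metis abs_mult abs_numeral abs_of_pos)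
  then have "\<bar>X\<bar> = h * \<bar>D z\<bar> / 2" by simp
  also have "\<dots> \<le> h * (M * h * (4 * cell_variation l r + h * \<bar>\<beta> l\<bar>)) / 2"
    using D[of z] z(1,2) h(1) by (intro divide_right_mono mult_left_mono) auto
  also have "\<dots> = M * h\<^sup>2 * (2 * cell_variation l r + h * \<bar>\<beta> l\<bar> / 2)"
    by (simp add: power2_eq_square algebra_simps)
  also have "\<dots> \<le> M * h\<^sup>2 * (2 * cell_variation l r + h * \<bar>\<beta> l\<bar>)"
    using M0 h(1) by (intro mult_left_mono add_left_mono) auto
  also have "\<dots> \<le> M * h\<^sup>2 * (3 * cell_variation l r + integral {l..r} (\<lambda>x. \<bar>\<beta> x\<bar>))"
  proof (rule mult_left_mono)
    have i: "(\<lambda>x. \<bar>\<beta> x\<bar>) integrable_on {l..r}"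
      by (intro integrable_continuous_real continuous_intros continuous_on_subset[OF \<beta>_cont]) auto
    \<comment> \<open>To sum up to the L^1 norm, the point value of |\<beta>| is traded for its
      integral over the cell, at the price of one more cell variation as h \<le> 1.\<close>
    have "h * \<bar>\<beta> l\<bar> = integral {l..r} (\<lambda>x. \<bar>\<beta> l\<bar>)" using r h by simp
    also have "\<dots> \<le> integral {l..r} (\<lambda>x. \<bar>\<beta> x\<bar> + cell_variation l r)"
    proof (rule integral_le)
      fix x assume "x \<in> {l..r}"
      then show "\<bar>\<beta> l\<bar> \<le> \<bar>\<beta> x\<bar> + cell_variation l r" using \<beta>_variation[of l l x r] by auto
    qed (intro integrable_add i integrable_const_ivl)+
    also have "\<dots> = integral {l..r} (\<lambda>x. \<bar>\<beta> x\<bar>) + h * cell_variation l r"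
      using i r h by (subst integral_add) auto
    also have "h * cell_variation l r \<le> 1 * cell_variation l r" using h cell_variation_nonneg by (intro mult_right_mono) auto
    finally show "2 * cell_variation l r + h * \<bar>\<beta> l\<bar> \<le> 3 * cell_variation l r + integral {l..r} (\<lambda>x. \<bar>\<beta> x\<bar>)" by simp
  qed (use M0 in simp)
  finally show ?thesis unfolding W_def X_def .
qed

end

section \<open>The trapezoidal rule on the truncated grid\<close>

context kernel
begin

lemma abs_\<beta>_integrable_on: "(\<lambda>x. \<bar>\<beta> x\<bar>) integrable_on {a..b}"
  by (intro integrable_continuous_real continuous_intros continuous_on_subset[OF \<beta>_cont]) auto

lemma integral_abs_\<beta>_le: "integral {a..b} (\<lambda>x. \<bar>\<beta> x\<bar>) \<le> L1_norm"
proof -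
  have i: "set_integrable lborel {a..b} (\<lambda>x. \<bar>\<beta> x\<bar>)"
    unfolding set_integrable_def using \<beta>_int by (intro integrable_mult_indicator) auto
  have "integral {a..b} (\<lambda>x. \<bar>\<beta> x\<bar>) = (LBINT x:{a..b}. \<bar>\<beta> x\<bar>)"
    using set_borel_integral_eq_integral(2)[OF i] by simp
  also have "\<dots> \<le> L1_norm"
    unfolding set_lebesgue_integral_def L1_norm_def
    using i \<beta>_int by (intro integral_mono) (auto simp: set_integrable_def indicator_def)
  finally show ?thesis .
qed

text \<open>The composite rule is written as the full sum minus half of both end values, because the
  scheme uses the full sum.\<close>

lemma quadrature_cells:
  assumes w: "C2bdd M w" and h: "0 < h" "h \<le> 1"
  defines "W \<equiv> \<lambda>x. \<beta> x * w x"
  shows "\<bar>integral {c..c + real n * h} W - (h * (\<Sum>j\<le>n. W (c + real j * h)) - h / 2 * (W c + W (c + real n * h)))\<bar>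
     \<le> M * h\<^sup>2 * (3 * (\<Sum>j<n. cell_variation (c + real j * h) (c + real (Suc j) * h)) + integral {c..c + real n * h} (\<lambda>x. \<bar>\<beta> x\<bar>))"
proof (induction n)
  case 0
  then show ?case by simp
next
  case (Suc n)
  define l where "l = c + real n * h"
  define r where "r = c + real (Suc n) * h"
  have lr: "c \<le> l" "l \<le> r" "r = l + h" using h by (auto simp: l_def r_def algebra_simps)
  have wc: "continuous_on S W" for S
    unfolding W_def by (intro continuous_intros continuous_on_subset[OF \<beta>_cont] C2bdd_continuous[OF w]) auto
  have 1: "integral {c..r} W = integral {c..l} W + integral {l..r} W"
    using lr by (intro Henstock_Kurzweil_Integration.integral_combine[symmetric] integrable_continuous_real wc)
  have 2: "integral {c..r} (\<lambda>x. \<bar>\<beta> x\<bar>) = integral {c..l} (\<lambda>x. \<bar>\<beta> x\<bar>) + integral {l..r} (\<lambda>x. \<bar>\<beta> x\<bar>)"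
    using lr by (intro Henstock_Kurzweil_Integration.integral_combine[symmetric] abs_\<beta>_integrable_on)
  have 3: "\<bar>integral {l..r} W - h / 2 * (W l + W r)\<bar> \<le> M * h\<^sup>2 * (3 * cell_variation l r + integral {l..r} (\<lambda>x. \<bar>\<beta> x\<bar>))"
    unfolding W_def by (rule quadrature_cell[OF w h lr(3)])
  have tri: "\<bar>(a1 + a2) - (h * (S + Wr) - h / 2 * (Wc + Wr))\<bar> \<le> K * (3 * (V1 + V2) + (b1 + b2))"
    if "\<bar>a1 - (h * S - h / 2 * (Wc + Wl))\<bar> \<le> K * (3 * V1 + b1)" "\<bar>a2 - h / 2 * (Wl + Wr)\<bar> \<le> K * (3 * V2 + b2)"
    for a1 a2 S Wl Wr Wc V1 V2 b1 b2 K
  proof -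
    have "(a1 + a2) - (h * (S + Wr) - h / 2 * (Wc + Wr)) = (a1 - (h * S - h / 2 * (Wc + Wl))) + (a2 - h / 2 * (Wl + Wr))"
      by (simp add: field_simps)
    also have "\<bar>\<dots>\<bar> \<le> K * (3 * V1 + b1) + K * (3 * V2 + b2)"
      using that abs_triangle_ineq order_trans add_mono by meson
    finally show ?thesis by (simp add: algebra_simps)
  qed
  show ?case
    using tri[OF Suc.IH[folded l_def] 3] 1 2
    by (simp only: sum.atMost_Suc sum.lessThan_Suc l_def r_def)
qed

lemma sum_int_reindex:
  "(\<Sum>j\<in>{- int N..int N}. F (real_of_int j)) = (\<Sum>k\<le>2 * N. F (real N - real k))"
  by (rule sum.reindex_bij_witness[of _ "\<lambda>k. int N - int k" "\<lambda>j. nat (int N - j)"]) auto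

text \<open>Substituting z = x - y gives a grid with left end c = x - N h. Besides the cell errors
  there remain the tail of the integral and the half end values by which the scheme exceeds the
  trapezoidal rule. Both involve w only at distance at least N h from 0, which is where \<eta>
  bounds it.\<close>

lemma quadrature:
  assumes w: "C2bdd M w" and h: "0 < h" "h \<le> 1"
    and \<eta>: "\<And>y. real N * h \<le> \<bar>y\<bar> \<Longrightarrow> \<bar>w y\<bar> \<le> \<eta>"
  shows "\<bar>(LBINT y. \<beta> (x - y) * w y) - (\<Sum>j\<in>{- int N..int N}. h * \<beta> (x - real_of_int j * h) * w (real_of_int j * h))\<bar>
    \<le> M * h\<^sup>2 * (3 * total_variation + L1_norm) + (L1_norm + sup_bound) * \<eta>"
proof -
  define w' where "w' z = w (x - z)" for z
  define c where "c = x - real N * h"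
  define W where "W z = \<beta> z * w' z" for z
  let ?I = "{c..c + real (2 * N) * h}"
  have w': "C2bdd M w'" unfolding w'_def by (rule C2bdd_affine[OF w])
  have M0: "0 \<le> M" by (rule C2bdd_nonneg[OF w])
  have wm: "w' \<in> borel_measurable borel"
    using C2bdd_continuous[OF w'] by (rule borel_measurable_continuous_onI)
  have iW: "integrable lborel W"
  proof (rule Bochner_Integration.integrable_bound)
    show "integrable lborel (\<lambda>z. M * \<beta> z)" using \<beta>_int by simp
    show "W \<in> borel_measurable lborel" unfolding W_def using wm \<beta>_int by auto
    show "AE z in lborel. norm (W z) \<le> norm (M * \<beta> z)"
      using mult_left_mono[OF C2bdd_bound[OF w'] abs_ge_zero[of "\<beta> _"]] M0
      by (intro AE_I2) (simp add: W_def abs_mult mult.commute[of M])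
  qed
  have \<eta>0: "0 \<le> \<eta>" using \<eta>[of "real N * h"] abs_ge_zero order_trans abs_ge_self by blast
  have out: "\<bar>w' z\<bar> \<le> \<eta>" if "z \<notin> {c<..<c + real (2 * N) * h}" for z
    unfolding w'_def using that by (intro \<eta>) (auto simp: c_def algebra_simps not_less)
  have "(LBINT y. \<beta> (x - y) * w y) = (LBINT z. W z)"
    using lborel_integral_real_affine[of "-1" W x] by (simp add: W_def w'_def)
  also have "\<dots> = (LBINT z. indicator ?I z * W z + indicator (- ?I) z * W z)"
    by (intro Bochner_Integration.integral_cong) (auto simp: indicator_def)
  also have "\<dots> = (LBINT z. indicator ?I z * W z) + (LBINT z. indicator (- ?I) z * W z)"
    using integrable_mult_indicator[OF _ iW, of ?I] integrable_mult_indicator[OF _ iW, of "- ?I"] by simp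
  also have "(LBINT z. indicator ?I z * W z) = integral ?I W"
    using set_borel_integral_eq_integral(2)[of ?I W] integrable_mult_indicator[OF _ iW, of ?I]
    by (simp add: set_lebesgue_integral_def set_integrable_def)
  finally have e1: "(LBINT y. \<beta> (x - y) * w y) = integral ?I W + (LBINT z. indicator (- ?I) z * W z)" .
  have b1: "\<bar>LBINT z. indicator (- ?I) z * W z\<bar> \<le> L1_norm * \<eta>"
  proof -
    have "norm (LBINT z. indicator (- ?I) z * W z) \<le> (LBINT z. \<eta> * \<bar>\<beta> z\<bar>)"
    proof (rule Bochner_Integration.integral_norm_bound_integral)
      show "integrable lborel (\<lambda>z. indicator (- ?I) z * W z)"
        using integrable_mult_indicator[OF _ iW, of "- ?I"] by simp
      show "norm (indicator (- ?I) z * W z) \<le> \<eta> * \<bar>\<beta> z\<bar>" for z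
      proof (cases "z \<in> ?I")
        case False
        then have "\<bar>w' z\<bar> \<le> \<eta>" by (intro out) auto
        then have "\<bar>\<beta> z\<bar> * \<bar>w' z\<bar> \<le> \<bar>\<beta> z\<bar> * \<eta>" by (intro mult_left_mono) auto
        then show ?thesis using False by (simp add: W_def abs_mult mult.commute[of \<eta>])
      qed (use \<eta>0 in simp)
    qed (use \<beta>_int in simp)
    then show ?thesis by (simp add: L1_norm_def mult.commute)
  qed
  have W_end: "\<bar>W z\<bar> \<le> sup_bound * \<eta>" if "\<bar>w' z\<bar> \<le> \<eta>" for z
    unfolding W_def abs_mult using \<beta>_bounded[of z] that by (intro mult_mono) auto
  have b2: "\<bar>h / 2 * (W c + W (c + real (2 * N) * h))\<bar> \<le> sup_bound * \<eta>"
  proof -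
    have "\<bar>h / 2 * (W c + W (c + real (2 * N) * h))\<bar> \<le> 1 / 2 * \<bar>W c + W (c + real (2 * N) * h)\<bar>"
      unfolding abs_mult using h by (intro mult_right_mono) auto
    also have "\<dots> \<le> 1 / 2 * (sup_bound * \<eta> + sup_bound * \<eta>)"
      by (intro mult_left_mono order_trans[OF abs_triangle_ineq] add_mono W_end out) auto
    also have "1 / 2 * (sup_bound * \<eta> + sup_bound * \<eta>) = sup_bound * \<eta>" by simp
    finally show ?thesis .
  qed
  have "(\<Sum>j\<in>{- int N..int N}. h * \<beta> (x - real_of_int j * h) * w (real_of_int j * h))
     = (\<Sum>k\<le>2 * N. h * \<beta> (x - (real N - real k) * h) * w ((real N - real k) * h))"
    by (rule sum_int_reindex[of "\<lambda>j. h * \<beta> (x - j * h) * w (j * h)"])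
  also have "\<dots> = h * (\<Sum>k\<le>2 * N. W (c + real k * h))"
    unfolding sum_distrib_left
    by (intro sum.cong) (auto simp: W_def w'_def c_def algebra_simps)
  finally have e2: "(\<Sum>j\<in>{- int N..int N}. h * \<beta> (x - real_of_int j * h) * w (real_of_int j * h))
     = h * (\<Sum>k\<le>2 * N. W (c + real k * h))" .
  have "\<bar>integral ?I W - (h * (\<Sum>k\<le>2 * N. W (c + real k * h)) - h / 2 * (W c + W (c + real (2 * N) * h)))\<bar>
     \<le> M * h\<^sup>2 * (3 * (\<Sum>j<2 * N. cell_variation (c + real j * h) (c + real (Suc j) * h)) + integral ?I (\<lambda>x. \<bar>\<beta> x\<bar>))"
    using quadrature_cells[OF w' h, of c "2 * N"] by (simp only: W_def[abs_def])
  also have "\<dots> \<le> M * h\<^sup>2 * (3 * total_variation + L1_norm)"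
    using sum_cell_variation[of h c "2 * N"] h M0 by (intro mult_left_mono add_mono integral_abs_\<beta>_le) auto
  finally have b3: "\<bar>integral ?I W - (h * (\<Sum>k\<le>2 * N. W (c + real k * h)) - h / 2 * (W c + W (c + real (2 * N) * h)))\<bar>
     \<le> M * h\<^sup>2 * (3 * total_variation + L1_norm)" .
  have tri: "\<bar>I + J - S\<bar> \<le> A + (B + C) * \<eta>" if "\<bar>J\<bar> \<le> B * \<eta>" "\<bar>E\<bar> \<le> C * \<eta>" "\<bar>I - (S - E)\<bar> \<le> A" for I J S A B C E :: real
    using that unfolding distrib_right by linarith
  show ?thesis
    unfolding e1 e2 by (rule tri[OF b1 b2 b3])
qed

text \<open>A Riemann sum of |\<beta>| exceeds the integral by at most the sum of the cell
  variations. The bound is free of h, N and x and controls the discrete convolution in the maximum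
  norm.\<close>

lemma sum_abs_\<beta>:
  assumes h: "0 < h" "h \<le> 1"
  shows "(\<Sum>j\<in>{- int N..int N}. h * \<bar>\<beta> (x - real_of_int j * h)\<bar>) \<le> L1_norm + total_variation + sup_bound"
proof -
  define c where "c = x - real N * h"
  have cells: "(\<Sum>j<n. h * \<bar>\<beta> (c + real j * h)\<bar>)
    \<le> integral {c..c + real n * h} (\<lambda>x. \<bar>\<beta> x\<bar>) + (\<Sum>j<n. cell_variation (c + real j * h) (c + real (Suc j) * h))" for n
  proof (induction n)
    case (Suc n)
    define l where "l = c + real n * h"
    define r where "r = c + real (Suc n) * h"
    have lr: "c \<le> l" "l \<le> r" "r = l + h" using h by (auto simp: l_def r_def algebra_simps)
    have 2: "integral {c..r} (\<lambda>x. \<bar>\<beta> x\<bar>) = integral {c..l} (\<lambda>x. \<bar>\<beta> x\<bar>) + integral {l..r} (\<lambda>x. \<bar>\<beta> x\<bar>)"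
      using lr by (intro Henstock_Kurzweil_Integration.integral_combine[symmetric] abs_\<beta>_integrable_on)
    have "h * \<bar>\<beta> l\<bar> = integral {l..r} (\<lambda>x. \<bar>\<beta> l\<bar>)" using lr h by simp
    also have "\<dots> \<le> integral {l..r} (\<lambda>x. \<bar>\<beta> x\<bar> + cell_variation l r)"
    proof (rule integral_le)
      fix x assume "x \<in> {l..r}"
      then show "\<bar>\<beta> l\<bar> \<le> \<bar>\<beta> x\<bar> + cell_variation l r" using \<beta>_variation[of l l x r] by auto
    qed (intro integrable_add abs_\<beta>_integrable_on integrable_const_ivl)+
    also have "\<dots> = integral {l..r} (\<lambda>x. \<bar>\<beta> x\<bar>) + h * cell_variation l r"
      using abs_\<beta>_integrable_on lr h by (subst integral_add) auto
    also have "h * cell_variation l r \<le> 1 * cell_variation l r" using h cell_variation_nonneg by (intro mult_right_mono) auto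
    finally have 3: "h * \<bar>\<beta> l\<bar> \<le> integral {l..r} (\<lambda>x. \<bar>\<beta> x\<bar>) + cell_variation l r" by simp
    show ?case
      using Suc.IH 2 3 unfolding sum.lessThan_Suc l_def[symmetric] r_def[symmetric] by linarith
  qed simp
  have "(\<Sum>j\<in>{- int N..int N}. h * \<bar>\<beta> (x - real_of_int j * h)\<bar>) = (\<Sum>k\<le>2 * N. h * \<bar>\<beta> (x - (real N - real k) * h)\<bar>)"
    by (rule sum_int_reindex[of "\<lambda>j. h * \<bar>\<beta> (x - j * h)\<bar>"])
  also have "\<dots> = (\<Sum>k<Suc (2 * N). h * \<bar>\<beta> (c + real k * h)\<bar>)"
    unfolding lessThan_Suc_atMost by (intro sum.cong) (auto simp: c_def algebra_simps)
  also have "\<dots> \<le> L1_norm + total_variation"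
    using cells[of "Suc (2 * N)"] integral_abs_\<beta>_le[of c "c + real (Suc (2 * N)) * h"] sum_cell_variation[of h c "Suc (2 * N)"] h
    by linarith
  finally show ?thesis using \<beta>_bounded[of 0] by linarith
qed

end

section \<open>Hat functions and piecewise linear interpolation\<close>

definition tent :: "real \<Rightarrow> real \<Rightarrow> real" where
  "tent h t = max (t + h) 0 - 2 * max t 0 + max (t - h) 0"

text \<open>\<open>tent h t / h\<close> is the hat function of mesh h, with value 1 at 0 and support
  [-h, h]. At a point between the nodes q and q + 1 only the hats of these two nodes can be
  nonzero.\<close>

lemma tent_grid:
  fixes j q :: int and h \<theta> :: real
  assumes h: "0 < h" and \<theta>: "0 \<le> \<theta>" "\<theta> < 1"
  shows "tent h (real_of_int j * h - (real_of_int q + \<theta>) * h) / h = (if j = q then 1 - \<theta> else 0) + (if j = q + 1 then \<theta> else 0)"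
proof -
  define s where "s = real_of_int (j - q) - \<theta>"
  have "real_of_int j * h - (real_of_int q + \<theta>) * h = s * h"
    by (simp add: s_def algebra_simps)
  moreover have "tent h (s * h) = h * (max (s + 1) 0 - 2 * max s 0 + max (s - 1) 0)"
  proof -
    have "max (r * h) 0 = h * max r 0" for r
      using h by (simp add: max_def mult_le_0_iff mult.commute)
    from this[of "s + 1"] this[of s] this[of "s - 1"]
    show ?thesis by (simp add: tent_def algebra_simps)
  qed
  ultimately have eq: "tent h (real_of_int j * h - (real_of_int q + \<theta>) * h) / h
     = max (s + 1) 0 - 2 * max s 0 + max (s - 1) 0" using h by simp
  consider "j - q \<le> -1" | "j - q = 0" | "j - q = 1" | "2 \<le> j - q" by linarith
  then show ?thesis
  proof cases
    case 1
    then have "real_of_int (j - q) \<le> -1" by linarith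
    then have "s \<le> -1" using \<theta> by (simp add: s_def)
    then show ?thesis unfolding eq using 1 by auto
  next
    case 2
    then show ?thesis unfolding eq s_def using \<theta> by auto
  next
    case 3
    then show ?thesis unfolding eq s_def using \<theta> by auto
  next
    case 4
    then have "2 \<le> real_of_int (j - q)" by linarith
    then have "1 \<le> s" using \<theta> by (simp add: s_def)
    then show ?thesis unfolding eq using 4 by auto
  qed
qed

text \<open>This is the piecewise linear interpolant of v with the nodes outside S set to 0, which
  is how the truncation of the grid enters.\<close>

lemma tent_sum:
  fixes v :: "int \<Rightarrow> real" and q :: int
  assumes h: "0 < h" and \<theta>: "0 \<le> \<theta>" "\<theta> < 1" and S: "finite S"
  shows "(\<Sum>j\<in>S. tent h (real_of_int j * h - (real_of_int q + \<theta>) * h) / h * v j)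
     = (if q \<in> S then (1 - \<theta>) * v q else 0) + (if q + 1 \<in> S then \<theta> * v (q + 1) else 0)"
proof -
  have "(\<Sum>j\<in>S. tent h (real_of_int j * h - (real_of_int q + \<theta>) * h) / h * v j)
    = (\<Sum>j\<in>S. (if j = q then (1 - \<theta>) * v j else 0) + (if j = q + 1 then \<theta> * v j else 0))"
    unfolding tent_grid[OF h \<theta>] by (intro sum.cong) (auto simp: distrib_right)
  also have "\<dots> = (if q \<in> S then (1 - \<theta>) * v q else 0) + (if q + 1 \<in> S then \<theta> * v (q + 1) else 0)"
    using S by (simp add: sum.distrib)
  finally show ?thesis .
qed

lemma grid_decomposition:
  fixes z h :: real
  assumes "0 < h"
  obtains q :: int and \<theta> where "0 \<le> \<theta>" "\<theta> < 1" "z = (real_of_int q + \<theta>) * h"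
proof
  show "0 \<le> frac (z / h)" "frac (z / h) < 1" by (auto simp: frac_lt_1)
  show "z = (real_of_int \<lfloor>z / h\<rfloor> + frac (z / h)) * h"
    using assms by (simp add: frac_def)
qed

text \<open>The mean value theorem on both sides of the point yields two values of the first
  derivative at distance at most h, compared through the second; the weights combine to \<theta> (1
  - \<theta>) h.\<close>

lemma linear_interpolation_error:
  assumes u: "C2bdd M u" and h: "0 < h" and \<theta>: "0 \<le> \<theta>" "\<theta> < 1"
  shows "\<bar>(1 - \<theta>) * u (a * h) + \<theta> * u ((a + 1) * h) - u ((a + \<theta>) * h)\<bar> \<le> M * h\<^sup>2"
proof (cases "\<theta> = 0")
  case True
  then show ?thesis using C2bdd_nonneg[OF u] by simp
next
  case False
  then have \<theta>': "0 < \<theta>" using \<theta> by simp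
  obtain u1 u2 where d1: "\<And>x. (u has_real_derivative u1 x) (at x)"
    and d2: "\<And>x. (u1 has_real_derivative u2 x) (at x)" and b: "\<And>x. \<bar>u2 x\<bar> \<le> M"
    using u unfolding C2bdd_def by blast
  have M0: "0 \<le> M" using C2bdd_nonneg[OF u] .
  have lip: "\<bar>u1 y - u1 x\<bar> \<le> M * \<bar>y - x\<bar>" for x y
    using field_differentiable_bound[of UNIV u1 u2 M y x] d2 b by auto
  have lt: "a * h < (a + \<theta>) * h" "(a + \<theta>) * h < (a + 1) * h"
    using h \<theta> \<theta>' by (intro mult_strict_right_mono; simp)+
  obtain z1 where z1: "a * h < z1" "z1 < (a + \<theta>) * h" "u ((a + \<theta>) * h) - u (a * h) = ((a + \<theta>) * h - a * h) * u1 z1"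
    using MVT2[OF lt(1), of u u1] d1 by auto
  obtain z2 where z2: "(a + \<theta>) * h < z2" "z2 < (a + 1) * h" "u ((a + 1) * h) - u ((a + \<theta>) * h) = ((a + 1) * h - (a + \<theta>) * h) * u1 z2"
    using MVT2[OF lt(2), of u u1] d1 by auto
  have z3: "u ((a + \<theta>) * h) - u (a * h) = \<theta> * h * u1 z1" "u ((a + 1) * h) - u ((a + \<theta>) * h) = (1 - \<theta>) * h * u1 z2"
    using z1(3) z2(3) by (simp_all add: algebra_simps)
  have "(1 - \<theta>) * u (a * h) + \<theta> * u ((a + 1) * h) - u ((a + \<theta>) * h)
    = \<theta> * (u ((a + 1) * h) - u ((a + \<theta>) * h)) - (1 - \<theta>) * (u ((a + \<theta>) * h) - u (a * h))"
    by (simp add: algebra_simps)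
  also have "\<dots> = \<theta> * (1 - \<theta>) * h * (u1 z2 - u1 z1)"
    unfolding z3 by (simp add: algebra_simps)
  also have "\<bar>\<dots>\<bar> \<le> 1 * h * (M * h)"
  proof -
    have "\<bar>z2 - z1\<bar> \<le> h" using z1 z2 by (simp add: distrib_right)
    then have "\<bar>u1 z2 - u1 z1\<bar> \<le> M * h"
      using lip[of z2 z1] M0 by (meson mult_left_mono order_trans)
    moreover have "\<theta> * (1 - \<theta>) \<le> 1 * 1" using \<theta> by (intro mult_mono) auto
    ultimately show ?thesis
      unfolding abs_mult using \<theta> h by (intro mult_mono) auto
  qed
  finally show ?thesis by (simp add: power2_eq_square mult_ac)
qed

text \<open>A missing node has |u| \<le> \<eta>, and the weights 1 - \<theta> and \<theta> add up to
  1, so truncation costs at most \<eta> whichever nodes are missing.\<close>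

lemma tent_interpolation_error:
  assumes u: "C2bdd M u" and h: "0 < h"
    and \<eta>: "\<And>y. real N * h \<le> \<bar>y\<bar> \<Longrightarrow> \<bar>u y\<bar> \<le> \<eta>"
  shows "\<bar>(\<Sum>j\<in>{- int N..int N}. tent h (real_of_int j * h - z) / h * u (real_of_int j * h)) - u z\<bar> \<le> M * h\<^sup>2 + \<eta>"
proof -
  obtain q :: int and \<theta> where \<theta>: "0 \<le> \<theta>" "\<theta> < 1" and z: "z = (real_of_int q + \<theta>) * h"
    by (rule grid_decomposition[OF h])
  let ?S = "{- int N..int N}"
  have out: "\<bar>u (real_of_int k * h)\<bar> \<le> \<eta>" if "k \<notin> ?S" for k
  proof (rule \<eta>)
    have "real N \<le> \<bar>real_of_int k\<bar>" using that by auto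
    then show "real N * h \<le> \<bar>real_of_int k * h\<bar>" using h by (simp add: abs_mult)
  qed
  let ?a = "(1 - \<theta>) * u (real_of_int q * h)" and ?b = "\<theta> * u ((real_of_int q + 1) * h)"
  have "\<eta> \<ge> 0" using \<eta>[of "real N * h"] abs_ge_zero order_trans abs_ge_self by blast
  have A: "\<bar>(if q \<in> ?S then ?a else 0) - ?a\<bar> \<le> (1 - \<theta>) * \<eta>"
    using out[of q] \<theta> \<open>\<eta> \<ge> 0\<close> by (auto simp only: abs_mult if_False if_True diff_0 abs_minus_cancel intro!: mult_mono split: if_splits) auto
  have B: "\<bar>(if q + 1 \<in> ?S then ?b else 0) - ?b\<bar> \<le> \<theta> * \<eta>"
    using out[of "q + 1"] \<theta> \<open>\<eta> \<ge> 0\<close> by (cases "q + 1 \<in> ?S") (auto simp: abs_mult intro!: mult_left_mono)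
  have C: "\<bar>?a + ?b - u z\<bar> \<le> M * h\<^sup>2"
    unfolding z by (rule linear_interpolation_error[OF u h \<theta>])
  have tri: "\<bar>x + y - w\<bar> \<le> m + e" if "\<bar>x - a\<bar> \<le> (1 - \<theta>) * e" "\<bar>y - b\<bar> \<le> \<theta> * e" "\<bar>a + b - w\<bar> \<le> m" for x y w a b m e
    using that unfolding left_diff_distrib mult_1 by linarith
  have eq: "(\<Sum>j\<in>?S. tent h (real_of_int j * h - z) / h * u (real_of_int j * h))
    = (if q \<in> ?S then ?a else 0) + (if q + 1 \<in> ?S then ?b else 0)"
    unfolding z tent_sum[OF h \<theta> finite_atLeastAtMost_int] by simp
  show ?thesis unfolding eq by (rule tri[OF A B C])
qed

lemma sum_tent_le_1:
  assumes h: "0 < h"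
  shows "(\<Sum>j\<in>{- int N..int N}. tent h (real_of_int j * h - z) / h) \<le> 1"
proof -
  obtain q :: int and \<theta> where \<theta>: "0 \<le> \<theta>" "\<theta> < 1" and z: "z = (real_of_int q + \<theta>) * h"
    by (rule grid_decomposition[OF h])
  show ?thesis
    using tent_sum[where v = "\<lambda>_. 1" and q = q, OF h \<theta> finite_atLeastAtMost_int[of "- int N" "int N"]] \<theta> unfolding z by simp
qed

lemma tent_eq_trap: "trap (k * h - h) (k * h) h y = tent h (y - k * h)"
  by (simp add: trap_def tent_def)

lemma tent_nonneg: "0 \<le> h \<Longrightarrow> 0 \<le> tent h t"
  by (auto simp: tent_def max_def)

section \<open>The discrete dispersion operator\<close>

context kernel
begin

definition dispersion :: "real \<Rightarrow> int \<Rightarrow> real" where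
  "dispersion h k = h * D2h h (\<lambda>k. \<beta> (real_of_int k * h)) k"

definition mass :: real where "mass = measure M1 UNIV + measure M2 UNIV"

lemma mass_nonneg: "0 \<le> mass" by (simp add: mass_def)

lemma tent_integrable:
  assumes "finite_measure M" "sets M = sets borel" "0 \<le> h"
  shows "integrable M (\<lambda>y. tent h (y - k * h))"
proof -
  have "trap (k * h - h) (k * h) h = (\<lambda>y. tent h (y - k * h))"
    by (rule ext) (rule tent_eq_trap)
  then show ?thesis
    using trap_integral_bound(3)[OF assms(1,2), of "k * h - h" "k * h" h] assms(3) by simp
qed

text \<open>Three consecutive grid values are the case p = k h - h, y = k h with step h, where the
  trapezoid degenerates to a tent. Of the factor h / h^2 there remains 1 / h, which turns the tent
  into a hat.\<close>

lemma dispersion_eq: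
  assumes h: "0 < h"
  shows "dispersion h k = (LINT y|M1. tent h (y - real_of_int k * h) / h) - (LINT y|M2. tent h (y - real_of_int k * h) / h)"
proof -
  have "dispersion h k = (\<beta> (real_of_int k * h - h) - \<beta> (real_of_int k * h - h + h) - \<beta> (real_of_int k * h) + \<beta> (real_of_int k * h + h)) / h"
    using h by (simp add: dispersion_def D2h_def power2_eq_square distrib_right left_diff_distrib)
  also have "\<dots> = ((LINT y|M1. tent h (y - real_of_int k * h)) - (LINT y|M2. tent h (y - real_of_int k * h))) / h"
    using h second_difference[of "real_of_int k * h - h" "real_of_int k * h" h]
    by (simp only: tent_eq_trap)
  finally show ?thesis by (simp add: diff_divide_distrib)
qed

text \<open>The hats are nonnegative and sum to at most 1 at every point, so a row of absolute
  values is bounded by the mass of both measures, in spite of the division by h^2.\<close>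

lemma sum_abs_dispersion:
  assumes h: "0 < h"
  shows "(\<Sum>j\<in>{- int N..int N}. \<bar>dispersion h (i - j)\<bar>) \<le> mass"
proof -
  have M: "(\<Sum>j\<in>{- int N..int N}. LINT y|M. tent h (y - real_of_int (i - j) * h) / h) \<le> measure M UNIV"
    if M: "finite_measure M" "sets M = sets borel" for M
  proof -
    interpret finite_measure M by fact
    have sp: "space M = UNIV" using sets_eq_imp_space_eq[OF M(2)] by simp
    have i: "integrable M (\<lambda>y. tent h (y - real_of_int (i - j) * h) / h)" for j
      using tent_integrable[OF M, of h "real_of_int (i - j)"] h by simp
    have "(\<Sum>j\<in>{- int N..int N}. LINT y|M. tent h (y - real_of_int (i - j) * h) / h)
      = (LINT y|M. (\<Sum>j\<in>{- int N..int N}. tent h (y - real_of_int (i - j) * h) / h))"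
      by (intro Bochner_Integration.integral_sum[symmetric] i)
    also have "\<dots> \<le> (LINT y|M. 1)"
    proof (rule integral_mono)
      fix y
      show "(\<Sum>j\<in>{- int N..int N}. tent h (y - real_of_int (i - j) * h) / h) \<le> 1"
        using sum_tent_le_1[where N = N and z = "real_of_int i * h - y", OF h] by (simp add: algebra_simps)
    qed (simp_all only: Bochner_Integration.integrable_sum[OF i] integrable_const)
    finally show ?thesis by (simp add: sp)
  qed
  have "\<bar>dispersion h k\<bar> \<le> (LINT y|M1. tent h (y - real_of_int k * h) / h) + (LINT y|M2. tent h (y - real_of_int k * h) / h)" for k
  proof -
    have "0 \<le> (LINT y|M. tent h (y - real_of_int k * h) / h)" for M :: "real measure"
      using h by (intro Bochner_Integration.integral_nonneg) (simp add: tent_nonneg)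
    from this[of M1] this[of M2] show ?thesis unfolding dispersion_eq[OF h] by linarith
  qed
  then have "(\<Sum>j\<in>{- int N..int N}. \<bar>dispersion h (i - j)\<bar>) \<le> (\<Sum>j\<in>{- int N..int N}.
     (LINT y|M1. tent h (y - real_of_int (i - j) * h) / h) + (LINT y|M2. tent h (y - real_of_int (i - j) * h) / h))"
    by (intro sum_mono)
  also have "\<dots> \<le> mass"
    unfolding sum.distrib mass_def
    by (intro add_mono M M1_finite M2_finite M1_sets M2_sets)
  finally show ?thesis .
qed

lemma dispersion_consistency:
  assumes u: "C2bdd M u" and h: "0 < h"
    and \<eta>: "\<And>y. real N * h \<le> \<bar>y\<bar> \<Longrightarrow> \<bar>u y\<bar> \<le> \<eta>"
  shows "\<bar>((LINT y|M1. u (real_of_int i * h - y)) - (LINT y|M2. u (real_of_int i * h - y)))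
     - (\<Sum>j\<in>{- int N..int N}. dispersion h (i - j) * u (real_of_int j * h))\<bar> \<le> (M * h\<^sup>2 + \<eta>) * mass"
proof -
  let ?S = "{- int N..int N}"
  define I where "I y = (\<Sum>j\<in>?S. tent h (y - real_of_int (i - j) * h) / h * u (real_of_int j * h))" for y
  have M: "\<bar>(LINT y|P. u (real_of_int i * h - y)) - (\<Sum>j\<in>?S. (LINT y|P. tent h (y - real_of_int (i - j) * h) / h) * u (real_of_int j * h))\<bar>
      \<le> (M * h\<^sup>2 + \<eta>) * measure P UNIV"
    if P: "finite_measure P" "sets P = sets borel" for P
  proof -
    interpret finite_measure P by fact
    have sp: "space P = UNIV" using sets_eq_imp_space_eq[OF P(2)] by simp
    have i: "integrable P (\<lambda>y. tent h (y - real_of_int (i - j) * h) / h * u (real_of_int j * h))" for j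
      using tent_integrable[OF P, of h "real_of_int (i - j)"] h by simp
    have iu: "integrable P (\<lambda>y. u (real_of_int i * h - y))"
      using C2bdd_affine[OF u, of "real_of_int i * h"]
      by (intro integrable_bounded_borel[OF P, of _ M])
         (auto intro: borel_measurable_continuous_onI C2bdd_continuous C2bdd_bound)
    have iI: "integrable P I" unfolding I_def by (intro Bochner_Integration.integrable_sum i)
    have "(\<Sum>j\<in>?S. (LINT y|P. tent h (y - real_of_int (i - j) * h) / h) * u (real_of_int j * h)) = (LINT y|P. I y)"
      unfolding I_def by (subst Bochner_Integration.integral_sum[OF i]) (simp only: integral_mult_left_zero)
    then have "(LINT y|P. u (real_of_int i * h - y)) - (\<Sum>j\<in>?S. (LINT y|P. tent h (y - real_of_int (i - j) * h) / h) * u (real_of_int j * h))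
       = (LINT y|P. u (real_of_int i * h - y) - I y)"
      using iI iu by simp
    moreover have "norm (LINT y|P. u (real_of_int i * h - y) - I y) \<le> (LINT y|P. M * h\<^sup>2 + \<eta>)"
    proof (rule Bochner_Integration.integral_norm_bound_integral)
      fix y
      \<comment> \<open>Since y - (i - j) h = j h - (i h - y), the hat sum at y is the interpolant
        of u at the point i h - y.\<close>
      have "I y = (\<Sum>j\<in>?S. tent h (real_of_int j * h - (real_of_int i * h - y)) / h * u (real_of_int j * h))"
        unfolding I_def by (intro sum.cong) (auto simp: algebra_simps)
      then show "norm (u (real_of_int i * h - y) - I y) \<le> M * h\<^sup>2 + \<eta>"
        using tent_interpolation_error[where N = N and z = "real_of_int i * h - y", OF u h \<eta>]
        by (simp add: abs_minus_commute)
    qed (use iI iu in auto)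
    ultimately show ?thesis by (simp add: sp mult.commute)
  qed
  have "(\<Sum>j\<in>?S. dispersion h (i - j) * u (real_of_int j * h))
    = (\<Sum>j\<in>?S. (LINT y|M1. tent h (y - real_of_int (i - j) * h) / h) * u (real_of_int j * h))
    - (\<Sum>j\<in>?S. (LINT y|M2. tent h (y - real_of_int (i - j) * h) / h) * u (real_of_int j * h))"
    unfolding dispersion_eq[OF h] by (simp only: left_diff_distrib sum_subtractf)
  moreover have tri: "\<bar>(a - b) - (c - d)\<bar> \<le> e * (m1 + m2)" if "\<bar>a - c\<bar> \<le> e * m1" "\<bar>b - d\<bar> \<le> e * m2" for a b c d e m1 m2 :: real
    using that unfolding distrib_left by linarith
  ultimately show ?thesis
    unfolding mass_def by (simp only:) (intro tri M M1_finite M2_finite M1_sets M2_sets)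
qed

end

section \<open>Lipschitz differential equations\<close>

text \<open>Joins norm and completeness, so that \<open>real \<Rightarrow>\<^sub>C real\<close> can
  serve as state space of a differential equation.\<close>

instance bcontfun :: (metric_space, banach) banach ..

lemma integral_exp:
  fixes c :: real
  assumes "0 < c" "0 \<le> t"
  shows "integral {0..t} (\<lambda>s. exp (c * s)) = (exp (c * t) - 1) / c"
proof -
  have "((\<lambda>s. exp (c * s)) has_integral (exp (c * t) / c - exp (c * 0) / c)) {0..t}"
  proof (rule fundamental_theorem_of_calculus[OF assms(2)])
    fix x
    have "((\<lambda>s. exp (c * s)) has_real_derivative exp (c * x) * c) (at x within {0..t})"
      by (auto intro!: derivative_eq_intros)
    from DERIV_cdivide[OF this, of c] assms(1)
    show "((\<lambda>s. exp (c * s) / c) has_vector_derivative exp (c * x)) (at x within {0..t})"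
      by (simp add: has_real_derivative_iff_has_vector_derivative)
  qed
  then show ?thesis by (simp add: integral_unique diff_divide_distrib)
qed

text \<open>Banach's fixed point theorem for the Picard operator, with the unknown rescaled by
  \<open>exp (2 * K * t)\<close> so that a single contraction covers the whole time interval.\<close>

lemma lipschitz_ode_solution:
  fixes F :: "'a::banach \<Rightarrow> 'a"
  assumes K: "0 < K" and lip: "\<And>x y. norm (F x - F y) \<le> K * norm (x - y)" and T: "0 \<le> T"
  shows "\<exists>x. x 0 = x0 \<and> (\<forall>t\<in>{0..T}. (x has_vector_derivative F (x t)) (at t within {0..T}))"
proof -
  define c where "c = 2 * K"
  have c: "0 < c" using K by (simp add: c_def)
  \<comment> \<open>Bounded continuous functions live on the whole line; clamping time to [0, T]
    extends the Picard iterates by constants.\<close>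
  define clamp where "clamp \<tau> = max 0 (min T \<tau>)" for \<tau>
  have clamp: "clamp \<tau> \<in> {0..T}" "\<tau> \<in> {0..T} \<Longrightarrow> clamp \<tau> = \<tau>" for \<tau>
    using T by (auto simp: clamp_def)
  have Fc: "continuous_on S F" for S
  proof (rule lipschitz_on_continuous_on)
    show "K-lipschitz_on S F"
      using K lip by (auto simp: lipschitz_on_def dist_norm)
  qed
  define G where "G y s = F (exp (c * s) *\<^sub>R y s)" for y :: "real \<Rightarrow> 'a" and s
  have Gc: "continuous_on S (G y)" if "continuous_on UNIV y" for y S
    unfolding G_def
    by (intro continuous_on_compose2[OF Fc[of UNIV]] continuous_intros continuous_on_subset[OF that]) auto
  define P where "P y \<tau> = exp (- c * clamp \<tau>) *\<^sub>R (x0 + integral {0..clamp \<tau>} (G y))" for y \<tau>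
  have Pb: "P y \<in> bcontfun" if y: "continuous_on UNIV y" for y
  proof -
    let ?H = "\<lambda>t. exp (- c * t) *\<^sub>R (x0 + integral {0..t} (G y))"
    have H: "continuous_on {0..T} ?H"
      by (intro continuous_intros indefinite_integral_continuous_1 integrable_continuous_real Gc[OF y])
    have "continuous_on UNIV (\<lambda>\<tau>. ?H (clamp \<tau>))"
      by (rule continuous_on_compose2[OF H]) (use clamp in \<open>auto simp: clamp_def intro!: continuous_intros\<close>)
    moreover have "bounded (?H ` {0..T})"
      by (intro compact_imp_bounded compact_continuous_image H) auto
    then have "bounded (range (\<lambda>\<tau>. ?H (clamp \<tau>)))"
      by (rule bounded_subset) (use clamp in auto)
    ultimately show ?thesis by (simp add: bcontfun_def P_def[abs_def])
  qed
  define \<P> where "\<P> y = Bcontfun (P (apply_bcontfun y))" for y :: "real \<Rightarrow>\<^sub>C 'a"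
  have \<P>: "apply_bcontfun (\<P> y) = P (apply_bcontfun y)" for y
    unfolding \<P>_def by (rule Bcontfun_inverse) (rule Pb, simp)
  have "dist (\<P> y) (\<P> z) \<le> 1 / 2 * dist y z" for y z
  proof (rule dist_bound)
    fix \<tau>
    define t where "t = clamp \<tau>"
    have t: "0 \<le> t" using clamp(1)[of \<tau>] by (simp add: t_def)
    have i: "G (apply_bcontfun w) integrable_on {0..t}" for w :: "real \<Rightarrow>\<^sub>C 'a"
      by (intro integrable_continuous_real Gc) simp
    have "norm (integral {0..t} (\<lambda>s. G y s - G z s)) \<le> integral {0..t} (\<lambda>s. K * dist y z * exp (c * s))"
    proof (rule Henstock_Kurzweil_Integration.integral_norm_bound_integral)
      show "(\<lambda>s. G y s - G z s) integrable_on {0..t}" by (intro integrable_diff i)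
      show "(\<lambda>s. K * dist y z * exp (c * s)) integrable_on {0..t}"
        by (intro integrable_continuous_real continuous_intros)
      fix s
      have "norm (G y s - G z s) \<le> K * norm (exp (c * s) *\<^sub>R y s - exp (c * s) *\<^sub>R z s)"
        unfolding G_def by (rule lip)
      also have "\<dots> = K * exp (c * s) * dist (y s) (z s)"
        by (simp add: dist_norm flip: scaleR_diff_right)
      also have "\<dots> \<le> K * exp (c * s) * dist y z"
        using K by (intro mult_left_mono dist_bounded) auto
      finally show "norm (G y s - G z s) \<le> K * dist y z * exp (c * s)" by (simp add: mult_ac)
    qed
    \<comment> \<open>The choice c = 2 K makes K / c equal to 1 / 2, and the factor exp (-c t) in P
      removes the exponential, so the contraction factor is 1 / 2 whatever T is.\<close>
    also have "\<dots> = dist y z * (exp (c * t) - 1) / 2"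
      using K t integral_exp[OF c t] by (simp add: c_def)
    also have "\<dots> \<le> dist y z * exp (c * t) / 2"
      by (simp add: right_diff_distrib)
    finally have b: "norm (integral {0..t} (G y) - integral {0..t} (G z)) \<le> dist y z * exp (c * t) / 2"
      using i by (simp add: integral_diff)
    have "dist (\<P> y \<tau>) (\<P> z \<tau>) = exp (- c * t) * norm (integral {0..t} (G y) - integral {0..t} (G z))"
      unfolding \<P> P_def t_def[symmetric] dist_norm by (simp flip: scaleR_diff_right)
    also have "\<dots> \<le> exp (- c * t) * (dist y z * exp (c * t) / 2)"
      using b by (intro mult_left_mono) auto
    also have "\<dots> = 1 / 2 * dist y z" by (simp add: exp_minus field_simps)
    finally show "dist (\<P> y \<tau>) (\<P> z \<tau>) \<le> 1 / 2 * dist y z" .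
  qed
  then obtain y where y: "\<P> y = y"
    using banach_fix_type[of "1 / 2" \<P>] by auto
  define x where "x t = x0 + integral {0..t} (G y)" for t
  have xy: "exp (c * t) *\<^sub>R y t = x t" if "t \<in> {0..T}" for t
  proof -
    have "y t = P y t" using \<P>[of y] y by simp
    then have "exp (c * t) *\<^sub>R y t = (exp (c * t) * exp (- c * t)) *\<^sub>R x t"
      using clamp(2)[OF that] by (simp add: P_def x_def)
    also have "exp (c * t) * exp (- c * t) = 1" by (simp flip: exp_add)
    finally show ?thesis by simp
  qed
  have "(x has_vector_derivative F (x t)) (at t within {0..T})" if "t \<in> {0..T}" for t
  proof -
    have "((\<lambda>t. integral {0..t} (G y)) has_vector_derivative G y t) (at t within {0..T})"
      by (rule integral_has_vector_derivative) (use that Gc in auto)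
    then have "(x has_vector_derivative G y t) (at t within {0..T})"
      unfolding x_def by (auto intro!: derivative_eq_intros)
    then show ?thesis by (simp add: G_def xy[OF that])
  qed
  then show ?thesis by (intro exI[of _ x]) (simp add: x_def)
qed

text \<open>At the first time s at which some component reaches the barrier, all components still
  satisfy the weak bound, so \<open>step\<close> applies and the barrier has the strictly larger
  slope. Just before s that component would then already lie above the barrier. As
  \<open>step\<close> may assume the bound for all components, a locally Lipschitz right-hand side
  suffices.\<close>

lemma exponential_barrier:
  fixes e e' :: "'i \<Rightarrow> real \<Rightarrow> real"
  assumes I: "finite I" and \<delta>: "0 < \<delta>"
    and der: "\<And>i t. i \<in> I \<Longrightarrow> t \<in> {0..T} \<Longrightarrow> (e i has_real_derivative e' i t) (at t within {0..T})"
    and init: "\<And>i. i \<in> I \<Longrightarrow> e i 0 = 0"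
    and step: "\<And>i t. i \<in> I \<Longrightarrow> t \<in> {0..T} \<Longrightarrow> (\<And>k. k \<in> I \<Longrightarrow> \<bar>e k t\<bar> \<le> \<delta> * exp (L * t)) \<Longrightarrow>
      \<bar>e' i t\<bar> < L * (\<delta> * exp (L * t))"
    and i: "i \<in> I" and t: "t \<in> {0..T}"
  shows "\<bar>e i t\<bar> \<le> \<delta> * exp (L * t)"
proof (rule ccontr)
  assume bad: "\<not> \<bar>e i t\<bar> \<le> \<delta> * exp (L * t)"
  define B where "B t = \<delta> * exp (L * t)" for t
  have cont: "continuous_on {0..T} (e k)" if "k \<in> I" for k
    using der[OF that] DERIV_continuous unfolding continuous_on_eq_continuous_within by blast
  have Bc: "continuous_on {0..T} B" unfolding B_def by (intro continuous_intros)
  define S where "S = (\<Union>k\<in>I. {\<tau>\<in>{0..T}. B \<tau> \<le> \<bar>e k \<tau>\<bar>})"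
  have "closed S"
    unfolding S_def
    by (intro closed_UN I ballI continuous_on_closed_Collect_le Bc continuous_intros cont) auto
  moreover have "bounded S" by (rule bounded_subset[of "{0..T}"]) (auto simp: S_def)
  ultimately have "compact S" by (simp add: compact_eq_bounded_closed)
  moreover have "S \<noteq> {}" using bad i t unfolding S_def B_def by force
  ultimately obtain s where s: "s \<in> S" "\<And>\<tau>. \<tau> \<in> S \<Longrightarrow> s \<le> \<tau>"
    using compact_attains_inf[of S] by blast
  from s(1) obtain k where k: "k \<in> I" "s \<in> {0..T}" "B s \<le> \<bar>e k s\<bar>" by (auto simp: S_def)
  have "0 < s"
  proof (rule ccontr)
    assume "\<not> 0 < s"
    then have "s = 0" using k by auto
    then show False using k init[of k] \<delta> by (simp add: B_def)
  qed
  have below: "\<bar>e m \<tau>\<bar> < B \<tau>" if "m \<in> I" "0 \<le> \<tau>" "\<tau> < s" for m \<tau>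
    using s(2)[of \<tau>] that k(2) unfolding S_def by force
  \<comment> \<open>\<open>step\<close> needs the bound at s itself for every component; it is the
    left limit of the strict bounds before s, and s > 0 because all components start at 0.\<close>
  have at_s: "\<bar>e m s\<bar> \<le> B s" if m: "m \<in> I" for m
  proof -
    have lim: "((\<lambda>\<tau>. B \<tau> - \<bar>e m \<tau>\<bar>) \<longlongrightarrow> B s - \<bar>e m s\<bar>) (at s within {0..s})"
    proof -
      have "continuous_on {0..s} (\<lambda>\<tau>. B \<tau> - \<bar>e m \<tau>\<bar>)"
        using k(2) by (intro continuous_intros continuous_on_subset[OF Bc] continuous_on_subset[OF cont[OF m]]) auto
      then show ?thesis using \<open>0 < s\<close> by (simp add: continuous_on_def)
    qed
    have "0 \<le> B s - \<bar>e m s\<bar>"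
    proof (rule tendsto_lowerbound[OF lim])
      show "\<forall>\<^sub>F \<tau> in at s within {0..s}. 0 \<le> B \<tau> - \<bar>e m \<tau>\<bar>"
        unfolding eventually_at using below[OF m] \<open>0 < s\<close>
        by (intro exI[of _ s]) (auto simp: less_imp_le)
      show "at s within {0..s} \<noteq> bot" using \<open>0 < s\<close> by (simp add: at_within_Icc_at_left)
    qed
    then show ?thesis by simp
  qed
  then have eq: "\<bar>e k s\<bar> = B s" using k by force
  have slope: "\<bar>e' k s\<bar> < L * B s"
    unfolding B_def by (rule step) (use k at_s in \<open>auto simp: B_def\<close>)
  \<comment> \<open>Multiplying by the sign replaces the absolute value by a function that is
    differentiable and touches the barrier at s.\<close>
  define \<sigma> where "\<sigma> = sgn (e k s)"
  have "B s > 0" using \<delta> by (simp add: B_def)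
  then have \<sigma>: "\<bar>\<sigma>\<bar> = 1" "\<sigma> * e k s = B s" using eq by (auto simp: \<sigma>_def abs_sgn_eq sgn_mult_self_eq abs_sgn mult.commute)
  have "((\<lambda>\<tau>. B \<tau> - \<sigma> * e k \<tau>) has_real_derivative L * B s - \<sigma> * e' k s) (at s within {0..T})"
    unfolding B_def by (auto intro!: derivative_eq_intros der k simp: k(2)[simplified])
  moreover have "0 < L * B s - \<sigma> * e' k s"
  proof -
    have "\<sigma> * e' k s \<le> \<bar>e' k s\<bar>" using \<sigma>(1) by (metis abs_ge_self abs_mult mult_1)
    then show ?thesis using slope by linarith
  qed
  ultimately obtain d where d: "d > 0" "\<And>h. h > 0 \<Longrightarrow> s - h \<in> {0..T} \<Longrightarrow> h < d \<Longrightarrow>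
      B (s - h) - \<sigma> * e k (s - h) < B s - \<sigma> * e k s"
    using has_real_derivative_pos_inc_left by blast
  define h where "h = min (d / 2) s"
  have h: "0 < h" "h < d" "s - h \<in> {0..T}" using d \<open>0 < s\<close> k(2) by (auto simp: h_def)
  have "B (s - h) < \<sigma> * e k (s - h)" using d(2)[OF h(1,3,2)] \<sigma>(2) by simp
  also have "\<dots> \<le> \<bar>e k (s - h)\<bar>" using \<sigma>(1) by (metis abs_ge_self abs_mult mult_1)
  finally show False using below[OF k(1), of "s - h"] h by simp
qed

section \<open>The semidiscrete system\<close>

lemma bounded_on_Icc:
  fixes f :: "real \<Rightarrow> real"
  assumes "continuous_on UNIV f"
  obtains A where "0 \<le> A" "\<And>x. \<bar>x\<bar> \<le> R \<Longrightarrow> \<bar>f x\<bar> \<le> A"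
proof -
  have "bounded (f ` {-R..R})"
    by (intro compact_imp_bounded compact_continuous_image continuous_on_subset[OF assms]) auto
  then obtain A where "\<forall>x\<in>f ` {-R..R}. norm x \<le> A" unfolding bounded_iff by blast
  then have "\<bar>f x\<bar> \<le> max A 0" if "\<bar>x\<bar> \<le> R" for x
  proof -
    have "x \<in> {-R..R}" using that by auto
    then show ?thesis using \<open>\<forall>x\<in>f ` {-R..R}. norm x \<le> A\<close> by force
  qed
  then show ?thesis using that[of "max A 0"] by simp
qed

lemma Ck_derivatives:
  assumes "Ck k f" "3 \<le> k"
  shows "(f has_real_derivative deriv f x) (at x)"
    and "(deriv f has_real_derivative deriv (deriv f) x) (at x)"
    and "continuous_on UNIV f" "continuous_on UNIV (deriv f)" "continuous_on UNIV (deriv (deriv f))"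
proof -
  have d: "((deriv ^^ j) f) differentiable (at x)" if "j < 3" for j x
    using assms that unfolding Ck_def by auto
  have c: "continuous_on UNIV ((deriv ^^ j) f)" if "j < 3" for j
    by (intro continuous_at_imp_continuous_on ballI differentiable_imp_continuous_within d that)
  show "(f has_real_derivative deriv f x) (at x)"
    using d[of 0 x] by (simp add: DERIV_deriv_iff_real_differentiable)
  show "(deriv f has_real_derivative deriv (deriv f) x) (at x)"
    using d[of 1 x] by (simp add: DERIV_deriv_iff_real_differentiable)
  show "continuous_on UNIV f" "continuous_on UNIV (deriv f)" "continuous_on UNIV (deriv (deriv f))"
    using c[of 0] c[of 1] c[of 2] by (simp_all add: numeral_2_eq_2)
qed

lemma Ck_lipschitz_on_Icc:
  assumes f: "Ck k f" "3 \<le> k"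
  obtains A where "0 \<le> A" "\<And>x y. \<bar>x\<bar> \<le> R \<Longrightarrow> \<bar>y\<bar> \<le> R \<Longrightarrow> \<bar>f x - f y\<bar> \<le> A * \<bar>x - y\<bar>"
proof -
  obtain A where A: "0 \<le> A" "\<And>x. \<bar>x\<bar> \<le> R \<Longrightarrow> \<bar>deriv f x\<bar> \<le> A"
    by (rule bounded_on_Icc[where R = R, OF Ck_derivatives(4)[OF f]]) blast
  have "\<bar>f x - f y\<bar> \<le> A * \<bar>x - y\<bar>" if "\<bar>x\<bar> \<le> R" "\<bar>y\<bar> \<le> R" for x y
    using field_differentiable_bound[of "{-R..R}" f "deriv f" A x y] Ck_derivatives(1)[OF f] A(2) that
    by (auto simp: abs_le_iff intro: has_field_derivative_at_within)
  then show ?thesis using that A(1) by blast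
qed

text \<open>M' depends only on f and M, so a single constant serves f (u t) for all t in
  [0, T].\<close>

lemma Ck_compose_C2bdd:
  assumes f: "Ck k f" "3 \<le> k"
  obtains M' where "\<And>v. C2bdd M v \<Longrightarrow> C2bdd M' (\<lambda>x. f (v x))"
proof -
  obtain A0 where A0: "0 \<le> A0" "\<And>x. \<bar>x\<bar> \<le> M \<Longrightarrow> \<bar>f x\<bar> \<le> A0"
    by (rule bounded_on_Icc[where R = M, OF Ck_derivatives(3)[OF f]]) blast
  obtain A1 where A1: "0 \<le> A1" "\<And>x. \<bar>x\<bar> \<le> M \<Longrightarrow> \<bar>deriv f x\<bar> \<le> A1"
    by (rule bounded_on_Icc[where R = M, OF Ck_derivatives(4)[OF f]]) blast
  obtain A2 where A2: "0 \<le> A2" "\<And>x. \<bar>x\<bar> \<le> M \<Longrightarrow> \<bar>deriv (deriv f) x\<bar> \<le> A2"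
    by (rule bounded_on_Icc[where R = M, OF Ck_derivatives(5)[OF f]]) blast
  define M' where "M' = A0 + A1 * M + A2 * M * M"
  have "C2bdd M' (\<lambda>x. f (v x))" if v: "C2bdd M v" for v
  proof -
    obtain v1 v2 where d1: "\<And>x. (v has_real_derivative v1 x) (at x)"
      and d2: "\<And>x. (v1 has_real_derivative v2 x) (at x)"
      and b: "\<And>x. \<bar>v x\<bar> \<le> M" "\<And>x. \<bar>v1 x\<bar> \<le> M" "\<And>x. \<bar>v2 x\<bar> \<le> M"
      using v unfolding C2bdd_def by blast
    have M0: "0 \<le> M" by (rule C2bdd_nonneg[OF v])
    have nn: "0 \<le> A1 * M" "0 \<le> A2 * M * M" using A1 A2 M0 by auto
    have e1: "((\<lambda>x. f (v x)) has_real_derivative v1 x * deriv f (v x)) (at x)" for x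
      using DERIV_chain'[where f = v and g = f, OF d1 Ck_derivatives(1)[OF f]] by (simp add: mult.commute)
    have e2: "((\<lambda>x. v1 x * deriv f (v x)) has_real_derivative v2 x * deriv f (v x) + (deriv (deriv f) (v x) * v1 x) * v1 x) (at x)" for x
      using DERIV_mult[OF d2 DERIV_chain'[where f = v and g = "deriv f", OF d1 Ck_derivatives(2)[OF f]]] by simp
    have "\<bar>f (v x)\<bar> \<le> M'" for x using A0(2)[OF b(1)[of x]] nn by (simp add: M'_def)
    moreover have "\<bar>v1 x * deriv f (v x)\<bar> \<le> M'" for x
    proof -
      have "\<bar>v1 x * deriv f (v x)\<bar> \<le> M * A1"
        unfolding abs_mult using A1 b M0 by (intro mult_mono) auto
      then show ?thesis using nn A0 by (simp add: M'_def mult.commute)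
    qed
    moreover have "\<bar>v2 x * deriv f (v x) + (deriv (deriv f) (v x) * v1 x) * v1 x\<bar> \<le> M'" for x
    proof -
      have "\<bar>v2 x * deriv f (v x)\<bar> \<le> M * A1"
        unfolding abs_mult using A1 b M0 by (intro mult_mono) auto
      moreover have "\<bar>(deriv (deriv f) (v x) * v1 x) * v1 x\<bar> \<le> A2 * M * M"
        unfolding abs_mult using A2 b M0 by (intro mult_mono) auto
      ultimately show ?thesis
        using A0(1) abs_triangle_ineq[of "v2 x * deriv f (v x)" "(deriv (deriv f) (v x) * v1 x) * v1 x"]
        by (simp add: M'_def mult.commute[of A1])
    qed
    ultimately show ?thesis
      unfolding C2bdd_def using e1 e2
      by (intro exI[of _ "\<lambda>x. v1 x * deriv f (v x)"]
          exI[of _ "\<lambda>x. v2 x * deriv f (v x) + deriv (deriv f) (v x) * v1 x * v1 x"] conjI allI)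
  qed
  then show ?thesis using that by blast
qed

lemma bounded_linear_apply_bcontfun:
  "bounded_linear (\<lambda>x :: 'a::topological_space \<Rightarrow>\<^sub>C 'b::real_normed_vector. apply_bcontfun x r)"
  by (rule bounded_linear_intro[of _ 1])
     (auto simp: plus_bcontfun.rep_eq scaleR_bcontfun.rep_eq norm_bounded)

section \<open>Stability, consistency and solvability of the finite system\<close>

context kernel
begin

definition semidiscrete :: "real \<Rightarrow> (real \<Rightarrow> real) \<Rightarrow> real \<Rightarrow> nat \<Rightarrow> (int \<Rightarrow> real) \<Rightarrow> int \<Rightarrow> real" where
  "semidiscrete \<kappa> f h N w i =
     - (\<Sum>j\<in>{- int N..int N}. h * \<beta> (real_of_int i * h - real_of_int j * h) * f (w j))
     - \<kappa> * (\<Sum>j\<in>{- int N..int N}. dispersion h (i - j) * w j)"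

text \<open>The condition on f concerns only the values that occur, which suits a locally Lipschitz
  f. The constant is free of h and N, and with it the growth rate of the error.\<close>

lemma semidiscrete_lipschitz:
  assumes h: "0 < h" "h \<le> 1" and \<kappa>: "0 \<le> \<kappa>" and A: "0 \<le> A" and D: "0 \<le> D"
    and f: "\<And>j. j \<in> {- int N..int N} \<Longrightarrow> \<bar>f (w j) - f (w' j)\<bar> \<le> A * \<bar>w j - w' j\<bar>"
    and w: "\<And>j. j \<in> {- int N..int N} \<Longrightarrow> \<bar>w j - w' j\<bar> \<le> D"
  shows "\<bar>semidiscrete \<kappa> f h N w i - semidiscrete \<kappa> f h N w' i\<bar> \<le> (A * (L1_norm + total_variation + sup_bound) + \<kappa> * mass) * D"
proof -
  let ?S = "{- int N..int N}"
  let ?b = "\<lambda>j. \<beta> (real_of_int i * h - real_of_int j * h)"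
  have 1: "\<bar>(\<Sum>j\<in>?S. h * ?b j * f (w j)) - (\<Sum>j\<in>?S. h * ?b j * f (w' j))\<bar> \<le> A * D * (L1_norm + total_variation + sup_bound)"
  proof -
    have "\<bar>(\<Sum>j\<in>?S. h * ?b j * f (w j)) - (\<Sum>j\<in>?S. h * ?b j * f (w' j))\<bar> \<le> (\<Sum>j\<in>?S. \<bar>h * ?b j * f (w j) - h * ?b j * f (w' j)\<bar>)"
      unfolding sum_subtractf[symmetric] by (rule sum_abs)
    also have "\<dots> \<le> (\<Sum>j\<in>?S. A * D * (h * \<bar>?b j\<bar>))"
    proof (rule sum_mono)
      fix j assume j: "j \<in> ?S"
      have "\<bar>f (w j) - f (w' j)\<bar> \<le> A * D"
        using f[OF j] mult_left_mono[OF w[OF j] A] by linarith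
      then have "h * \<bar>?b j\<bar> * \<bar>f (w j) - f (w' j)\<bar> \<le> h * \<bar>?b j\<bar> * (A * D)"
        using h by (intro mult_left_mono) auto
      then show "\<bar>h * ?b j * f (w j) - h * ?b j * f (w' j)\<bar> \<le> A * D * (h * \<bar>?b j\<bar>)"
        unfolding right_diff_distrib[symmetric] abs_mult abs_of_pos[OF h(1)] by (simp only: mult.commute)
    qed
    also have "\<dots> = A * D * (\<Sum>j\<in>?S. h * \<bar>?b j\<bar>)" by (simp only: sum_distrib_left)
    also have "\<dots> \<le> A * D * (L1_norm + total_variation + sup_bound)"
      using sum_abs_\<beta>[OF h] A D by (intro mult_left_mono) auto
    finally show ?thesis .
  qed
  have 2: "\<bar>(\<Sum>j\<in>?S. dispersion h (i - j) * w j) - (\<Sum>j\<in>?S. dispersion h (i - j) * w' j)\<bar> \<le> mass * D"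
  proof -
    have "\<bar>(\<Sum>j\<in>?S. dispersion h (i - j) * w j) - (\<Sum>j\<in>?S. dispersion h (i - j) * w' j)\<bar>
        \<le> (\<Sum>j\<in>?S. \<bar>dispersion h (i - j) * w j - dispersion h (i - j) * w' j\<bar>)"
      unfolding sum_subtractf[symmetric] by (rule sum_abs)
    also have "\<dots> \<le> (\<Sum>j\<in>?S. \<bar>dispersion h (i - j)\<bar> * D)"
    proof (rule sum_mono)
      fix j assume j: "j \<in> ?S"
      show "\<bar>dispersion h (i - j) * w j - dispersion h (i - j) * w' j\<bar> \<le> \<bar>dispersion h (i - j)\<bar> * D"
        unfolding right_diff_distrib[symmetric] abs_mult by (intro mult_left_mono w j) auto
    qed
    also have "\<dots> \<le> mass * D"
      unfolding sum_distrib_right[symmetric] using sum_abs_dispersion[OF h(1)] D by (intro mult_right_mono) auto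
    finally show ?thesis .
  qed
  have tri: "\<bar>(- a - \<kappa> * c) - (- b - \<kappa> * d)\<bar> \<le> x + \<kappa> * y" if "\<bar>a - b\<bar> \<le> x" "\<bar>c - d\<bar> \<le> y" for a b c d x y :: real
  proof -
    have "\<kappa> * \<bar>c - d\<bar> \<le> \<kappa> * y" using that \<kappa> by (intro mult_left_mono)
    then have "\<bar>\<kappa> * c - \<kappa> * d\<bar> \<le> \<kappa> * y" using \<kappa> by (simp add: abs_mult flip: right_diff_distrib)
    then show ?thesis using that by linarith
  qed
  show ?thesis
    unfolding semidiscrete_def by (rule order_trans[OF tri[OF 1 2]]) (simp add: algebra_simps)
qed

text \<open>The residual of the exact solution in the scheme. Decay of f (u) is assumed separately
  with the factor A; it will follow from f 0 = 0 and the Lipschitz bound.\<close>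

lemma semidiscrete_consistency:
  assumes h: "0 < h" "h \<le> 1" and \<kappa>: "0 \<le> \<kappa>"
    and u: "C2bdd M u" and fu: "C2bdd M' (\<lambda>x. f (u x))"
    and \<eta>: "\<And>y. real N * h \<le> \<bar>y\<bar> \<Longrightarrow> \<bar>u y\<bar> \<le> \<eta>" "\<And>y. real N * h \<le> \<bar>y\<bar> \<Longrightarrow> \<bar>f (u y)\<bar> \<le> A * \<eta>"
  shows "\<bar>- (LBINT y. \<beta> (real_of_int i * h - y) * f (u y))
      - \<kappa> * ((LINT y|M1. u (real_of_int i * h - y)) - (LINT y|M2. u (real_of_int i * h - y)))
      - semidiscrete \<kappa> f h N (\<lambda>j. u (real_of_int j * h)) i\<bar>
    \<le> M' * h\<^sup>2 * (3 * total_variation + L1_norm) + (L1_norm + sup_bound) * (A * \<eta>) + \<kappa> * ((M * h\<^sup>2 + \<eta>) * mass)"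
proof -
  have tri: "\<bar>- a - \<kappa> * c - (- b - \<kappa> * d)\<bar> \<le> x + \<kappa> * y" if "\<bar>a - b\<bar> \<le> x" "\<bar>c - d\<bar> \<le> y" for a b c d x y :: real
  proof -
    have "\<kappa> * \<bar>c - d\<bar> \<le> \<kappa> * y" using that \<kappa> by (intro mult_left_mono)
    then have "\<bar>\<kappa> * c - \<kappa> * d\<bar> \<le> \<kappa> * y" using \<kappa> by (simp add: abs_mult flip: right_diff_distrib)
    then show ?thesis using that by linarith
  qed
  show ?thesis
    unfolding semidiscrete_def
    by (rule tri[OF quadrature[OF fu h \<eta>(2)] dispersion_consistency[OF u h(1) \<eta>(1)]])
qed

lemma semidiscrete_solution:
  assumes h: "0 < h" and A: "\<And>x y. \<bar>f x - f y\<bar> \<le> A * \<bar>x - y\<bar>"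
    and \<phi>: "continuous_on UNIV \<phi>" "\<And>x. \<bar>\<phi> x\<bar> \<le> B" and T: "0 \<le> T"
  shows "\<exists>v. \<forall>i. v 0 i = \<phi> (real_of_int i * h) \<and>
     (\<forall>t\<in>{0..T}. ((\<lambda>\<tau>. v \<tau> i) has_real_derivative semidiscrete \<kappa> f h N (v t) i) (at t within {0..T}))"
proof -
  let ?S = "{- int N..int N}"
  \<comment> \<open>Letting the row index vary over all reals turns the system into an equation in the Banach space of
    bounded continuous functions, which is available for every \<open>N\<close> at once.\<close>
  define p where "p j r = h * \<beta> (r * h - real_of_int j * h)" for j :: int and r
  define d where "d j r = (\<beta> ((r - real_of_int j + 1) * h) - 2 * \<beta> ((r - real_of_int j) * h) + \<beta> ((r - real_of_int j - 1) * h)) / h" for j :: int and r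
  have bc: "q \<in> bcontfun" if "continuous_on UNIV q" "\<And>x. \<bar>q x\<bar> \<le> K" for q :: "real \<Rightarrow> real" and K
    using that unfolding bcontfun_def bounded_iff by auto
  have \<beta>c: "continuous_on UNIV (\<lambda>x. \<beta> (q x))" if "continuous_on UNIV q" for q :: "real \<Rightarrow> real"
    by (rule continuous_on_compose2[OF \<beta>_cont that]) auto
  have "p j \<in> bcontfun" for j
  proof (rule bc)
    show "continuous_on UNIV (p j)" unfolding p_def by (intro continuous_intros \<beta>c)
    show "\<bar>p j x\<bar> \<le> h * sup_bound" for x
      using h \<beta>_bounded by (simp add: p_def abs_mult)
  qed
  then have p: "apply_bcontfun (Bcontfun (p j)) = p j" for j by (rule Bcontfun_inverse)
  have "d j \<in> bcontfun" for j
  proof (rule bc)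
    show "continuous_on UNIV (d j)" unfolding d_def using h by (intro continuous_intros \<beta>c) auto
    show "\<bar>d j x\<bar> \<le> 4 * sup_bound / h" for x
      using h \<beta>_bounded[of "(x - real_of_int j + 1) * h"] \<beta>_bounded[of "(x - real_of_int j) * h"] \<beta>_bounded[of "(x - real_of_int j - 1) * h"]
      unfolding d_def by (simp only: abs_divide) (intro frac_le; linarith)
  qed
  then have d: "apply_bcontfun (Bcontfun (d j)) = d j" for j by (rule Bcontfun_inverse)
  have "(\<lambda>r. \<phi> (r * h)) \<in> bcontfun"
    by (rule bc[OF continuous_on_compose2[OF \<phi>(1)] \<phi>(2)]) (auto intro!: continuous_intros)
  then have \<phi>h: "apply_bcontfun (Bcontfun (\<lambda>r. \<phi> (r * h))) = (\<lambda>r. \<phi> (r * h))" by (rule Bcontfun_inverse)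
  \<comment> \<open>Finitely many values of the state enter as coefficients of the fixed functions
    \<open>p j\<close> and \<open>d j\<close>, which makes F Lipschitz. Its constant may depend on h
    and N, as only existence is at stake.\<close>
  define F where "F x = (\<Sum>j\<in>?S. f (apply_bcontfun x (real_of_int j)) *\<^sub>R (- Bcontfun (p j)))
      + (\<Sum>j\<in>?S. apply_bcontfun x (real_of_int j) *\<^sub>R ((- \<kappa>) *\<^sub>R Bcontfun (d j)))" for x :: "real \<Rightarrow>\<^sub>C real"
  define K where "K = (\<Sum>j\<in>?S. A * norm (Bcontfun (p j))) + (\<Sum>j\<in>?S. norm ((- \<kappa>) *\<^sub>R Bcontfun (d j)))"
  have lip: "norm (F x - F y) \<le> K * norm (x - y)" for x y
  proof -
    have ev: "\<bar>apply_bcontfun x r - apply_bcontfun y r\<bar> \<le> norm (x - y)" for r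
      using norm_bounded[of "x - y" r] by (simp add: minus_bcontfun.rep_eq)
    have A0: "0 \<le> A" using A[of 1 0] by simp
    have "F x - F y = (\<Sum>j\<in>?S. (f (x (real_of_int j)) - f (y (real_of_int j))) *\<^sub>R (- Bcontfun (p j)))
      + (\<Sum>j\<in>?S. (x (real_of_int j) - y (real_of_int j)) *\<^sub>R ((- \<kappa>) *\<^sub>R Bcontfun (d j)))"
      unfolding F_def scaleR_diff_left sum_subtractf by simp
    also have "norm \<dots> \<le> (\<Sum>j\<in>?S. A * norm (Bcontfun (p j)) * norm (x - y)) + (\<Sum>j\<in>?S. norm ((- \<kappa>) *\<^sub>R Bcontfun (d j)) * norm (x - y))"
    proof (rule norm_triangle_le, rule add_mono; rule sum_norm_le)
      fix j
      have "\<bar>f (x (real_of_int j)) - f (y (real_of_int j))\<bar> \<le> A * norm (x - y)"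
        using A[of "x (real_of_int j)" "y (real_of_int j)"] mult_left_mono[OF ev[of "real_of_int j"] A0] by linarith
      from mult_right_mono[OF this norm_ge_zero[of "Bcontfun (p j)"]]
      show "norm ((f (x (real_of_int j)) - f (y (real_of_int j))) *\<^sub>R (- Bcontfun (p j))) \<le> A * norm (Bcontfun (p j)) * norm (x - y)"
        by (simp add: mult_ac)
      show "norm ((x (real_of_int j) - y (real_of_int j)) *\<^sub>R ((- \<kappa>) *\<^sub>R Bcontfun (d j))) \<le> norm ((- \<kappa>) *\<^sub>R Bcontfun (d j)) * norm (x - y)"
        using mult_right_mono[OF ev[of "real_of_int j"] norm_ge_zero[of "(- \<kappa>) *\<^sub>R Bcontfun (d j)"]]
        unfolding norm_scaleR[of "x (real_of_int j) - y (real_of_int j)"] real_norm_def by (simp only: mult.commute)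
    qed
    also have "\<dots> = K * norm (x - y)"
      unfolding K_def distrib_right sum_distrib_right by (rule refl)
    finally show ?thesis .
  qed
  have K1: "0 < \<bar>K\<bar> + 1" by arith
  have "norm (F x - F y) \<le> (\<bar>K\<bar> + 1) * norm (x - y)" for x y
    by (rule order_trans[OF lip]) (intro mult_right_mono, auto)
  from lipschitz_ode_solution[OF K1 this T]
  obtain x where x: "x 0 = Bcontfun (\<lambda>r. \<phi> (r * h))"
    "\<And>t. t \<in> {0..T} \<Longrightarrow> (x has_vector_derivative F (x t)) (at t within {0..T})"
    by blast
  show ?thesis
  proof (intro exI[of _ "\<lambda>t i. apply_bcontfun (x t) (real_of_int i)"] allI conjI ballI)
    fix i :: int
    show "apply_bcontfun (x 0) (real_of_int i) = \<phi> (real_of_int i * h)" by (simp add: x(1) \<phi>h)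
    fix t assume t: "t \<in> {0..T}"
    interpret ev: bounded_linear "\<lambda>x :: real \<Rightarrow>\<^sub>C real. apply_bcontfun x (real_of_int i)"
      by (rule bounded_linear_apply_bcontfun)
    have di: "d j (real_of_int i) = dispersion h (i - j)" for j
      using h by (simp add: d_def dispersion_def D2h_def power2_eq_square)
    have "apply_bcontfun (F (x t)) (real_of_int i) = semidiscrete \<kappa> f h N (\<lambda>i. apply_bcontfun (x t) (real_of_int i)) i"
      unfolding F_def semidiscrete_def ev.add ev.sum ev.scaleR ev.neg p d di
      by (simp add: p_def sum_negf sum_distrib_left mult_ac)
    then show "((\<lambda>\<tau>. apply_bcontfun (x \<tau>) (real_of_int i)) has_real_derivative
       semidiscrete \<kappa> f h N (\<lambda>i. apply_bcontfun (x t) (real_of_int i)) i) (at t within {0..T})"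
      using ev.has_vector_derivative[OF x(2)[OF t]]
      by (simp add: has_real_derivative_iff_has_vector_derivative)
  qed
qed

end

section \<open>Convergence and existence for the truncated scheme\<close>

theorem theorem4p2:
  fixes \<kappa> s T :: real
    and \<alpha> f \<phi> :: "real \<Rightarrow> real"
    and M1 M2 :: "real measure"
    and u ut :: "real \<Rightarrow> real \<Rightarrow> real"
  assumes "\<kappa> > 0"
    and "cond_C1 \<alpha>"
    and "cond_C2 \<alpha> M1 M2"
    and "s > 9/2"
    and "Ck (nat \<lfloor>s\<rfloor> + 1) f"
    and "f 0 = 0"
    and "T > 0"
    and "in_Hs s \<phi>"
    and "C1_Hs s T u ut"
    and "u 0 = \<phi>"
    and "\<forall>t\<in>{0..T}. \<forall>x. ut t x + (LBINT y. deriv \<alpha> (x - y) * f (u t y))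
            + \<kappa> * ((\<integral>y. u t (x - y) \<partial>M1) - (\<integral>y. u t (x - y) \<partial>M2)) = 0"
  shows "\<exists>C h0 \<epsilon>0. h0 > 0 \<and> \<epsilon>0 > 0 \<and>
     (\<forall>h \<epsilon>. 0 < h \<and> h < h0 \<and> 0 < \<epsilon> \<and> \<epsilon> < \<epsilon>0 \<longrightarrow>
        (\<exists>N::nat. N > 0 \<and> (\<exists>v. solves_trunc \<kappa> \<alpha> f h T N \<phi> v) \<and>
           (\<forall>v. solves_trunc \<kappa> \<alpha> f h T N \<phi> v \<longrightarrow>
              (\<forall>t\<in>{0..T}. \<forall>i\<in>{-int N..int N}.
                 \<bar>u t (real_of_int i * h) - v t i\<bar> \<le> C * (h\<^sup>2 + \<epsilon>)))))"
proof -
  obtain g where "kernel (deriv \<alpha>) g M1 M2"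
    using kernel_deriv[OF assms(2,3)] by blast
  then interpret kernel "deriv \<alpha>" g M1 M2 .
  have \<kappa>: "0 \<le> \<kappa>" and s: "4 \<le> s" and T: "0 \<le> T" using assms(1,4,7) by auto
  have "4 \<le> \<lfloor>s\<rfloor>" using s by (simp add: le_floor_iff)
  then have k: "3 \<le> nat \<lfloor>s\<rfloor> + 1" by linarith
  note f = assms(5) k
  obtain M where uM: "\<And>t. t \<in> {0..T} \<Longrightarrow> C2bdd M (u t)"
    using C1_Hs_uniform_C2bdd[OF assms(9) s] by blast
  have \<phi>M: "C2bdd M \<phi>" using uM[of 0] T assms(10) by simp
  have M0: "0 \<le> M" by (rule C2bdd_nonneg[OF \<phi>M])
  \<comment> \<open>The margin 1 over the bound of u is matched by \<open>small\<close> below: an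
    error of at most 1 keeps the numerical values in [-R, R].\<close>
  define R where "R = M + 1"
  obtain A where A: "0 \<le> A" "\<And>x y. \<bar>x\<bar> \<le> R \<Longrightarrow> \<bar>y\<bar> \<le> R \<Longrightarrow> \<bar>f x - f y\<bar> \<le> A * \<bar>x - y\<bar>"
    by (rule Ck_lipschitz_on_Icc[where R = R, OF f]) blast
  obtain M' where M': "\<And>v. C2bdd M v \<Longrightarrow> C2bdd M' (\<lambda>x. f (v x))"
    by (rule Ck_compose_C2bdd[where M = M, OF f]) blast
  have M'0: "0 \<le> M'" by (rule C2bdd_nonneg[OF M'[OF \<phi>M]])
  have Bs0: "0 \<le> sup_bound" using \<beta>_bounded[of 0] by linarith
  \<comment> \<open>K is the Lipschitz constant of the discrete right-hand side and C1 bounds the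
    residual in units of h^2 + \<epsilon>. The extra 1 in L leaves room for the residual in the
    slope of the barrier.\<close>
  define K where "K = A * (L1_norm + total_variation + sup_bound) + \<kappa> * mass"
  define L where "L = K + 1"
  define C1 where "C1 = M' * (3 * total_variation + L1_norm) + (L1_norm + sup_bound) * A + \<kappa> * (M + 1) * mass"
  define C where "C = (C1 + 1) * exp (L * T)"
  have K0: "0 \<le> K" unfolding K_def
    using A(1) \<kappa> L1_norm_nonneg total_variation_nonneg Bs0 mass_nonneg by (intro add_nonneg_nonneg mult_nonneg_nonneg) auto
  have C10: "0 \<le> C1" unfolding C1_def
    using A(1) \<kappa> L1_norm_nonneg total_variation_nonneg Bs0 mass_nonneg M0 M'0 by (intro add_nonneg_nonneg mult_nonneg_nonneg) auto
  have C0: "0 < C" using C10 by (simp add: C_def)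
  have eqn: "ut t x = - (LBINT y. deriv \<alpha> (x - y) * f (u t y))
      - \<kappa> * ((LINT y|M1. u t (x - y)) - (LINT y|M2. u t (x - y)))" if "t \<in> {0..T}" for t x
  proof -
    have tri: "a = - b - c" if "a + b + c = 0" for a b c :: real using that by linarith
    show ?thesis by (rule tri) (rule assms(11)[rule_format, OF that])
  qed
  have trunc_iff: "solves_trunc \<kappa> \<alpha> f h T N \<phi> v \<longleftrightarrow> (\<forall>i\<in>{- int N..int N}. v 0 i = \<phi> (real_of_int i * h) \<and>
     (\<forall>t\<in>{0..T}. ((\<lambda>\<tau>. v \<tau> i) has_real_derivative semidiscrete \<kappa> f h N (v t) i) (at t within {0..T})))"
    for f h N v
    unfolding solves_trunc_def semidiscrete_def dispersion_def by (rule refl)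
  have cong: "semidiscrete \<kappa> f1 h N w i = semidiscrete \<kappa> f2 h N w i"
    if "\<And>j. j \<in> {- int N..int N} \<Longrightarrow> f1 (w j) = f2 (w j)" for f1 f2 h N w i
  proof -
    have "(\<Sum>j\<in>{- int N..int N}. h * deriv \<alpha> (real_of_int i * h - real_of_int j * h) * f1 (w j))
      = (\<Sum>j\<in>{- int N..int N}. h * deriv \<alpha> (real_of_int i * h - real_of_int j * h) * f2 (w j))"
      by (intro sum.cong) (simp_all add: that)
    then show ?thesis by (simp only: semidiscrete_def)
  qed
  have main: "\<exists>N>0. (\<exists>v. solves_trunc \<kappa> \<alpha> f h T N \<phi> v) \<and>
       (\<forall>v. solves_trunc \<kappa> \<alpha> f h T N \<phi> v \<longrightarrow>
          (\<forall>t\<in>{0..T}. \<forall>i\<in>{- int N..int N}. \<bar>u t (real_of_int i * h) - v t i\<bar> \<le> C * (h\<^sup>2 + \<epsilon>)))"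
    if h: "0 < h" "h \<le> 1" and \<epsilon>: "0 < \<epsilon>" and small: "C * (h\<^sup>2 + \<epsilon>) \<le> 1" for h \<epsilon>
  proof -
    obtain r where r: "\<And>t x. t \<in> {0..T} \<Longrightarrow> r \<le> \<bar>x\<bar> \<Longrightarrow> \<bar>u t x\<bar> \<le> \<epsilon>"
      using C1_Hs_uniform_decay[OF assms(9) s \<epsilon>] by blast
    \<comment> \<open>The grid has to reach beyond r, outside which |u| \<le> \<epsilon>; hence N is
      of size r / h at least, and the successor makes it positive.\<close>
    obtain n :: nat where n: "r / h < real n" using reals_Archimedean2 by blast
    define N where "N = Suc n"
    have "r < real n * h" using n h by (simp add: divide_less_eq)
    also have "\<dots> \<le> real N * h" using h by (simp add: N_def)
    finally have N: "r \<le> real N * h" by simp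
    have decay: "\<bar>u t y\<bar> \<le> \<epsilon>" if "t \<in> {0..T}" "real N * h \<le> \<bar>y\<bar>" for t y
      using r[OF that(1), of y] N that(2) by linarith
    let ?S = "{- int N..int N}"
    \<comment> \<open>C1 + 1 instead of C1 makes the residual strictly smaller than \<delta>, as the
      strict slope condition of the barrier demands.\<close>
    define \<delta> where "\<delta> = (C1 + 1) * (h\<^sup>2 + \<epsilon>)"
    have \<delta>: "0 < \<delta>" using C10 \<epsilon> by (simp add: \<delta>_def add_nonneg_pos)
    have B_le: "\<delta> * exp (L * t) \<le> C * (h\<^sup>2 + \<epsilon>)" if "t \<in> {0..T}" for t
    proof -
      have "exp (L * t) \<le> exp (L * T)" using that K0 by (simp add: L_def mult_left_mono)
      then have "\<delta> * exp (L * t) \<le> \<delta> * exp (L * T)" using \<delta> by (intro mult_left_mono) auto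
      then show ?thesis by (simp add: \<delta>_def C_def mult_ac)
    qed
    have residual: "\<bar>ut t (real_of_int i * h) - semidiscrete \<kappa> f h N (\<lambda>j. u t (real_of_int j * h)) i\<bar> \<le> C1 * (h\<^sup>2 + \<epsilon>)"
      if t: "t \<in> {0..T}" for t i
    proof -
      have "\<bar>ut t (real_of_int i * h) - semidiscrete \<kappa> f h N (\<lambda>j. u t (real_of_int j * h)) i\<bar>
        \<le> M' * h\<^sup>2 * (3 * total_variation + L1_norm) + (L1_norm + sup_bound) * (A * \<epsilon>) + \<kappa> * ((M * h\<^sup>2 + \<epsilon>) * mass)"
        unfolding eqn[OF t]
      proof (rule semidiscrete_consistency[OF h \<kappa> uM[OF t] M'[OF uM[OF t]] decay[OF t]])
        fix y assume y: "real N * h \<le> \<bar>y\<bar>"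
        have "\<bar>f (u t y) - f 0\<bar> \<le> A * \<bar>u t y - 0\<bar>"
          using C2bdd_bound[OF uM[OF t], of y] M0 by (intro A(2)) (auto simp: R_def)
        also have "\<dots> \<le> A * \<epsilon>" using decay[OF t y] A(1) by (intro mult_left_mono) auto
        finally show "\<bar>f (u t y)\<bar> \<le> A * \<epsilon>" using assms(6) by simp
      qed
      also have "\<dots> \<le> M' * (3 * total_variation + L1_norm) * (h\<^sup>2 + \<epsilon>) + (L1_norm + sup_bound) * A * (h\<^sup>2 + \<epsilon>) + \<kappa> * (M + 1) * mass * (h\<^sup>2 + \<epsilon>)"
      proof (intro add_mono)
        have "M' * (3 * total_variation + L1_norm) * h\<^sup>2 \<le> M' * (3 * total_variation + L1_norm) * (h\<^sup>2 + \<epsilon>)"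
          using M'0 total_variation_nonneg L1_norm_nonneg \<epsilon> by (intro mult_left_mono mult_nonneg_nonneg) auto
        then show "M' * h\<^sup>2 * (3 * total_variation + L1_norm) \<le> M' * (3 * total_variation + L1_norm) * (h\<^sup>2 + \<epsilon>)" by (simp only: mult_ac)
        have "(L1_norm + sup_bound) * A * \<epsilon> \<le> (L1_norm + sup_bound) * A * (h\<^sup>2 + \<epsilon>)"
          using A(1) Bs0 L1_norm_nonneg by (intro mult_left_mono mult_nonneg_nonneg) auto
        then show "(L1_norm + sup_bound) * (A * \<epsilon>) \<le> (L1_norm + sup_bound) * A * (h\<^sup>2 + \<epsilon>)" by (simp only: mult.assoc)
        have "M * h\<^sup>2 + \<epsilon> \<le> (M + 1) * (h\<^sup>2 + \<epsilon>)" using M0 \<epsilon> by (simp add: algebra_simps)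
        then have "\<kappa> * mass * (M * h\<^sup>2 + \<epsilon>) \<le> \<kappa> * mass * ((M + 1) * (h\<^sup>2 + \<epsilon>))"
          using \<kappa> mass_nonneg by (intro mult_left_mono mult_nonneg_nonneg) auto
        then show "\<kappa> * ((M * h\<^sup>2 + \<epsilon>) * mass) \<le> \<kappa> * (M + 1) * mass * (h\<^sup>2 + \<epsilon>)" by (simp only: mult_ac)
      qed
      also have "\<dots> = C1 * (h\<^sup>2 + \<epsilon>)" by (simp only: C1_def distrib_right)
      finally show ?thesis .
    qed
    \<comment> \<open>Stated for any fc that agrees with f on [-R, R]: it is applied to the clipped
      f, for which existence is known, and to f itself for an arbitrary solution.\<close>
    have error: "\<bar>u t (real_of_int i * h) - v t i\<bar> \<le> C * (h\<^sup>2 + \<epsilon>)"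
      if agree: "\<And>x. \<bar>x\<bar> \<le> R \<Longrightarrow> fc x = f x"
        and init: "\<And>i. i \<in> ?S \<Longrightarrow> v 0 i = \<phi> (real_of_int i * h)"
        and der: "\<And>i t. i \<in> ?S \<Longrightarrow> t \<in> {0..T} \<Longrightarrow>
          ((\<lambda>\<tau>. v \<tau> i) has_real_derivative semidiscrete \<kappa> fc h N (v t) i) (at t within {0..T})"
        and t: "t \<in> {0..T}" and i: "i \<in> ?S"
      for fc v t i
    proof -
      have "\<bar>u t (real_of_int i * h) - v t i\<bar> \<le> \<delta> * exp (L * t)"
      proof (rule exponential_barrier[where I = ?S and T = T and e = "\<lambda>i t. u t (real_of_int i * h) - v t i"
            and e' = "\<lambda>i t. ut t (real_of_int i * h) - semidiscrete \<kappa> fc h N (v t) i", OF _ \<delta> _ _ _ i t])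
        show "finite ?S" by simp
        fix i t assume it: "i \<in> ?S" "t \<in> {0..T}"
        show "((\<lambda>t. u t (real_of_int i * h) - v t i) has_real_derivative
            ut t (real_of_int i * h) - semidiscrete \<kappa> fc h N (v t) i) (at t within {0..T})"
          by (intro DERIV_diff C1_Hs_has_derivative[OF assms(9) s it(2)] der it)
        assume bd: "\<And>k. k \<in> ?S \<Longrightarrow> \<bar>u t (real_of_int k * h) - v t k\<bar> \<le> \<delta> * exp (L * t)"
        have uR: "\<bar>u t (real_of_int k * h)\<bar> \<le> R" for k
          using C2bdd_bound[OF uM[OF it(2)], of "real_of_int k * h"] by (simp add: R_def)
        have vR: "\<bar>v t k\<bar> \<le> R" if "k \<in> ?S" for k
          using bd[OF that] B_le[OF it(2)] small C2bdd_bound[OF uM[OF it(2)], of "real_of_int k * h"]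
          unfolding R_def by linarith
        have "semidiscrete \<kappa> fc h N (v t) i = semidiscrete \<kappa> f h N (v t) i"
          by (rule cong) (rule agree, rule vR)
        moreover have "\<bar>semidiscrete \<kappa> f h N (\<lambda>j. u t (real_of_int j * h)) i - semidiscrete \<kappa> f h N (v t) i\<bar>
          \<le> K * (\<delta> * exp (L * t))"
          unfolding K_def using \<delta> by (intro semidiscrete_lipschitz h \<kappa> A(1) A(2) uR vR bd) auto
        moreover have "C1 * (h\<^sup>2 + \<epsilon>) < \<delta> * exp (L * t)"
        proof -
          have "0 < h\<^sup>2 + \<epsilon>" using \<epsilon> by (simp add: add_nonneg_pos)
          then have "C1 * (h\<^sup>2 + \<epsilon>) < \<delta>" by (simp add: \<delta>_def distrib_right)
          also have "\<delta> * 1 \<le> \<delta> * exp (L * t)"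
            using \<delta> it(2) K0 by (intro mult_left_mono) (auto simp: L_def)
          finally show ?thesis by simp
        qed
        moreover have "K * (\<delta> * exp (L * t)) + \<delta> * exp (L * t) = L * (\<delta> * exp (L * t))"
          by (simp add: L_def distrib_right)
        ultimately show "\<bar>ut t (real_of_int i * h) - semidiscrete \<kappa> fc h N (v t) i\<bar> < L * (\<delta> * exp (L * t))"
          using residual[OF it(2), of i] by linarith
      next
        fix i assume "i \<in> ?S"
        then show "u 0 (real_of_int i * h) - v 0 i = 0" using init assms(10) by simp
      qed
      also have "\<dots> \<le> C * (h\<^sup>2 + \<epsilon>)" by (rule B_le[OF t])
      finally show ?thesis .
    qed
    \<comment> \<open>Clipping the argument to [-R, R] does not increase distances, so fc has the
      Lipschitz constant A on the whole line.\<close>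
    define fc where "fc x = f (max (- R) (min R x))" for x
    have agree: "fc x = f x" if "\<bar>x\<bar> \<le> R" for x
      using that by (simp add: fc_def abs_le_iff)
    have "\<bar>fc x - fc y\<bar> \<le> A * \<bar>x - y\<bar>" for x y
    proof -
      have "\<bar>fc x - fc y\<bar> \<le> A * \<bar>max (- R) (min R x) - max (- R) (min R y)\<bar>"
        unfolding fc_def using M0 by (intro A(2)) (auto simp: R_def)
      also have "\<dots> \<le> A * \<bar>x - y\<bar>"
        using A(1) by (intro mult_left_mono) auto
      finally show ?thesis .
    qed
    from semidiscrete_solution[OF h(1) this C2bdd_continuous[OF \<phi>M] C2bdd_bound[OF \<phi>M] T, of \<kappa> N]
    obtain v where v: "\<And>i. v 0 i = \<phi> (real_of_int i * h)"
      "\<And>i t. t \<in> {0..T} \<Longrightarrow> ((\<lambda>\<tau>. v \<tau> i) has_real_derivative semidiscrete \<kappa> fc h N (v t) i) (at t within {0..T})"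
      by blast
    have vR: "\<bar>v t i\<bar> \<le> R" if "t \<in> {0..T}" "i \<in> ?S" for t i
      using error[OF agree v that] small C2bdd_bound[OF uM[OF that(1)], of "real_of_int i * h"]
      unfolding R_def by linarith
    have "semidiscrete \<kappa> fc h N (v t) i = semidiscrete \<kappa> f h N (v t) i" if "t \<in> {0..T}" for t i
      by (rule cong) (rule agree, rule vR[OF that])
    then have "solves_trunc \<kappa> \<alpha> f h T N \<phi> v"
      unfolding trunc_iff using v by metis
    moreover have "\<bar>u t (real_of_int i * h) - w t i\<bar> \<le> C * (h\<^sup>2 + \<epsilon>)"
      if "solves_trunc \<kappa> \<alpha> f h T N \<phi> w" "t \<in> {0..T}" "i \<in> ?S" for w t i
      using error[of f w t i] that unfolding trunc_iff by blast
    moreover have "0 < N" by (simp add: N_def)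
    ultimately show ?thesis by blast
  qed
  show ?thesis
  \<comment> \<open>With h \<le> 1 the term h^2 is at most h, so each of h^2 and \<epsilon> is at
    most 1 / (2 C), which yields C (h^2 + \<epsilon>) \<le> 1.\<close>
  proof (rule exI[of _ C], rule exI[of _ "min 1 (1 / (2 * C))"], rule exI[of _ "1 / (2 * C)"], intro conjI allI impI)
    show "0 < min 1 (1 / (2 * C))" "0 < 1 / (2 * C)" using C0 by auto
    fix h \<epsilon> :: real
    assume a: "0 < h \<and> h < min 1 (1 / (2 * C)) \<and> 0 < \<epsilon> \<and> \<epsilon> < 1 / (2 * C)"
    have "h\<^sup>2 \<le> h" using a by (simp add: power2_eq_square mult_left_le)
    then have "h\<^sup>2 + \<epsilon> \<le> 1 / (2 * C) + 1 / (2 * C)" using a by linarith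
    then have "C * (h\<^sup>2 + \<epsilon>) \<le> C * (1 / (2 * C) + 1 / (2 * C))" using C0 by (intro mult_left_mono) auto
    also have "\<dots> = 1" using C0 by (simp add: field_simps)
    finally have "C * (h\<^sup>2 + \<epsilon>) \<le> 1" .
    then show "\<exists>N::nat. N > 0 \<and> (\<exists>v. solves_trunc \<kappa> \<alpha> f h T N \<phi> v) \<and>
           (\<forall>v. solves_trunc \<kappa> \<alpha> f h T N \<phi> v \<longrightarrow>
              (\<forall>t\<in>{0..T}. \<forall>i\<in>{-int N..int N}.
                 \<bar>u t (real_of_int i * h) - v t i\<bar> \<le> C * (h\<^sup>2 + \<epsilon>)))"
      using main[of h \<epsilon>] a by auto
  qed
qed

end
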